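(* A regular cardinal $\kappa>\omega_1$ is internally AP supercompact if and only if $\mathrm{ISP}(\kappa,\lambda)$ holds for all cardinals $\lambda\geq\kappa$.
   Context: $\mathrm{H}(\theta)$ is the set of all sets whose transitive closure has cardinality less than $\theta$. An elementary embedding $j:M\to N$ between transitive classes is non-trivial if there is an ordinal $\alpha\in M$ with $j(\alpha)>\alpha$; then $\mathrm{crit}(j)$ denotes the least such ordinal. Given cardinals $\kappa<\theta$, a non-trivial elementary embedding $j:M\to \mathrm{H}(\theta)$ is a small embedding for $\kappa$ if $M\in \mathrm{H}(\theta)$ is transitive and $j(\mathrm{crit}(j))=\kappa$. "For all sufficiently large (regular) cardinals $\theta$" means: there is an ordinal $\alpha$ such that the statement holds for all (regular) cardinals $\theta>\alpha$. Given transitive classes $M\subseteq N$, the pair $(M,N)$ satisfies the $\omega_1$-approximation property if $A\in M$ whenever $A\in N$ is such that $A\subseteq B$ for some $B\in M$, and $A\cap x\in M$ for every $x\in M$ which is countable in $M$. A cardinal $\kappa$ is internally AP supercompact if for all sufficiently large regular cardinals $\theta$ and all $x\in \mathrm{H}(\theta)$, there is a small embedding $j:M\to \mathrm{H}(\theta)$ for $\kappa$ and a transitive model $N$ of $\mathrm{ZFC}^-$ such that $x\in\mathrm{ran}(j)$ and: (i) $N\subseteq \mathrm{H}(\theta)$ and the pair $(N,\mathrm{H}(\theta))$ satisfies the $\omega_1$-approximation property; (ii) $M\in N$ and $M=\mathrm{H}(\delta)^N$ for some $N$-cardinal $\delta<\kappa$. $\mathcal{P}_\kappa(X)$ is the set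 of all subsets of $X$ of cardinality less than $\kappa$. A $\mathcal{P}_\kappa(\lambda)$-list is a sequence $\langle d_a\mid a\in\mathcal{P}_\kappa(\lambda)\rangle$ with $d_a\subseteq a$ for all $a$. For $\kappa$ uncountable regular and $\lambda\geq\kappa$ a cardinal, such a list is slender if for every sufficiently large cardinal $\theta$, there is a club $C$ in $\mathcal{P}_\kappa(\mathrm{H}(\theta))$ with $b\cap d_{X\cap\lambda}\in X$ for all $X\in C$ and all $b\in X\cap\mathcal{P}_{\omega_1}(\lambda)$. $\mathrm{ISP}(\kappa,\lambda)$ is the statement that for every slender $\mathcal{P}_\kappa(\lambda)$-list $\langle d_a\mid a\in\mathcal{P}_\kappa(\lambda)\rangle$, there exists $D\subseteq\lambda$ such that $\{a\in\mathcal{P}_\kappa(\lambda)\mid d_a=D\cap a\}$ is stationary in $\mathcal{P}_\kappa(\lambda)$. *)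

theory Defs
  imports "HOL-Library.Countable_Set" "HOL-Library.Equipollence"
begin

section \<open>The set-theoretic universe\<close>

text \<open>
  The universe of sets is a type \<open>'v\<close> whose elements are the sets; \<open>elts x\<close> is the extension of \<open>x\<close>,
  so \<open>x \<in> elts y\<close> is the membership relation of the universe. HOL sets of type \<open>'v set\<close> play the role
  of classes. As usual for set theory in HOL, Separation and Replacement are stated for arbitrary HOL
  predicates and functions. Hence the natural numbers, well-foundedness, and the functions between
  sets of the universe agree with those of HOL, and cardinalities may be compared by \<open>\<approx>\<close>,
  \<open>\<lesssim>\<close>, \<open>\<prec>\<close>. The Axiom of Choice is inherited from Hilbert choice; see \<open>choice\<close> below.
\<close>

class zfc =
  fixes elts :: "'a \<Rightarrow> 'a set"
  assumes extensionality: "elts x = elts y \<Longrightarrow> x = y"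
    and foundation: "elts x \<noteq> {} \<Longrightarrow> \<exists>y\<in>elts x. elts y \<inter> elts x = {}"
    and pairing: "\<exists>z. elts z = {x, y}"
    and union: "\<exists>z. elts z = (\<Union>y\<in>elts x. elts y)"
    and powerset: "\<exists>z. elts z = {y. elts y \<subseteq> elts x}"
    and infinity: "\<exists>z. (\<exists>e\<in>elts z. elts e = {}) \<and>
                       (\<forall>y\<in>elts z. \<exists>s\<in>elts z. elts s = insert y (elts y))"
    and separation: "\<exists>z. elts z = {y \<in> elts x. P y}"
    and replacement: "\<exists>z. elts z = F ` elts x"

lemma choice:
  fixes x :: "'v::zfc"
  assumes "\<forall>y\<in>elts x. elts y \<noteq> {}"
    and "\<forall>y\<in>elts x. \<forall>z\<in>elts x. y \<noteq> z \<longrightarrow> elts y \<inter> elts z = {}"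
  shows "\<exists>c. \<forall>y\<in>elts x. \<exists>!z. z \<in> elts c \<and> z \<in> elts y"
proof -
  define F where "F y = (SOME z. z \<in> elts y)" for y :: 'v
  have F: "F y \<in> elts y" if "y \<in> elts x" for y
    using assms(1) that unfolding F_def by (simp add: some_in_eq)
  obtain c where c: "elts c = F ` elts x"
    using replacement[of F x] by (rule exE)
  have "\<exists>!z. z \<in> elts c \<and> z \<in> elts y" if y: "y \<in> elts x" for y
  proof (rule ex1I[of _ "F y"])
    show "F y \<in> elts c \<and> F y \<in> elts y"
      using c F y by simp
  next
    fix z assume z: "z \<in> elts c \<and> z \<in> elts y"
    then obtain u where u: "u \<in> elts x" "z = F u"
      using c by auto
    then have "u = y"
      using z F[of u] y assms(2) by (metis disjoint_iff)
    with u show "z = F y" by simp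
  qed
  then show ?thesis by (intro exI[of _ c] ballI)
qed

text \<open>The set with a given extension; meaningful only when that extension is not a proper class.\<close>

definition vset :: "'v::zfc set \<Rightarrow> 'v" where
  "vset A = (THE x. elts x = A)"

definition transitive :: "'v::zfc set \<Rightarrow> bool" where
  "transitive A \<longleftrightarrow> (\<forall>x\<in>A. elts x \<subseteq> A)"

definition TC :: "'v::zfc \<Rightarrow> 'v set" where
  "TC x = {y. (\<lambda>u v. u \<in> elts v)\<^sup>+\<^sup>+ y x}"

section \<open>Ordinals and cardinals\<close>

text \<open>For ordinals, \<open>\<alpha> < \<beta>\<close> is \<open>\<alpha> \<in> elts \<beta>\<close>, and \<open>\<alpha> \<le> \<beta>\<close> is \<open>elts \<alpha> \<subseteq> elts \<beta>\<close>.\<close>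

definition Ord :: "'v::zfc \<Rightarrow> bool" where
  "Ord \<alpha> \<longleftrightarrow> transitive (elts \<alpha>) \<and> (\<forall>\<beta>\<in>elts \<alpha>. transitive (elts \<beta>))"

definition Card :: "'v::zfc \<Rightarrow> bool" where
  "Card \<kappa> \<longleftrightarrow> Ord \<kappa> \<and> (\<forall>\<alpha>\<in>elts \<kappa>. \<not> elts \<alpha> \<approx> elts \<kappa>)"

definition regular :: "'v::zfc \<Rightarrow> bool" where
  "regular \<kappa> \<longleftrightarrow> Card \<kappa> \<and> infinite (elts \<kappa>) \<and>
     (\<forall>A\<subseteq>elts \<kappa>. (\<forall>\<beta>\<in>elts \<kappa>. \<exists>\<alpha>\<in>A. elts \<beta> \<subseteq> elts \<alpha>) \<longrightarrow> A \<approx> elts \<kappa>)"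

definition omega1 :: "'v::zfc" where
  "omega1 = (THE \<alpha>. Ord \<alpha> \<and> uncountable (elts \<alpha>) \<and> (\<forall>\<beta>\<in>elts \<alpha>. countable (elts \<beta>)))"

definition Hset :: "'v::zfc \<Rightarrow> 'v set" where
  "Hset \<theta> = {x. TC x \<prec> elts \<theta>}"

section \<open>Elementary and small embeddings\<close>

text \<open>Formulas of the language of set theory, with variables named by natural numbers.\<close>

datatype fm = Mem nat nat | Eq nat nat | Neg fm | Conj fm fm | Exists nat fm

primrec sat :: "'v::zfc set \<Rightarrow> fm \<Rightarrow> (nat \<Rightarrow> 'v) \<Rightarrow> bool" where
  "sat M (Mem m n) s \<longleftrightarrow> s m \<in> elts (s n)"
| "sat M (Eq m n) s \<longleftrightarrow> s m = s n"
| "sat M (Neg \<phi>) s \<longleftrightarrow> \<not> sat M \<phi> s"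
| "sat M (Conj \<phi> \<psi>) s \<longleftrightarrow> sat M \<phi> s \<and> sat M \<psi> s"
| "sat M (Exists n \<phi>) s \<longleftrightarrow> (\<exists>x\<in>M. sat M \<phi> (s(n := x)))"

definition elementary_embedding :: "('v::zfc \<Rightarrow> 'v) \<Rightarrow> 'v set \<Rightarrow> 'v set \<Rightarrow> bool" where
  "elementary_embedding j M N \<longleftrightarrow> j ` M \<subseteq> N \<and>
     (\<forall>\<phi> s. range s \<subseteq> M \<longrightarrow> (sat M \<phi> s \<longleftrightarrow> sat N \<phi> (j \<circ> s)))"

definition nontrivial :: "('v::zfc \<Rightarrow> 'v) \<Rightarrow> 'v set \<Rightarrow> bool" where
  "nontrivial j M \<longleftrightarrow> (\<exists>\<alpha>\<in>M. Ord \<alpha> \<and> \<alpha> \<in> elts (j \<alpha>))"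

definition crit :: "('v::zfc \<Rightarrow> 'v) \<Rightarrow> 'v set \<Rightarrow> 'v" where
  "crit j M = (THE \<alpha>. \<alpha> \<in> M \<and> Ord \<alpha> \<and> \<alpha> \<in> elts (j \<alpha>) \<and>
     (\<forall>\<beta>\<in>M. Ord \<beta> \<and> \<beta> \<in> elts (j \<beta>) \<longrightarrow> elts \<alpha> \<subseteq> elts \<beta>))"

definition small_embedding :: "'v::zfc \<Rightarrow> 'v \<Rightarrow> ('v \<Rightarrow> 'v) \<Rightarrow> 'v \<Rightarrow> bool" where
  "small_embedding \<kappa> \<theta> j M \<longleftrightarrow> Card \<kappa> \<and> Card \<theta> \<and> \<kappa> \<in> elts \<theta> \<and>
     M \<in> Hset \<theta> \<and> transitive (elts M) \<and>
     elementary_embedding j (elts M) (Hset \<theta>) \<and> nontrivial j (elts M) \<and>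
     j (crit j (elts M)) = \<kappa>"

section \<open>Notions relativized to a class\<close>

text \<open>
  A name ending in \<open>_in\<close> denotes the relativization to the class \<open>N\<close> of the notion in question: every
  quantifier ranges over \<open>N\<close>. Here \<open>ext N x\<close> is the extension of \<open>x\<close> in the structure \<open>(N, \<in>)\<close>; it is
  \<open>elts x\<close> if \<open>N\<close> is transitive and \<open>x \<in> N\<close>.
\<close>

definition ext :: "'v::zfc set \<Rightarrow> 'v \<Rightarrow> 'v set" where
  "ext N x = {z \<in> N. z \<in> elts x}"

text \<open>\<open>p\<close> is the Kuratowski pair of \<open>x\<close> and \<open>y\<close>.\<close>

definition opair_in :: "'v::zfc set \<Rightarrow> 'v \<Rightarrow> 'v \<Rightarrow> 'v \<Rightarrow> bool" where
  "opair_in N x y p \<longleftrightarrow> (\<forall>z\<in>N. z \<in> ext N p \<longleftrightarrow> ext N z = {x} \<or> ext N z = {x, y})"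

definition rel_in :: "'v::zfc set \<Rightarrow> 'v \<Rightarrow> 'v \<Rightarrow> 'v \<Rightarrow> bool" where
  "rel_in N r x y \<longleftrightarrow> (\<exists>p\<in>ext N r. opair_in N x y p)"

definition injection_in :: "'v::zfc set \<Rightarrow> 'v \<Rightarrow> 'v \<Rightarrow> 'v \<Rightarrow> bool" where
  "injection_in N f x y \<longleftrightarrow>
     (\<forall>p\<in>ext N f. \<exists>u\<in>ext N x. \<exists>v\<in>ext N y. opair_in N u v p) \<and>
     (\<forall>u\<in>ext N x. \<exists>!v. v \<in> ext N y \<and> rel_in N f u v) \<and>
     (\<forall>u\<in>ext N x. \<forall>u'\<in>ext N x. \<forall>v\<in>ext N y. rel_in N f u v \<and> rel_in N f u' v \<longrightarrow> u = u')"

definition bijection_in :: "'v::zfc set \<Rightarrow> 'v \<Rightarrow> 'v \<Rightarrow> 'v \<Rightarrow> bool" where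
  "bijection_in N f x y \<longleftrightarrow> injection_in N f x y \<and> (\<forall>v\<in>ext N y. \<exists>u\<in>ext N x. rel_in N f u v)"

definition transitive_in :: "'v::zfc set \<Rightarrow> 'v \<Rightarrow> bool" where
  "transitive_in N x \<longleftrightarrow> (\<forall>y\<in>ext N x. ext N y \<subseteq> ext N x)"

definition Ord_in :: "'v::zfc set \<Rightarrow> 'v \<Rightarrow> bool" where
  "Ord_in N \<alpha> \<longleftrightarrow> transitive_in N \<alpha> \<and> (\<forall>\<beta>\<in>ext N \<alpha>. transitive_in N \<beta>)"

definition Card_in :: "'v::zfc set \<Rightarrow> 'v \<Rightarrow> bool" where
  "Card_in N \<delta> \<longleftrightarrow> Ord_in N \<delta> \<and> (\<forall>\<alpha>\<in>ext N \<delta>. \<not> (\<exists>f\<in>N. bijection_in N f \<alpha> \<delta>))"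

definition Limit_in :: "'v::zfc set \<Rightarrow> 'v \<Rightarrow> bool" where
  "Limit_in N \<alpha> \<longleftrightarrow> Ord_in N \<alpha> \<and> ext N \<alpha> \<noteq> {} \<and> (\<forall>\<beta>\<in>ext N \<alpha>. \<exists>\<gamma>\<in>ext N \<alpha>. \<beta> \<in> ext N \<gamma>)"

definition omega_in :: "'v::zfc set \<Rightarrow> 'v \<Rightarrow> bool" where
  "omega_in N w \<longleftrightarrow> Limit_in N w \<and> (\<forall>\<alpha>\<in>ext N w. \<not> Limit_in N \<alpha>)"

definition countable_in :: "'v::zfc set \<Rightarrow> 'v \<Rightarrow> bool" where
  "countable_in N x \<longleftrightarrow> (\<exists>w\<in>N. omega_in N w \<and> (\<exists>f\<in>N. injection_in N f x w))"

definition TC_in :: "'v::zfc set \<Rightarrow> 'v \<Rightarrow> 'v \<Rightarrow> bool" where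
  "TC_in N x t \<longleftrightarrow> transitive_in N t \<and> ext N x \<subseteq> ext N t \<and>
     (\<forall>u\<in>N. transitive_in N u \<and> ext N x \<subseteq> ext N u \<longrightarrow> ext N t \<subseteq> ext N u)"

text \<open>\<open>H(\<delta>)\<close> as computed in \<open>N\<close>. In \<open>N\<close>, a set has cardinality less than the cardinal \<open>\<delta>\<close> if it is
  in bijection with some ordinal below \<open>\<delta>\<close>.\<close>

definition Hset_in :: "'v::zfc set \<Rightarrow> 'v \<Rightarrow> 'v set" where
  "Hset_in N \<delta> = {x \<in> N. \<exists>t\<in>N. TC_in N x t \<and> (\<exists>\<alpha>\<in>ext N \<delta>. \<exists>f\<in>N. bijection_in N f t \<alpha>)}"

definition well_orders_in :: "'v::zfc set \<Rightarrow> 'v \<Rightarrow> 'v \<Rightarrow> bool" where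
  "well_orders_in N r a \<longleftrightarrow>
     (\<forall>x\<in>ext N a. \<not> rel_in N r x x) \<and>
     (\<forall>x\<in>ext N a. \<forall>y\<in>ext N a. \<forall>z\<in>ext N a. rel_in N r x y \<and> rel_in N r y z \<longrightarrow> rel_in N r x z) \<and>
     (\<forall>x\<in>ext N a. \<forall>y\<in>ext N a. x = y \<or> rel_in N r x y \<or> rel_in N r y x) \<and>
     (\<forall>b\<in>N. ext N b \<subseteq> ext N a \<and> ext N b \<noteq> {} \<longrightarrow>
        (\<exists>m\<in>ext N b. \<forall>y\<in>ext N b. y = m \<or> rel_in N r m y))"

text \<open>
  \<open>ZFC\<close> without Power Set, with Replacement in the form of the Collection scheme and with Choice in the
  form of the well-ordering principle (without Power Set, the usual variants of these two axioms are
  not equivalent). In the schemes, the remaining values of \<open>s\<close> are the parameters.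
\<close>

definition models_ZFC_minus :: "'v::zfc set \<Rightarrow> bool" where
  "models_ZFC_minus N \<longleftrightarrow>
     \<comment> \<open>Extensionality\<close>
     (\<forall>x\<in>N. \<forall>y\<in>N. ext N x = ext N y \<longrightarrow> x = y) \<and>
     \<comment> \<open>Foundation\<close>
     (\<forall>x\<in>N. ext N x \<noteq> {} \<longrightarrow> (\<exists>y\<in>ext N x. ext N y \<inter> ext N x = {})) \<and>
     \<comment> \<open>Pairing\<close>
     (\<forall>x\<in>N. \<forall>y\<in>N. \<exists>z\<in>N. ext N z = {x, y}) \<and>
     \<comment> \<open>Union\<close>
     (\<forall>x\<in>N. \<exists>z\<in>N. ext N z = (\<Union>y\<in>ext N x. ext N y)) \<and>
     \<comment> \<open>Infinity\<close>
     (\<exists>z\<in>N. (\<exists>e\<in>ext N z. ext N e = {}) \<and>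
        (\<forall>y\<in>ext N z. \<exists>s\<in>ext N z. ext N s = insert y (ext N y))) \<and>
     \<comment> \<open>Separation\<close>
     (\<forall>\<phi> s. range s \<subseteq> N \<longrightarrow>
        (\<forall>a\<in>N. \<exists>b\<in>N. ext N b = {x \<in> ext N a. sat N \<phi> (s(0 := x))})) \<and>
     \<comment> \<open>Collection\<close>
     (\<forall>\<phi> s. range s \<subseteq> N \<longrightarrow>
        (\<forall>a\<in>N. (\<forall>x\<in>ext N a. \<exists>y\<in>N. sat N \<phi> (s(0 := x, 1 := y))) \<longrightarrow>
           (\<exists>b\<in>N. \<forall>x\<in>ext N a. \<exists>y\<in>ext N b. sat N \<phi> (s(0 := x, 1 := y))))) \<and>
     \<comment> \<open>Choice\<close>
     (\<forall>a\<in>N. \<exists>r\<in>N. well_orders_in N r a)"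

section \<open>Internally AP supercompact cardinals\<close>

definition omega1_approximation :: "'v::zfc set \<Rightarrow> 'v set \<Rightarrow> bool" where
  "omega1_approximation M N \<longleftrightarrow>
     (\<forall>A\<in>N. (\<exists>B\<in>M. elts A \<subseteq> elts B) \<and>
        (\<forall>x\<in>M. countable_in M x \<longrightarrow> vset (elts A \<inter> elts x) \<in> M) \<longrightarrow> A \<in> M)"

definition internally_AP_supercompact :: "'v::zfc \<Rightarrow> bool" where
  "internally_AP_supercompact \<kappa> \<longleftrightarrow> Card \<kappa> \<and>
     (\<exists>\<alpha>. Ord \<alpha> \<and> (\<forall>\<theta>. regular \<theta> \<and> \<alpha> \<in> elts \<theta> \<longrightarrow>
        (\<forall>x\<in>Hset \<theta>. \<exists>j M N. small_embedding \<kappa> \<theta> j M \<and>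
           transitive (elts N) \<and> models_ZFC_minus (elts N) \<and> x \<in> j ` elts M \<and>
           elts N \<subseteq> Hset \<theta> \<and> omega1_approximation (elts N) (Hset \<theta>) \<and>
           M \<in> elts N \<and>
           (\<exists>\<delta>\<in>elts N. Card_in (elts N) \<delta> \<and> \<delta> \<in> elts \<kappa> \<and> elts M = Hset_in (elts N) \<delta>))))"

section \<open>Slender lists and ISP\<close>

definition Pk :: "'v::zfc \<Rightarrow> 'v set \<Rightarrow> 'v set" where
  "Pk \<kappa> A = {a. elts a \<subseteq> A \<and> elts a \<prec> elts \<kappa>}"

text \<open>Closed means closed under unions of nonempty increasing sequences of length less than \<open>\<kappa>\<close>.\<close>

definition club :: "'v::zfc \<Rightarrow> 'v set \<Rightarrow> 'v set \<Rightarrow> bool" where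
  "club \<kappa> A C \<longleftrightarrow> C \<subseteq> Pk \<kappa> A \<and>
     (\<forall>x\<in>Pk \<kappa> A. \<exists>y\<in>C. elts x \<subseteq> elts y) \<and>
     (\<forall>\<alpha>\<in>elts \<kappa>. \<forall>f. elts \<alpha> \<noteq> {} \<and> (\<forall>\<xi>\<in>elts \<alpha>. f \<xi> \<in> C) \<and>
        (\<forall>\<eta>\<in>elts \<alpha>. \<forall>\<xi>\<in>elts \<eta>. elts (f \<xi>) \<subseteq> elts (f \<eta>)) \<longrightarrow>
        vset (\<Union>\<xi>\<in>elts \<alpha>. elts (f \<xi>)) \<in> C)"

definition stationary :: "'v::zfc \<Rightarrow> 'v set \<Rightarrow> 'v set \<Rightarrow> bool" where
  "stationary \<kappa> A S \<longleftrightarrow> S \<subseteq> Pk \<kappa> A \<and> (\<forall>C. club \<kappa> A C \<longrightarrow> S \<inter> C \<noteq> {})"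

text \<open>Only the values of \<open>d\<close> on \<open>Pk \<kappa> (elts \<mu>)\<close> matter.\<close>

definition Pk_list :: "'v::zfc \<Rightarrow> 'v \<Rightarrow> ('v \<Rightarrow> 'v) \<Rightarrow> bool" where
  "Pk_list \<kappa> \<mu> d \<longleftrightarrow> (\<forall>a\<in>Pk \<kappa> (elts \<mu>). elts (d a) \<subseteq> elts a)"

definition slender :: "'v::zfc \<Rightarrow> 'v \<Rightarrow> ('v \<Rightarrow> 'v) \<Rightarrow> bool" where
  "slender \<kappa> \<mu> d \<longleftrightarrow>
     (\<exists>\<alpha>. Ord \<alpha> \<and> (\<forall>\<theta>. Card \<theta> \<and> \<alpha> \<in> elts \<theta> \<longrightarrow>
        (\<exists>C. club \<kappa> (Hset \<theta>) C \<and>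
           (\<forall>X\<in>C. \<forall>b\<in>elts X \<inter> Pk omega1 (elts \<mu>).
              vset (elts b \<inter> elts (d (vset (elts X \<inter> elts \<mu>)))) \<in> elts X))))"

definition ISP :: "'v::zfc \<Rightarrow> 'v \<Rightarrow> bool" where
  "ISP \<kappa> \<mu> \<longleftrightarrow>
     (\<forall>d. Pk_list \<kappa> \<mu> d \<and> slender \<kappa> \<mu> d \<longrightarrow>
        (\<exists>D. elts D \<subseteq> elts \<mu> \<and>
           stationary \<kappa> (elts \<mu>) {a \<in> Pk \<kappa> (elts \<mu>). elts (d a) = elts D \<inter> elts a}))"

end

theory Submission
  imports Defs
begin

text \<open>
  For the forward direction, let \<open>j : M \<rightarrow> H(\<theta>)\<close> and \<open>N\<close> be as in the definition, with everything relevant in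
  the range of \<open>j\<close>, and let \<open>X\<close> be the pointwise image under \<open>j\<close> of the preimage of some \<open>H(\<theta>\<^sub>0)\<close>.
  Then \<open>X\<close> is in every club in the range of \<open>j\<close>. By slenderness and approximation, the preimage \<open>D'\<close> of
  \<open>d\<^sub>a\<close>, where \<open>a = X \<inter> \<lambda>\<close>, is in \<open>N\<close> and hence in \<open>M\<close>; so \<open>D = j(D')\<close> satisfies \<open>d\<^sub>a = D \<inter> a\<close>, and
  \<open>a\<close> is in every club from \<open>X\<close>. So the set guessed by \<open>D\<close> is stationary by elementarity.

  For the converse, following Viale and Weiss, ISP at \<open>\<lambda> = \<bar>H(\<theta>\<^sub>1)\<bar>\<close> yields \<open>X \<prec> H(\<theta>\<^sub>1)\<close> of size less than \<open>\<kappa>\<close>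
  with \<open>X \<inter> \<kappa> \<in> \<kappa>\<close> which is guessing: every subset of an element of \<open>X\<close> whose countable pieces are in \<open>X\<close>
  agrees on \<open>X\<close> with an element of \<open>X\<close>. The transitive collapse \<open>N\<close> of \<open>X\<close> has the approximation property,
  and the inverse of the collapse restricts to a small embedding of the image \<open>M\<close> of \<open>H(\<theta>)\<close>.

  Clubs are handled through closure under operations: for regular \<open>\<kappa> > \<omega>\<^sub>1\<close>, the members of
  \<open>P\<^sub>\<kappa>(A)\<close> closed under a map from finite sequences in \<open>A\<close> to \<open>P\<^sub>\<kappa>(A)\<close> form a club, and every club
  contains one of this form.
\<close>

section \<open>Small classes and well-foundedness\<close>

text \<open>Elementarity is never applied to a formula about clubs or stationary sets. Supposing
  that every D fails in ISP, a club refuting D is chosen for all D at once, and all these clubs are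
  packed into one operation that takes D as an argument; j only needs a code of it in its range. The
  D that j produces later is then contradicted by a club under whose operation X was closed from the
  start. The obstacle there is that approximation speaks of sets countable in N, slenderness of
  truly countable elements of X. A countable piece and its enumeration have to be brought from N
  into M, where j can act on them; that M is an H(\<delta>) of N makes this possible. The converse
  crosses the same gap the other way: X contains an enumeration of each of its countable elements,
  so that their collapses are countable in N. Elementarity of X becomes closure under countably many
  Skolem operations. The cardinal \<theta>1 above \<theta> makes room for \<theta> and H(\<theta>)
  as elements of X; their collapses are \<delta> and M.\<close>

definition small :: "'v::zfc set \<Rightarrow> bool" where
  "small A \<longleftrightarrow> (\<exists>x. elts x = A)"

lemma vset_elts [simp]: "vset (elts x) = x"
  unfolding vset_def by (rule the_equality) (auto intro: extensionality)

lemma elts_vset: "small A \<Longrightarrow> elts (vset A) = A"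
  unfolding small_def using vset_elts by metis

lemma small_elts [simp, intro]: "small (elts x)"
  unfolding small_def by blast

lemma small_subset: "small A \<Longrightarrow> B \<subseteq> A \<Longrightarrow> small B"
proof -
  assume "small A" "B \<subseteq> A"
  then obtain x where x: "elts x = A" unfolding small_def by blast
  obtain z where "elts z = {y \<in> elts x. y \<in> B}"
    using separation[of x "\<lambda>y. y \<in> B"] by (rule exE)
  with x \<open>B \<subseteq> A\<close> show "small B" unfolding small_def by (intro exI[of _ z]) auto
qed

lemma elts_vset_subset: "B \<subseteq> elts x \<Longrightarrow> elts (vset B) = B"
  by (rule elts_vset[OF small_subset[OF small_elts]])

lemma small_lepoll:
  fixes A B :: "'v::zfc set"
  assumes "small A" "B \<lesssim> A" shows "small B"
proof -
  obtain x where x: "elts x = A" using assms(1) unfolding small_def by blast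
  obtain g where g: "B \<subseteq> g ` elts x" using assms(2) x unfolding lepoll_iff by blast
  obtain z where "elts z = g ` elts x" using replacement[of g x] by (rule exE)
  with g have "B \<subseteq> elts z" by simp
  then show ?thesis by (rule small_subset[OF small_elts])
qed

lemma small_image: "small A \<Longrightarrow> small (f ` A)" for f :: "'v::zfc \<Rightarrow> 'v"
  by (rule small_lepoll[OF _ image_lepoll])

lemma small_empty [simp, intro]: "small {}"
  by (rule small_subset[OF small_elts empty_subsetI])

lemma small_doubleton [simp, intro]: "small {x, y}"
  unfolding small_def by (rule pairing)

lemma small_singleton [simp, intro]: "small {x}"
  using small_doubleton[of x x] by simp

lemma small_UN:
  fixes A :: "'v::zfc \<Rightarrow> 'v set"
  assumes "small I" "\<And>i. i \<in> I \<Longrightarrow> small (A i)" shows "small (\<Union>i\<in>I. A i)"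
proof -
  obtain x where x: "elts x = (\<lambda>i. vset (A i)) ` I"
    using small_image[OF assms(1)] unfolding small_def by blast
  obtain z where "elts z = (\<Union>y\<in>elts x. elts y)" using union[of x] by (rule exE)
  also have "\<dots> = (\<Union>i\<in>I. A i)" using assms(2) x by (simp add: elts_vset)
  finally show ?thesis unfolding small_def by blast
qed

lemma small_Un: "small A \<Longrightarrow> small B \<Longrightarrow> small (A \<union> B)"
  using small_UN[of "{vset A, vset B}" elts] by (simp add: elts_vset)

lemma small_insert [intro]: "small A \<Longrightarrow> small (insert x A)"
  using small_Un[of "{x}" A] by simp

lemma small_Pow: "small (vset ` Pow (elts x))"
proof -
  obtain z where z: "elts z = {y. elts y \<subseteq> elts x}" using powerset[of x] by (rule exE)
  have "vset ` Pow (elts x) \<subseteq> elts z"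
  proof safe
    fix A assume "A \<subseteq> elts x"
    then show "vset A \<in> elts z" unfolding z mem_Collect_eq
      by (subst elts_vset[OF small_subset[OF small_elts]])
  qed
  then show ?thesis using small_subset by blast
qed

lemma mem_irrefl: "x \<notin> elts x"
proof -
  have "elts (vset {x}) = {x}" by (simp add: elts_vset)
  then show ?thesis using foundation[of "vset {x}"] by auto
qed

section \<open>The von Neumann natural numbers\<close>

primrec vnat :: "nat \<Rightarrow> 'v::zfc" where
  "vnat 0 = vset {}"
| "vnat (Suc n) = vset (insert (vnat n) (elts (vnat n)))"

lemma elts_vnat: "elts (vnat n :: 'v::zfc) = vnat ` {..<n}"
proof (induction n)
  case (Suc n)
  have "elts (vnat (Suc n) :: 'v) = insert (vnat n) (elts (vnat n))"
    unfolding vnat.simps by (rule elts_vset) (simp add: small_insert)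
  then show ?case unfolding Suc.IH lessThan_Suc image_insert .
qed (simp add: elts_vset)

lemma vnat_inject: "vnat m = (vnat n :: 'v::zfc) \<longleftrightarrow> m = n"
proof -
  have "vnat m \<noteq> (vnat n :: 'v)" if "m < n" for m n
  proof -
    have "vnat m \<in> elts (vnat n :: 'v)" unfolding elts_vnat using that by simp
    then show ?thesis by (metis mem_irrefl)
  qed
  then show ?thesis by (metis linorder_neqE_nat)
qed

lemma small_range_vnat: "small (range (vnat :: nat \<Rightarrow> 'v::zfc))"
proof -
  obtain z e where e: "e \<in> elts z" "elts e = {}"
    and s: "\<forall>y\<in>elts (z::'v). \<exists>s\<in>elts z. elts s = insert y (elts y)" using infinity by blast
  have "vnat n \<in> elts z" for n
  proof (induction n)
    case 0
    have "vnat 0 = e" by (metis e(2) vnat.simps(1) vset_elts)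
    then show ?case using e by simp
  next
    case (Suc n)
    then obtain s where "s \<in> elts z" "elts s = insert (vnat n) (elts (vnat n))" using s by blast
    then show ?case by (metis vnat.simps(2) vset_elts)
  qed
  then show ?thesis using small_subset[of "elts z"] by blast
qed

text \<open>Replacement is indexed by elements of the universe only, so the index n is replaced by
  \<open>vnat n\<close>.\<close>

lemma small_countable_UN:
  fixes A :: "nat \<Rightarrow> 'v::zfc set"
  assumes "\<And>n. small (A n)" shows "small (\<Union>n. A n)"
proof -
  have "(\<Union>n. A n) = (\<Union>k\<in>range (vnat :: nat \<Rightarrow> 'v). A (inv vnat k))"
    by (simp add: inv_f_f inj_def vnat_inject)
  then show ?thesis using small_UN[OF small_range_vnat] assms by metis
qed

section \<open>Transitive closures and well-foundedness of membership\<close>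

lemma TC_step: "y \<in> TC x \<Longrightarrow> elts y \<subseteq> TC x"
  unfolding TC_def by (auto intro: tranclp_into_tranclp2)

lemma elts_subset_TC: "elts x \<subseteq> TC x"
  unfolding TC_def by auto

lemma transitive_TC: "transitive (TC x)"
  unfolding transitive_def using TC_step by blast

lemma TC_least: "transitive t \<Longrightarrow> elts x \<subseteq> t \<Longrightarrow> TC x \<subseteq> t"
proof
  fix y assume t: "transitive t" "elts x \<subseteq> t" and "y \<in> TC x"
  then have "(\<lambda>u v. u \<in> elts v)\<^sup>+\<^sup>+ y x" unfolding TC_def by simp
  then show "y \<in> t"
    by (induction rule: converse_tranclp_induct) (use t transitive_def in blast)+
qed

lemma TC_transitive: "transitive (elts x) \<Longrightarrow> TC x = elts x"
  using TC_least elts_subset_TC by blast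

lemma small_TC [simp, intro]: "small (TC x)"
proof -
  \<comment> \<open>\<open>L n\<close> is the extension of the n-th iterated union of x. The union
    of all \<open>L n\<close> is transitive and therefore bounds \<open>TC x\<close>.\<close>
  define L where "L = rec_nat (elts x) (\<lambda>_ A. \<Union>y\<in>A. elts y)"
  have "small (L n)" for n by (induction n) (auto simp: L_def intro: small_UN)
  then have "small (\<Union>n. L n)" by (rule small_countable_UN)
  moreover have "elts y \<subseteq> L (Suc n)" if "y \<in> L n" for y n using that by (auto simp: L_def)
  then have "transitive (\<Union>n. L n)" unfolding transitive_def by blast
  moreover have "elts x \<subseteq> (\<Union>n. L n)" using L_def by (metis UN_upper UNIV_I old.nat.simps(6))
  ultimately show ?thesis using small_subset TC_least by metis
qed

text \<open>Foundation speaks of sets only. A class with an element x is cut down to the set of its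
  members that are x or lie in the transitive closure of x; a minimal element of this set is minimal
  in the class.\<close>

lemma wf_elts: "wf {(u, v). u \<in> elts v}"
proof (rule wfI_min)
  fix x :: 'a and Q assume x: "x \<in> Q"
  define s where "s = vset (insert x (TC x) \<inter> Q)"
  have s: "elts s = insert x (TC x) \<inter> Q"
    unfolding s_def by (rule elts_vset) (rule small_subset[of "insert x (TC x)"], simp_all add: small_insert)
  have "x \<in> elts s" unfolding s using x by simp
  then have "elts s \<noteq> {}" by (metis empty_iff)
  from foundation[OF this] obtain y where y: "y \<in> elts s" "elts y \<inter> elts s = {}" by (rule bexE)
  have "y = x \<or> y \<in> TC x" using y(1) unfolding s by (elim IntE insertE) simp_all
  then have "elts y \<subseteq> insert x (TC x)" by (metis TC_step elts_subset_TC subset_insertI2)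
  then show "\<exists>z\<in>Q. \<forall>y. (y, z) \<in> {(u, v). u \<in> elts v} \<longrightarrow> y \<notin> Q"
    using y s by auto
qed

lemma elts_induct [case_names step]: "(\<And>x. (\<And>y. y \<in> elts x \<Longrightarrow> P y) \<Longrightarrow> P x) \<Longrightarrow> P x"
  using wf_induct_rule[OF wf_elts, of P x] by auto

lemma elts_minimal:
  assumes "P x" obtains y where "P y" "\<And>z. z \<in> elts y \<Longrightarrow> \<not> P z"
  using wfE_min[OF wf_elts, of x "Collect P"] assms by auto

section \<open>Kuratowski pairs\<close>

definition opair :: "'v::zfc \<Rightarrow> 'v \<Rightarrow> 'v" where
  "opair x y = vset {vset {x}, vset {x, y}}"

lemma elts_opair: "elts (opair x y) = {vset {x}, vset {x, y}}"
  unfolding opair_def by (simp add: elts_vset)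

lemma vset_doubleton_eq: "vset {a, b} = vset {c, d} \<longleftrightarrow> {a, b} = {c, d}"
  by (metis elts_vset small_doubleton)

lemma opair_inject [simp]: "opair a b = opair c d \<longleftrightarrow> a = c \<and> b = d"
proof
  assume "opair a b = opair c d"
  then have "{vset {a, a}, vset {a, b}} = {vset {c, c}, vset {c, d}}"
    using elts_opair by (metis insert_absorb2)
  then show "a = c \<and> b = d" unfolding doubleton_eq_iff vset_doubleton_eq by blast
qed simp

section \<open>Ordinals\<close>

lemma Ord_mem: "Ord \<alpha> \<Longrightarrow> \<beta> \<in> elts \<alpha> \<Longrightarrow> Ord \<beta>"
  unfolding Ord_def transitive_def by blast

lemma Ord_trans: "Ord \<alpha> \<Longrightarrow> \<beta> \<in> elts \<alpha> \<Longrightarrow> \<gamma> \<in> elts \<beta> \<Longrightarrow> \<gamma> \<in> elts \<alpha>"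
  unfolding Ord_def transitive_def by blast

lemma Ord_vset: "small A \<Longrightarrow> transitive A \<Longrightarrow> (\<And>x. x \<in> A \<Longrightarrow> Ord x) \<Longrightarrow> Ord (vset A)"
  by (simp add: Ord_def elts_vset)

text \<open>Induction on both arguments: if neither ordinal belongs to the other, the two induction
  hypotheses place every element of each in the other.\<close>

lemma Ord_linear: "Ord \<alpha> \<Longrightarrow> Ord \<beta> \<Longrightarrow> \<alpha> \<in> elts \<beta> \<or> \<alpha> = \<beta> \<or> \<beta> \<in> elts \<alpha>"
proof (induction \<alpha> arbitrary: \<beta> rule: elts_induct)
  case (step \<alpha>)
  note IH1 = step.IH
  from step.prems show ?case
  proof (induction \<beta> rule: elts_induct)
    case (step \<beta>)
    have "elts \<alpha> = elts \<beta>" if n: "\<alpha> \<notin> elts \<beta>" "\<beta> \<notin> elts \<alpha>"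
    proof (intro equalityI subsetI)
      fix c assume c: "c \<in> elts \<alpha>"
      then have "c \<in> elts \<beta> \<or> c = \<beta> \<or> \<beta> \<in> elts c"
        using IH1 step.prems Ord_mem by blast
      with c n show "c \<in> elts \<beta>" using Ord_trans[OF step.prems(1) c] by blast
    next
      fix c assume c: "c \<in> elts \<beta>"
      then have "\<alpha> \<in> elts c \<or> \<alpha> = c \<or> c \<in> elts \<alpha>"
        using step.IH step.prems Ord_mem by blast
      with c n show "c \<in> elts \<alpha>" using Ord_trans[OF step.prems(2) c] by blast
    qed
    then show ?case using extensionality by blast
  qed
qed

lemma Ord_subset_iff:
  assumes "Ord \<alpha>" "Ord \<beta>" shows "elts \<alpha> \<subseteq> elts \<beta> \<longleftrightarrow> \<alpha> \<in> elts \<beta> \<or> \<alpha> = \<beta>"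
  using Ord_linear[OF assms] Ord_trans[OF assms(2)] mem_irrefl by blast

lemma Ord_vnat [simp, intro]: "Ord (vnat n)"
proof (induction n rule: less_induct)
  case (less n)
  then show ?case
    unfolding Ord_def by (auto simp: elts_vnat transitive_def) 
qed

lemma Ord_least:
  assumes "Ord \<alpha>" "P \<alpha>"
  obtains \<beta> where "Ord \<beta>" "P \<beta>" "\<And>\<gamma>. \<gamma> \<in> elts \<beta> \<Longrightarrow> \<not> P \<gamma>"
  using elts_minimal[of "\<lambda>\<beta>. Ord \<beta> \<and> P \<beta>" \<alpha>] assms Ord_mem by metis

section \<open>The collapse of a class\<close>

text \<open>The Mostowski collapse, by recursion over all sets and not only those in X.
  Extensionality of X enters only with injectivity.\<close>

definition collapse :: "'v::zfc set \<Rightarrow> 'v \<Rightarrow> 'v" where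
  "collapse X = wfrec {(u, v). u \<in> elts v} (\<lambda>f x. vset (f ` (elts x \<inter> X)))"

lemma collapse_eq: "collapse X x = vset (collapse X ` (elts x \<inter> X))"
  unfolding collapse_def
  by (subst wfrec[OF wf_elts]) (auto simp: cut_def intro!: arg_cong[of _ _ vset] image_cong)

lemma elts_collapse: "elts (collapse X x) = collapse X ` (elts x \<inter> X)"
  by (subst collapse_eq, rule elts_vset) (auto intro: small_image small_subset[OF small_elts])

lemma collapse_inj:
  assumes ext: "\<And>x y. x \<in> X \<Longrightarrow> y \<in> X \<Longrightarrow> elts x \<inter> X = elts y \<inter> X \<Longrightarrow> x = y"
  shows "inj_on (collapse X) X"
proof -
  have "\<forall>y\<in>X. collapse X x = collapse X y \<longrightarrow> x = y" if "x \<in> X" for x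
    using that
  proof (induction x rule: elts_induct)
    case (step x)
    show ?case
    proof (intro ballI impI)
      fix y assume y: "y \<in> X" and eq: "collapse X x = collapse X y"
      then have im: "collapse X ` (elts x \<inter> X) = collapse X ` (elts y \<inter> X)"
        by (metis elts_collapse)
      have "elts x \<inter> X \<subseteq> elts y \<inter> X"
      proof
        fix u assume u: "u \<in> elts x \<inter> X"
        then obtain v where "v \<in> elts y \<inter> X" "collapse X u = collapse X v" using im by blast
        then show "u \<in> elts y \<inter> X" using step.IH[of u] u by auto
      qed
      moreover have "elts y \<inter> X \<subseteq> elts x \<inter> X"
      proof
        fix v assume v: "v \<in> elts y \<inter> X"
        then obtain u where "u \<in> elts x \<inter> X" "collapse X u = collapse X v" using im by (metis imageE imageI)
        then show "v \<in> elts x \<inter> X" using step.IH[of u] v by auto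
      qed
      ultimately show "x = y" using ext step.prems y by blast
    qed
  qed
  then show ?thesis unfolding inj_on_def by blast
qed

lemma transitive_collapse_image: "transitive (collapse X ` X)"
  unfolding transitive_def by (auto simp: elts_collapse)

lemma collapse_mem_iff:
  assumes "inj_on (collapse X) X" "x \<in> X" "y \<in> X"
  shows "collapse X x \<in> elts (collapse X y) \<longleftrightarrow> x \<in> elts y"
  using assms by (auto simp: elts_collapse inj_on_def)

text \<open>Meant for the transitive part \<open>X \<inter> elts \<kappa>\<close> of a model X,
  which the collapse leaves pointwise fixed.\<close>

lemma collapse_fixes:
  assumes "transitive A" "A \<subseteq> X" "x \<in> A" shows "collapse X x = x"
  using assms(3)
proof (induction x rule: elts_induct)
  case (step x)
  have sub: "elts x \<subseteq> A" using assms(1) step.prems unfolding transitive_def by blast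
  have "elts (collapse X x) = collapse X ` elts x"
    unfolding elts_collapse using sub assms(2) by (simp add: Int_absorb2)
  also have "\<dots> = elts x" using step.IH sub by force
  finally show ?case using extensionality by blast
qed

lemma Ord_collapse: "Ord \<alpha> \<Longrightarrow> Ord (collapse X \<alpha>)"
proof (induction \<alpha> rule: elts_induct)
  case (step \<alpha>)
  have *: "collapse X \<alpha> = vset (collapse X ` (elts \<alpha> \<inter> X))" by (rule collapse_eq)
  show ?case
    unfolding * 
  proof (rule Ord_vset)
    show "small (collapse X ` (elts \<alpha> \<inter> X))" by (metis elts_collapse small_elts)
    show "transitive (collapse X ` (elts \<alpha> \<inter> X))"
      unfolding transitive_def elts_collapse[symmetric]
      using step.prems Ord_trans by (fastforce simp: elts_collapse)
  qed (use step Ord_mem in blast)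
qed

section \<open>Cardinals\<close>

lemma lepoll_total: "A \<lesssim> B \<or> B \<lesssim> A"
  unfolding lepoll_def card_of_ordLeq
  using ordLeq_total[OF card_of_Well_order card_of_Well_order] .

lemma not_lesspoll_iff: "\<not> A \<prec> B \<longleftrightarrow> B \<lesssim> A"
  unfolding lesspoll_def by (metis eqpoll_imp_lepoll eqpoll_sym lepoll_antisym lepoll_total)

text \<open>Burali-Forti: an injection of an ordinal into \<open>x\<close> is determined up to the ordinal by the images
  of its initial segments, and there is only a set of such families.\<close>

lemma Hartogs:
  fixes x :: "'v::zfc"
  shows "\<exists>\<alpha>::'v. Ord \<alpha> \<and> \<not> elts \<alpha> \<lesssim> elts x"
proof (rule ccontr)
  assume "\<not> ?thesis"
  then have "\<forall>\<alpha>::'v. Ord \<alpha> \<longrightarrow> (\<exists>f. inj_on f (elts \<alpha>) \<and> f ` elts \<alpha> \<subseteq> elts x)"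
    by (simp add: lepoll_def)
  then obtain f :: "'v \<Rightarrow> 'v \<Rightarrow> 'v" where f: "\<And>\<alpha>. Ord \<alpha> \<Longrightarrow> inj_on (f \<alpha>) (elts \<alpha>)" "\<And>\<alpha>. Ord \<alpha> \<Longrightarrow> f \<alpha> ` elts \<alpha> \<subseteq> elts x"
    by metis
  define seg where "seg \<alpha> \<beta> = vset (f \<alpha> ` elts \<beta>)" for \<alpha> \<beta>
  define code where "code \<alpha> = vset (seg \<alpha> ` elts \<alpha>)" for \<alpha>
  have seg: "elts (seg \<alpha> \<beta>) = f \<alpha> ` elts \<beta>" for \<alpha> \<beta>
    unfolding seg_def by (intro elts_vset small_image) simp
  have code: "elts (code \<alpha>) = seg \<alpha> ` elts \<alpha>" for \<alpha>
    unfolding code_def by (intro elts_vset small_image) simp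
  \<comment> \<open>By injectivity of \<open>f \<alpha>\<close>, inclusion between images of initial
    segments reflects inclusion between the segments.\<close>
  have sub: "elts \<beta> \<subseteq> elts \<gamma>"
    if \<alpha>: "Ord \<alpha>" "\<beta> \<in> elts \<alpha>" "\<gamma> \<in> elts \<alpha>" and le: "elts (seg \<alpha> \<beta>) \<subseteq> elts (seg \<alpha> \<gamma>)" for \<alpha> \<beta> \<gamma>
  proof
    fix u assume u: "u \<in> elts \<beta>"
    then obtain v where "v \<in> elts \<gamma>" "f \<alpha> u = f \<alpha> v" using le seg by fastforce
    with u \<alpha> f(1)[OF \<alpha>(1)] Ord_trans[OF \<alpha>(1)] show "u \<in> elts \<gamma>" by (metis inj_onD)
  qed
  \<comment> \<open>Families with equal codes consist of the same images, ordered by inclusion, so a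
    common image stands at the same place in both. The induction is on that place.\<close>
  have agree: "\<beta> = \<gamma>"
    if "Ord a" "Ord b" "\<beta> \<in> elts a" "\<gamma> \<in> elts b" "seg a \<beta> = seg b \<gamma>" "code a = code b" for a b \<beta> \<gamma>
    using that(3-5)
  proof (induction \<beta> arbitrary: \<gamma> rule: elts_induct)
    case (step \<beta>)
    have "u \<in> elts \<gamma>" if u: "u \<in> elts \<beta>" for u
    proof -
      have ua: "u \<in> elts a" using u step.prems(1) \<open>Ord a\<close> Ord_trans by blast
      then have "seg a u \<in> elts (code b)" using code[of a] \<open>code a = code b\<close> by (metis imageI)
      then obtain v where v: "v \<in> elts b" "seg a u = seg b v" using code by auto
      then have uv: "u = v" using step.IH[OF u ua] by blast
      have "elts u \<subseteq> elts \<beta>" using Ord_trans[OF Ord_mem[OF \<open>Ord a\<close> step.prems(1)] u] by blast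
      then have "elts (seg b v) \<subseteq> elts (seg b \<gamma>)"
        unfolding v(2)[symmetric] step.prems(3)[symmetric] seg by (rule image_mono)
      then have "elts v \<subseteq> elts \<gamma>" by (rule sub[OF \<open>Ord b\<close> v(1) step.prems(2)])
      then consider "v \<in> elts \<gamma>" | "v = \<gamma>"
        using Ord_subset_iff Ord_mem \<open>Ord b\<close> v(1) step.prems(2) by metis
      then show ?thesis
      proof cases
        case 2
        then have "elts (seg a \<beta>) \<subseteq> elts (seg a u)" using v step.prems by simp
        then have "elts \<beta> \<subseteq> elts u" using sub \<open>Ord a\<close> step.prems ua by blast
        then show ?thesis using u mem_irrefl by blast
      qed (use uv in simp)
    qed
    moreover have "v \<in> elts \<beta>" if v: "v \<in> elts \<gamma>" for v
    proof -
      have vb: "v \<in> elts b" using v step.prems(2) \<open>Ord b\<close> Ord_trans by blast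
      then have "seg b v \<in> elts (code a)" using code[of b] \<open>code a = code b\<close> by (metis imageI)
      then obtain u where u: "u \<in> elts a" "seg a u = seg b v" using code by auto
      have "elts v \<subseteq> elts \<gamma>" using Ord_trans[OF Ord_mem[OF \<open>Ord b\<close> step.prems(2)] v] by blast
      then have "elts (seg a u) \<subseteq> elts (seg a \<beta>)"
        unfolding u(2) step.prems(3) seg by (rule image_mono)
      then have "elts u \<subseteq> elts \<beta>" using sub[OF \<open>Ord a\<close> u(1) step.prems(1)] by blast
      then consider "u \<in> elts \<beta>" | "u = \<beta>"
        using Ord_subset_iff Ord_mem \<open>Ord a\<close> u(1) step.prems(1) by metis
      then show ?thesis
      proof cases
        case 1
        then show ?thesis using step.IH[OF 1 u(1) vb u(2)] by simp
      next
        case 2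
        then have "elts (seg b \<gamma>) \<subseteq> elts (seg b v)" using u step.prems by simp
        then have "elts \<gamma> \<subseteq> elts v" using sub \<open>Ord b\<close> step.prems vb by blast
        then show ?thesis using v mem_irrefl by blast
      qed
    qed
    ultimately show ?case using extensionality by blast
  qed
  have inj: "inj_on code (Collect Ord)"
  proof (rule inj_onI)
    fix a b :: 'v assume ab: "a \<in> Collect Ord" "b \<in> Collect Ord" and eq: "code a = code b"
    have "elts a' \<subseteq> elts b'" if ord: "Ord a'" "Ord b'" and eq: "code a' = code b'" for a' b'
    proof
      fix u assume u: "u \<in> elts a'"
      then have "seg a' u \<in> elts (code b')" using code[of a'] eq by (metis imageI)
      then obtain v where "v \<in> elts b'" "seg a' u = seg b' v" using code by auto
      then show "u \<in> elts b'" using agree ord eq u by metis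
    qed
    then show "a = b" using ab eq extensionality by (metis mem_Collect_eq subset_antisym)
  qed
  \<comment> \<open>Each code is a set of subsets of x, so the ordinals would inject into the double
    power set of x and form a set.\<close>
  obtain P1 where P1: "elts P1 = {y. elts y \<subseteq> elts x}" using powerset[of x] by (rule exE)
  obtain P2 where P2: "elts P2 = {y. elts y \<subseteq> elts P1}" using powerset[of P1] by (rule exE)
  have "code ` Collect Ord \<subseteq> elts P2"
  proof safe
    fix a :: 'v assume a: "Ord a"
    have "elts (seg a \<beta>) \<subseteq> elts x" if "\<beta> \<in> elts a" for \<beta>
      using seg f(2)[OF a] that Ord_trans[OF a] by (metis image_mono subsetI subset_trans)
    then show "code a \<in> elts P2" using code P1 P2 by auto
  qed
  then have "(Collect Ord :: 'v set) \<lesssim> elts P2" 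
    unfolding lepoll_def using inj by (intro exI[of _ code] conjI)
  then have sm: "small (Collect Ord :: 'v set)" by (rule small_lepoll[OF small_elts])
  then have "Ord (vset (Collect Ord :: 'v set))"
    by (rule Ord_vset) (auto simp: transitive_def Ord_mem)
  then have "vset (Collect Ord :: 'v set) \<in> elts (vset (Collect Ord))" using sm by (simp add: elts_vset)
  then show False using mem_irrefl by blast
qed

lemma Card_Ord: "Card \<kappa> \<Longrightarrow> Ord \<kappa>"
  unfolding Card_def by blast

lemma Card_lesspoll: "Card \<kappa> \<Longrightarrow> \<alpha> \<in> elts \<kappa> \<Longrightarrow> elts \<alpha> \<prec> elts \<kappa>"
  unfolding Card_def lesspoll_def using Ord_trans by (metis subsetI subset_imp_lepoll)

lemma Ord_lesspoll_mem: "Ord \<alpha> \<Longrightarrow> Ord \<beta> \<Longrightarrow> elts \<alpha> \<prec> elts \<beta> \<Longrightarrow> \<alpha> \<in> elts \<beta>"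
  by (metis Ord_linear Ord_subset_iff not_lesspoll_iff subset_imp_lepoll)

lemma Card_least: "Ord \<alpha> \<Longrightarrow> (\<And>\<beta>. \<beta> \<in> elts \<alpha> \<Longrightarrow> \<not> elts \<beta> \<approx> elts \<alpha>) \<Longrightarrow> Card \<alpha>"
  unfolding Card_def by blast

text \<open>Choice enters through comparability: A injects into an ordinal that does not inject into
  A. The image is a set of ordinals, and its collapse is an ordinal of the right size.\<close>

lemma Ord_exists_eqpoll:
  fixes A :: "'v::zfc set"
  assumes "small A" shows "\<exists>\<alpha>::'v. Ord \<alpha> \<and> elts \<alpha> \<approx> A"
proof -
  obtain x where x: "elts x = A" using assms unfolding small_def by blast
  obtain \<alpha> :: 'v where \<alpha>: "Ord \<alpha>" "\<not> elts \<alpha> \<lesssim> elts x" using Hartogs[of x] by metis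
  then have "A \<lesssim> elts \<alpha>" using lepoll_total x by metis
  then obtain f where f: "inj_on f A" "f ` A \<subseteq> elts \<alpha>" unfolding lepoll_def by blast
  define B where "B = f ` A"
  have B: "Ord b" if "b \<in> B" for b using that f \<alpha>(1) Ord_mem B_def by blast
  have inj: "inj_on (collapse B) B"
  proof (rule collapse_inj)
    fix b c assume "b \<in> B" "c \<in> B" "elts b \<inter> B = elts c \<inter> B"
    then show "b = c" using Ord_linear[OF B B] mem_irrefl by blast
  qed
  have "small (collapse B ` B)" unfolding B_def using assms by (intro small_image)
  moreover from this have "Ord (vset (collapse B ` B))"
    by (rule Ord_vset[OF _ transitive_collapse_image]) (auto intro: Ord_collapse B)
  moreover have "collapse B ` B \<approx> A"
    using inj f(1) B_def by simp
  ultimately show ?thesis by (intro exI[of _ "vset (collapse B ` B)"]) (simp add: elts_vset)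
qed

lemma Card_exists_eqpoll:
  fixes A :: "'v::zfc set"
  assumes "small A" shows "\<exists>\<mu>::'v. Card \<mu> \<and> elts \<mu> \<approx> A"
proof -
  obtain \<alpha> :: 'v where "Ord \<alpha>" "elts \<alpha> \<approx> A" using Ord_exists_eqpoll[OF assms] by metis
  then obtain \<mu> :: 'v where "Ord \<mu>" "elts \<mu> \<approx> A" "\<And>\<gamma>. \<gamma> \<in> elts \<mu> \<Longrightarrow> \<not> elts \<gamma> \<approx> A"
    using Ord_least[of \<alpha> "\<lambda>\<alpha>. elts \<alpha> \<approx> A"] by metis
  then show ?thesis by (metis Card_least eqpoll_trans)
qed

lemma lesspoll_Card:
  fixes \<kappa> :: "'v::zfc"
  assumes "A \<prec> elts \<kappa>" "Card \<kappa>" shows "\<exists>\<mu>\<in>elts \<kappa>. Card \<mu> \<and> elts \<mu> \<approx> A"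
proof -
  have "A \<lesssim> elts \<kappa>" by (rule lesspoll_imp_lepoll[OF assms(1)])
  then obtain B where B: "B \<subseteq> elts \<kappa>" "A \<approx> B"
    unfolding lepoll_def by (meson eqpoll_sym inj_on_image_eqpoll_self)
  obtain \<mu> :: 'v where "Card \<mu>" "elts \<mu> \<approx> B"
    using Card_exists_eqpoll[OF small_subset[OF small_elts B(1)]] by metis
  then have \<mu>: "Card \<mu>" "elts \<mu> \<approx> A" using B(2) by (metis eqpoll_trans eqpoll_sym)+
  have "elts \<mu> \<prec> elts \<kappa>" by (rule eq_lesspoll_trans[OF \<mu>(2) assms(1)])
  then show ?thesis using \<mu> Ord_lesspoll_mem Card_Ord assms(2) by metis
qed

lemma Card_subset: "Card \<mu> \<Longrightarrow> Card \<nu> \<Longrightarrow> elts \<mu> \<lesssim> elts \<nu> \<Longrightarrow> elts \<mu> \<subseteq> elts \<nu>"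
  by (metis Card_Ord Card_lesspoll Ord_linear Ord_subset_iff not_lesspoll_iff order_refl)

section \<open>Regular cardinals\<close>

lemma infinite_Times_self: "infinite A \<Longrightarrow> A \<times> A \<approx> A"
  unfolding eqpoll_iff_card_of_ordIso by (rule card_of_Times_same_infinite)

lemma lesspoll_Card_Times_mem:
  fixes \<kappa> :: "'v::zfc"
  assumes "Card \<kappa>" "infinite (elts \<kappa>)" "\<beta> \<in> elts \<kappa>" "\<gamma> \<in> elts \<kappa>"
  shows "elts \<beta> \<times> elts \<gamma> \<prec> elts \<kappa>"
proof -
  have "\<exists>\<rho>\<in>elts \<kappa>. elts \<beta> \<subseteq> elts \<rho> \<and> elts \<gamma> \<subseteq> elts \<rho>"
    using assms Card_Ord Ord_mem Ord_linear Ord_subset_iff by (metis order_refl)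
  then obtain \<rho> where \<rho>: "\<rho> \<in> elts \<kappa>" "elts \<beta> \<times> elts \<gamma> \<subseteq> elts \<rho> \<times> elts \<rho>" by blast
  show ?thesis
  proof (cases "finite (elts \<rho>)")
    case True
    then have "finite (elts \<beta> \<times> elts \<gamma>)" using \<rho>(2) finite_subset by blast
    then show ?thesis by (rule finite_lesspoll_infinite[OF assms(2)])
  next
    case False
    have "elts \<beta> \<times> elts \<gamma> \<lesssim> elts \<rho>"
      by (rule lepoll_trans2[OF subset_imp_lepoll[OF \<rho>(2)] infinite_Times_self[OF False]])
    then show ?thesis by (rule lesspoll_trans1[OF _ Card_lesspoll[OF assms(1) \<rho>(1)]])
  qed
qed

lemma lesspoll_Card_Times:
  fixes \<kappa> :: "'v::zfc"
  assumes "Card \<kappa>" "infinite (elts \<kappa>)" "A \<prec> elts \<kappa>" "B \<prec> elts \<kappa>"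
  shows "A \<times> B \<prec> elts \<kappa>"
proof -
  obtain \<beta> where \<beta>: "\<beta> \<in> elts \<kappa>" "elts \<beta> \<approx> A" using lesspoll_Card assms by metis
  obtain \<gamma> where \<gamma>: "\<gamma> \<in> elts \<kappa>" "elts \<gamma> \<approx> B" using lesspoll_Card assms by metis
  have "A \<times> B \<approx> elts \<beta> \<times> elts \<gamma>"
    by (rule eqpoll_sym[OF times_eqpoll_cong[OF \<beta>(2) \<gamma>(2)]])
  then show ?thesis
    by (rule eq_lesspoll_trans[OF _ lesspoll_Card_Times_mem[OF assms(1,2) \<beta>(1) \<gamma>(1)]])
qed

lemma UN_lepoll_Sigma: "(\<Union>i\<in>I. A i) \<lesssim> Sigma I A"
proof -
  have "(\<Union>i\<in>I. A i) = snd ` Sigma I A" by force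
  then show ?thesis by (metis image_lepoll)
qed

lemma regular_Card: "regular \<kappa> \<Longrightarrow> Card \<kappa>"
  unfolding regular_def by blast

lemma regular_infinite: "regular \<kappa> \<Longrightarrow> infinite (elts \<kappa>)"
  unfolding regular_def by blast

lemma regular_bounded:
  fixes \<kappa> :: "'v::zfc"
  assumes "regular \<kappa>" "B \<subseteq> elts \<kappa>" "B \<prec> elts \<kappa>"
  shows "\<exists>\<beta>\<in>elts \<kappa>. B \<subseteq> elts \<beta>"
proof -
  have "\<not> B \<approx> elts \<kappa>" using assms(3) unfolding lesspoll_def by blast
  then obtain \<beta> where \<beta>: "\<beta> \<in> elts \<kappa>" "\<forall>\<alpha>\<in>B. \<not> elts \<beta> \<subseteq> elts \<alpha>"
    using assms(1,2) unfolding regular_def by metis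
  have O: "Ord \<kappa>" using assms(1) regular_Card Card_Ord by metis
  have "\<alpha> \<in> elts \<beta>" if "\<alpha> \<in> B" for \<alpha>
  proof -
    have "Ord \<alpha>" "Ord \<beta>" using that O \<beta>(1) assms(2) Ord_mem by blast+
    then show ?thesis using \<beta>(2) that Ord_linear Ord_subset_iff by metis
  qed
  then show ?thesis using \<beta>(1) by blast
qed

text \<open>The sizes of the \<open>A i\<close> form a subset of \<kappa> with fewer than \<kappa>
  elements, so one \<beta> below \<kappa> bounds them all, and the union is no larger than the
  product of I and \<beta>.\<close>

lemma regular_UN:
  fixes \<kappa> :: "'v::zfc"
  assumes "regular \<kappa>" "I \<prec> elts \<kappa>" "\<And>i. i \<in> I \<Longrightarrow> A i \<prec> elts \<kappa>"
  shows "(\<Union>i\<in>I. A i) \<prec> elts \<kappa>"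
proof -
  have C: "Card \<kappa>" "infinite (elts \<kappa>)" "Ord \<kappa>"
    using assms(1) regular_Card regular_infinite Card_Ord by metis+
  have "\<forall>i\<in>I. \<exists>\<mu>\<in>elts \<kappa>. elts \<mu> \<approx> A i" using lesspoll_Card[OF assms(3) C(1)] by metis
  then obtain m where m: "\<And>i. i \<in> I \<Longrightarrow> m i \<in> elts \<kappa>" "\<And>i. i \<in> I \<Longrightarrow> elts (m i) \<approx> A i" by metis
  have "m ` I \<prec> elts \<kappa>" by (rule lesspoll_trans1[OF image_lepoll assms(2)])
  moreover have "m ` I \<subseteq> elts \<kappa>" using m(1) by blast
  ultimately obtain \<beta> where \<beta>: "\<beta> \<in> elts \<kappa>" "m ` I \<subseteq> elts \<beta>" using regular_bounded[OF assms(1)] by metis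
  have "A i \<lesssim> elts \<beta>" if "i \<in> I" for i
  proof -
    have "elts (m i) \<subseteq> elts \<beta>" using \<beta> that Ord_trans[OF Ord_mem[OF C(3) \<beta>(1)]] by blast
    then show ?thesis using m(2)[OF that] by (metis eqpoll_sym lepoll_trans1 subset_imp_lepoll)
  qed
  then have "Sigma I A \<lesssim> I \<times> elts \<beta>" by (intro Sigma_lepoll_mono) auto
  then have "(\<Union>i\<in>I. A i) \<lesssim> I \<times> elts \<beta>" by (rule lepoll_trans[OF UN_lepoll_Sigma])
  also have "I \<times> elts \<beta> \<prec> elts \<kappa>"
    by (rule lesspoll_Card_Times[OF C(1,2) assms(2) Card_lesspoll[OF C(1) \<beta>(1)]])
  finally show ?thesis .
qed

lemma regular_Un:
  fixes \<kappa> :: "'v::zfc"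
  assumes "regular \<kappa>" "A \<prec> elts \<kappa>" "B \<prec> elts \<kappa>" shows "A \<union> B \<prec> elts \<kappa>"
proof -
  have "(\<Union>b\<in>{True, False}. if b then A else B) \<prec> elts \<kappa>"
    by (rule regular_UN[OF assms(1) finite_lesspoll_infinite[OF regular_infinite[OF assms(1)]]])
      (use assms in auto)
  then show ?thesis by (simp add: Un_commute)
qed

lemma regular_insert:
  fixes \<kappa> :: "'v::zfc"
  assumes "regular \<kappa>" "A \<prec> elts \<kappa>" shows "insert a A \<prec> elts \<kappa>"
  using regular_Un[OF assms(1) finite_lesspoll_infinite[OF regular_infinite[OF assms(1)], of "{a}"] assms(2)]
  by simp

text \<open>A successor cardinal is regular: \<theta> is the least ordinal that does not inject into
  the infinite set y, and a short cofinal subset would write it as a union of at most |y| sets of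
  size at most |y|.\<close>

lemma regular_exists:
  fixes x :: "'v::zfc"
  shows "\<exists>\<theta>::'v. regular \<theta> \<and> elts x \<prec> elts \<theta>"
proof -
  \<comment> \<open>Adding \<omega> makes y infinite and keeps x as a subset.\<close>
  define y where "y = vset (elts x \<union> range vnat)"
  have y: "elts y = elts x \<union> range vnat"
    unfolding y_def by (intro elts_vset small_Un small_range_vnat) simp
  have "inj (vnat :: nat \<Rightarrow> 'v)" by (simp add: inj_def vnat_inject)
  then have inf: "infinite (elts y)" unfolding y by (simp add: finite_image_iff)
  obtain \<alpha> :: 'v where "Ord \<alpha>" "\<not> elts \<alpha> \<lesssim> elts y" using Hartogs[of y] by metis
  then obtain \<theta> :: 'v where \<theta>: "Ord \<theta>" "\<not> elts \<theta> \<lesssim> elts y" "\<And>\<beta>. \<beta> \<in> elts \<theta> \<Longrightarrow> elts \<beta> \<lesssim> elts y"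
    using Ord_least[of \<alpha> "\<lambda>\<alpha>. \<not> elts \<alpha> \<lesssim> elts y"] by metis
  have C: "Card \<theta>" by (rule Card_least[OF \<theta>(1)]) (metis \<theta>(2,3) eqpoll_sym lepoll_trans1)
  have I: "infinite (elts \<theta>)" using \<theta>(2) inf finite_lepoll_infinite by metis
  have "A \<approx> elts \<theta>"
    if A: "A \<subseteq> elts \<theta>" "\<forall>\<beta>\<in>elts \<theta>. \<exists>\<alpha>\<in>A. elts \<beta> \<subseteq> elts \<alpha>" for A
  proof (rule ccontr)
    assume "\<not> ?thesis"
    then have "A \<prec> elts \<theta>" using A(1) subset_imp_lepoll unfolding lesspoll_def by metis
    then obtain \<mu> where "\<mu> \<in> elts \<theta>" "elts \<mu> \<approx> A" using lesspoll_Card C by metis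
    then have Ay: "A \<lesssim> elts y" by (metis \<theta>(3) eqpoll_sym lepoll_trans1)
    \<comment> \<open>Cofinality is stated with \<le>, so a \<beta> may be met only by equality;
      hence the points \<alpha> are added to their own extensions.\<close>
    have "elts \<theta> \<subseteq> (\<Union>\<alpha>\<in>A. insert \<alpha> (elts \<alpha>))"
    proof
      fix \<beta> assume \<beta>: "\<beta> \<in> elts \<theta>"
      then obtain \<alpha> where "\<alpha> \<in> A" "elts \<beta> \<subseteq> elts \<alpha>" using A(2) by blast
      then show "\<beta> \<in> (\<Union>\<alpha>\<in>A. insert \<alpha> (elts \<alpha>))"
        using Ord_subset_iff[of \<beta> \<alpha>] Ord_mem[OF \<theta>(1)] \<beta> A(1) by blast
    qed
    then have "elts \<theta> \<lesssim> Sigma A (\<lambda>\<alpha>. insert \<alpha> (elts \<alpha>))"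
      using UN_lepoll_Sigma subset_imp_lepoll lepoll_trans by metis
    also have "\<dots> \<lesssim> A \<times> elts y"
    proof (rule Sigma_lepoll_mono)
      fix \<alpha> assume "\<alpha> \<in> A"
      then have \<alpha>: "elts \<alpha> \<lesssim> elts y" using A(1) \<theta>(3) by blast
      show "insert \<alpha> (elts \<alpha>) \<lesssim> elts y"
      proof (cases "finite (elts \<alpha>)")
        case True
        then show ?thesis by (intro finite_lepoll_infinite[OF inf]) simp
      next
        case False
        show ?thesis by (rule lepoll_trans[OF infinite_insert_lepoll[OF False] \<alpha>])
      qed
    qed simp
    also have "A \<times> elts y \<lesssim> elts y \<times> elts y" using Ay by (intro times_lepoll_mono) auto
    also have "\<dots> \<approx> elts y" by (rule infinite_Times_self[OF inf])
    finally show False using \<theta>(2) by blast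
  qed
  then have "regular \<theta>" unfolding regular_def using C I by blast
  moreover have "elts y \<prec> elts \<theta>" using \<theta>(2) not_lesspoll_iff by metis
  then have "elts x \<prec> elts \<theta>" using y subset_imp_lepoll lesspoll_trans1 by (metis Un_upper1)
  ultimately show ?thesis by blast
qed

section \<open>The cardinal \<omega>1 and regular cardinals above it\<close>

lemma omega1:
  "Ord (omega1 :: 'v::zfc)" "uncountable (elts (omega1 :: 'v))"
  "\<And>\<beta>. \<beta> \<in> elts (omega1 :: 'v) \<Longrightarrow> countable (elts \<beta>)"
proof -
  define w :: 'v where "w = vset (range vnat)"
  have w: "elts w = range vnat" unfolding w_def by (rule elts_vset[OF small_range_vnat])
  obtain \<alpha> :: 'v where \<alpha>: "Ord \<alpha>" "\<not> elts \<alpha> \<lesssim> elts w" using Hartogs[of w] by metis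
  have "infinite (elts w)" unfolding w by (simp add: finite_image_iff inj_def vnat_inject)
  then have "(UNIV :: nat set) \<lesssim> elts w" using infinite_le_lepoll by metis
  then have "uncountable (elts \<alpha>)"
    using \<alpha>(2) unfolding countable_def by (metis lepoll_def lepoll_trans subset_UNIV)
  then obtain \<beta> :: 'v where \<beta>: "Ord \<beta>" "uncountable (elts \<beta>)" "\<And>\<gamma>. \<gamma> \<in> elts \<beta> \<Longrightarrow> countable (elts \<gamma>)"
    using Ord_least[of \<alpha> "\<lambda>\<alpha>. uncountable (elts \<alpha>)"] \<alpha>(1) by metis
  have "(omega1 :: 'v) = \<beta>" unfolding omega1_def
  proof (rule the_equality)
    fix \<gamma> :: 'v assume "Ord \<gamma> \<and> uncountable (elts \<gamma>) \<and> (\<forall>\<beta>\<in>elts \<gamma>. countable (elts \<beta>))"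
    then show "\<gamma> = \<beta>" using \<beta> Ord_linear[of \<gamma> \<beta>] by blast
  qed (use \<beta> in blast)
  then show "Ord (omega1 :: 'v)" "uncountable (elts (omega1 :: 'v))"
    "\<And>\<beta>. \<beta> \<in> elts (omega1 :: 'v) \<Longrightarrow> countable (elts \<beta>)" using \<beta> by auto
qed

lemma lesspoll_omega1_iff: "A \<prec> elts (omega1 :: 'v::zfc) \<longleftrightarrow> countable A"
proof
  have C: "Card (omega1 :: 'v)"
    by (rule Card_least[OF omega1(1)]) (metis omega1(2,3) countable_eqpoll eqpoll_sym)
  assume "A \<prec> elts (omega1 :: 'v)"
  then obtain \<mu> :: 'v where "\<mu> \<in> elts omega1" "elts \<mu> \<approx> A" using lesspoll_Card C by metis
  then show "countable A" by (metis omega1(3) countable_eqpoll eqpoll_sym)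
next
  assume "countable A"
  then show "A \<prec> elts (omega1 :: 'v)" using not_lesspoll_iff countable_lepoll omega1(2) by metis
qed

locale regular_above_omega1 =
  fixes \<kappa> :: "'v::zfc"
  assumes regular: "regular \<kappa>" and omega1_mem: "omega1 \<in> elts \<kappa>"
begin

lemma Card: "Card \<kappa>" and Ord: "Ord \<kappa>" and infinite: "infinite (elts \<kappa>)"
  using regular regular_Card regular_infinite Card_Ord by metis+

lemma countable_lesspoll: "countable A \<Longrightarrow> A \<prec> elts \<kappa>"
  using lesspoll_omega1_iff lesspoll_trans Card_lesspoll[OF Card omega1_mem] by metis

lemma finite_lesspoll: "finite A \<Longrightarrow> A \<prec> elts \<kappa>"
  by (rule countable_lesspoll[OF countable_finite])

lemma lists_lesspoll:
  assumes "A \<prec> elts \<kappa>" shows "lists A \<prec> elts \<kappa>"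
proof -
  have L: "{l \<in> lists A. length l = n} \<prec> elts \<kappa>" for n
  proof (induction n)
    case 0
    have "{l \<in> lists A. length l = 0} = {[]}" by auto
    then show ?case by (simp add: finite_lesspoll)
  next
    case (Suc n)
    have "{l \<in> lists A. length l = Suc n} \<subseteq> (\<lambda>(a, l). a # l) ` (A \<times> {l \<in> lists A. length l = n})"
      by (auto simp: length_Suc_conv image_iff)
    then show ?case
      by (rule lesspoll_trans1[OF subset_image_lepoll lesspoll_Card_Times[OF Card infinite assms Suc]])
  qed
  have "lists A = (\<Union>n. {l \<in> lists A. length l = n})" by blast
  moreover have "(\<Union>n. {l \<in> lists A. length l = n}) \<prec> elts \<kappa>"
    by (rule regular_UN[OF regular countable_lesspoll[OF countableI_type] L])
  ultimately show ?thesis by (simp only:)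
qed

lemma lesspoll_small: "(A :: 'v set) \<prec> elts \<kappa> \<Longrightarrow> small A"
  by (rule small_lepoll[OF small_elts lesspoll_imp_lepoll])

lemma vset_mem_Pk: "B \<subseteq> A \<Longrightarrow> B \<prec> elts \<kappa> \<Longrightarrow> vset B \<in> Pk \<kappa> A"
  unfolding Pk_def by (simp add: elts_vset[OF lesspoll_small])

lemma PkD: "x \<in> Pk \<kappa> A \<Longrightarrow> elts x \<subseteq> A" "x \<in> Pk \<kappa> A \<Longrightarrow> elts x \<prec> elts \<kappa>"
  unfolding Pk_def by auto

end

section \<open>Clubs\<close>

text \<open>The values are sets and not points, so that a single operation can add fewer than
  \<kappa> points at once, such as all elements of an ordinal below \<kappa>.\<close>

definition closed_under :: "('v list \<Rightarrow> 'v set) \<Rightarrow> 'v set \<Rightarrow> bool" where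
  "closed_under T X \<longleftrightarrow> (\<forall>l\<in>lists X. T l \<subseteq> X)"

lemma closed_underD: "closed_under T X \<Longrightarrow> l \<in> lists X \<Longrightarrow> y \<in> T l \<Longrightarrow> y \<in> X"
  unfolding closed_under_def by blast

context regular_above_omega1
begin

definition small_op :: "'v set \<Rightarrow> ('v list \<Rightarrow> 'v set) \<Rightarrow> bool" where
  "small_op A T \<longleftrightarrow> (\<forall>l\<in>lists A. T l \<subseteq> A \<and> T l \<prec> elts \<kappa>)"

lemma small_opD: "small_op A T \<Longrightarrow> l \<in> lists A \<Longrightarrow> T l \<subseteq> A"
  "small_op A T \<Longrightarrow> l \<in> lists A \<Longrightarrow> T l \<prec> elts \<kappa>"
  unfolding small_op_def by auto

text \<open>Closing off \<omega> times is enough, since a finite sequence from the union already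
  lies in one stage; regularity of the uncountable \<kappa> keeps the union small.\<close>

lemma closure_exists:
  assumes T: "small_op A T" and X: "X \<subseteq> A" "X \<prec> elts \<kappa>"
  obtains Y where "X \<subseteq> Y" "Y \<subseteq> A" "Y \<prec> elts \<kappa>" "closed_under T Y"
proof -
  define Z where "Z = rec_nat X (\<lambda>_ B. B \<union> (\<Union>l\<in>lists B. T l))"
  have Z0: "Z 0 = X" and ZS: "Z (Suc n) = Z n \<union> (\<Union>l\<in>lists (Z n). T l)" for n
    unfolding Z_def by simp_all
  have Z: "Z n \<subseteq> A \<and> Z n \<prec> elts \<kappa>" for n
  proof (induction n)
    case (Suc n)
    have l: "T l \<subseteq> A" "T l \<prec> elts \<kappa>" if "l \<in> lists (Z n)" for l
      using small_opD[OF T] lists_mono Suc that by blast+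
    have "(\<Union>l\<in>lists (Z n). T l) \<prec> elts \<kappa>"
      by (rule regular_UN[OF regular lists_lesspoll l(2)]) (use Suc in auto)
    then show ?case unfolding ZS using Suc l(1) regular_Un[OF regular] by blast
  qed (simp add: Z0 X)
  have mono: "Z m \<subseteq> Z n" if "m \<le> n" for m n
    using lift_Suc_mono_le[of Z, OF _ that] ZS by blast
  have fin: "\<exists>n. l \<in> lists (Z n)" if "l \<in> lists (\<Union>n. Z n)" for l
    using that
  proof (induction l)
    case (Cons a l)
    then obtain m n where "a \<in> Z m" "l \<in> lists (Z n)" by auto
    then have "a \<in> Z (max m n)" "l \<in> lists (Z (max m n))"
      using mono[of m "max m n"] mono[of n "max m n"] by auto
    then show ?case by (intro exI[of _ "max m n"]) simp
  qed simp
  have "closed_under T (\<Union>n. Z n)"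
    unfolding closed_under_def
  proof
    fix l assume "l \<in> lists (\<Union>n. Z n)"
    then obtain n where "l \<in> lists (Z n)" using fin by blast
    then have "T l \<subseteq> Z (Suc n)" unfolding ZS by blast
    then show "T l \<subseteq> (\<Union>n. Z n)" by blast
  qed
  moreover have "(\<Union>n. Z n) \<prec> elts \<kappa>"
    by (rule regular_UN[OF regular countable_lesspoll]) (use Z in auto)
  ultimately show ?thesis using that[of "\<Union>n. Z n"] Z Z0 by blast
qed

text \<open>A finite sequence from the union of a chain lies in one member of the chain, so closure
  passes to unions; cofinality is \<open>closure_exists\<close>.\<close>

lemma club_closed_under:
  assumes T: "small_op A T"
  shows "club \<kappa> A {x \<in> Pk \<kappa> A. closed_under T (elts x)}"
  unfolding club_def
proof (intro conjI ballI allI impI)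
  fix x assume "x \<in> Pk \<kappa> A"
  then obtain Y where Y: "elts x \<subseteq> Y" "Y \<subseteq> A" "Y \<prec> elts \<kappa>" "closed_under T Y"
    using closure_exists[OF T] PkD by metis
  then have "elts (vset Y) = Y" by (simp add: elts_vset[OF lesspoll_small])
  then show "\<exists>y\<in>{x \<in> Pk \<kappa> A. closed_under T (elts x)}. elts x \<subseteq> elts y"
    using Y vset_mem_Pk[of Y A] by (intro bexI[of _ "vset Y"]) auto
next
  fix \<alpha> f
  assume \<alpha>: "\<alpha> \<in> elts \<kappa>" and "elts \<alpha> \<noteq> {} \<and>
        (\<forall>\<xi>\<in>elts \<alpha>. f \<xi> \<in> {x \<in> Pk \<kappa> A. closed_under T (elts x)}) \<and>
        (\<forall>\<eta>\<in>elts \<alpha>. \<forall>\<xi>\<in>elts \<eta>. elts (f \<xi>) \<subseteq> elts (f \<eta>))"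
  then have ne: "elts \<alpha> \<noteq> {}" and f: "\<And>\<xi>. \<xi> \<in> elts \<alpha> \<Longrightarrow> f \<xi> \<in> Pk \<kappa> A"
    "\<And>\<xi>. \<xi> \<in> elts \<alpha> \<Longrightarrow> closed_under T (elts (f \<xi>))"
    and mono: "\<And>\<eta> \<xi>. \<eta> \<in> elts \<alpha> \<Longrightarrow> \<xi> \<in> elts \<eta> \<Longrightarrow> elts (f \<xi>) \<subseteq> elts (f \<eta>)" by auto
  let ?U = "\<Union>\<xi>\<in>elts \<alpha>. elts (f \<xi>)"
  have U: "?U \<prec> elts \<kappa>"
    by (rule regular_UN[OF regular Card_lesspoll[OF Card \<alpha>]]) (use f PkD in blast)
  have ex: "\<exists>\<xi>\<in>elts \<alpha>. l \<in> lists (elts (f \<xi>))" if "l \<in> lists ?U" for l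
    using that
  proof (induction l)
    case (Cons a l)
    then obtain \<xi> \<eta> where a: "\<xi> \<in> elts \<alpha>" "a \<in> elts (f \<xi>)" "\<eta> \<in> elts \<alpha>" "l \<in> lists (elts (f \<eta>))" by auto
    have "elts (f \<xi>) \<subseteq> elts (f \<eta>) \<or> elts (f \<eta>) \<subseteq> elts (f \<xi>)"
      using Ord_linear[of \<xi> \<eta>] mono a Ord_mem Ord \<alpha> by blast
    then show ?case
    proof
      assume "elts (f \<xi>) \<subseteq> elts (f \<eta>)"
      then show ?thesis using a by (intro bexI[of _ \<eta>]) auto
    next
      assume "elts (f \<eta>) \<subseteq> elts (f \<xi>)"
      then show ?thesis using a by (intro bexI[of _ \<xi>]) auto
    qed
  qed (use ne in auto)
  have "closed_under T ?U"
    unfolding closed_under_def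
  proof
    fix l assume "l \<in> lists ?U"
    then obtain \<xi> where \<xi>: "\<xi> \<in> elts \<alpha>" "l \<in> lists (elts (f \<xi>))" using ex by metis
    then have "T l \<subseteq> elts (f \<xi>)" using f(2) unfolding closed_under_def by metis
    then show "T l \<subseteq> ?U" using \<xi>(1) by blast
  qed
  then have "closed_under T (elts (vset ?U))" using U by (simp add: elts_vset[OF lesspoll_small])
  moreover have "vset ?U \<in> Pk \<kappa> A" using f(1) PkD U by (intro vset_mem_Pk) blast+
  ultimately show "vset ?U \<in> {x \<in> Pk \<kappa> A. closed_under T (elts x)}" by blast
qed blast

text \<open>The converse, up to inclusion. If \<open>c\<close> is a monotone assignment of elements of \<open>C\<close> to the finite
  subsets of \<open>A\<close>, then the union \<open>U B\<close> of the \<open>c F\<close> for \<open>F \<subseteq> B\<close> is in \<open>C\<close>, by induction on the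
  cardinality of \<open>B\<close>.\<close>

lemma club_contains_closed:
  assumes C: "club \<kappa> A C"
  obtains T where "small_op A T" "\<And>x. x \<in> Pk \<kappa> A \<Longrightarrow> closed_under T (elts x) \<Longrightarrow> x \<in> C"
proof -
  have CP: "C \<subseteq> Pk \<kappa> A" using C unfolding club_def by blast
  have "\<exists>y\<in>C. B \<subseteq> elts y" if "B \<subseteq> A" "B \<prec> elts \<kappa>" for B
  proof -
    have "\<exists>y\<in>C. elts (vset B) \<subseteq> elts y" using C vset_mem_Pk[OF that] unfolding club_def by blast
    then show ?thesis by (simp add: elts_vset[OF lesspoll_small[OF that(2)]])
  qed
  then obtain e where e: "\<And>B. B \<subseteq> A \<Longrightarrow> B \<prec> elts \<kappa> \<Longrightarrow> e B \<in> C"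
    "\<And>B. B \<subseteq> A \<Longrightarrow> B \<prec> elts \<kappa> \<Longrightarrow> B \<subseteq> elts (e B)" by metis
  \<comment> \<open>Recursion on finite sets: \<open>c F\<close> is a member of C above F and above
    \<open>c G\<close> for all proper subsets G of F, which makes c monotone.\<close>
  define c where "c = wfrec finite_psubset (\<lambda>h F. e (F \<union> (\<Union>G\<in>{G. G \<subset> F}. elts (h G))))"
  have c_eq: "c F = e (F \<union> (\<Union>G\<in>{G. G \<subset> F}. elts (c G)))" if "finite F" for F
    unfolding c_def
    by (subst wfrec[OF wf_finite_psubset]) (use that in \<open>auto simp: cut_def finite_psubset_def intro!: arg_cong[of _ _ e]\<close>)
  have arg: "F \<union> (\<Union>G\<in>{G. G \<subset> F}. elts (c G)) \<subseteq> A \<and> F \<union> (\<Union>G\<in>{G. G \<subset> F}. elts (c G)) \<prec> elts \<kappa>"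
    if "finite F" "F \<subseteq> A" for F
    using that
  proof (induction F rule: finite_psubset_induct)
    case (psubset F)
    have G: "c G \<in> C" if "G \<subset> F" for G
    proof -
      have "finite G" using that psubset.hyps by (meson finite_subset psubset_imp_subset)
      then show ?thesis using psubset.IH[OF that] psubset.prems that c_eq e(1) by (metis order_trans psubset_imp_subset)
    qed
    then have P: "c G \<in> Pk \<kappa> A" if "G \<subset> F" for G using CP that by blast
    have "finite {G. G \<subset> F}"
      by (rule finite_subset[of _ "Pow F"]) (use psubset.hyps in auto)
    then have "(\<Union>G\<in>{G. G \<subset> F}. elts (c G)) \<prec> elts \<kappa>"
      by (rule regular_UN[OF regular finite_lesspoll]) (use P PkD(2) in blast)
    then have "F \<union> (\<Union>G\<in>{G. G \<subset> F}. elts (c G)) \<prec> elts \<kappa>"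
      by (rule regular_Un[OF regular finite_lesspoll[OF psubset.hyps]])
    moreover have "F \<union> (\<Union>G\<in>{G. G \<subset> F}. elts (c G)) \<subseteq> A"
      using P PkD(1) psubset.prems by blast
    ultimately show ?case by blast
  qed
  have cC: "c F \<in> C" and Fc: "F \<subseteq> elts (c F)" and cm: "\<And>G. G \<subset> F \<Longrightarrow> elts (c G) \<subseteq> elts (c F)"
    if F: "finite F" "F \<subseteq> A" for F
  proof -
    note a = arg[OF F]
    show "c F \<in> C" using a e(1) c_eq[OF F(1)] by metis
    have s: "F \<union> (\<Union>G\<in>{G. G \<subset> F}. elts (c G)) \<subseteq> elts (c F)" using a e(2) c_eq[OF F(1)] by metis
    then show "F \<subseteq> elts (c F)" by blast
    show "elts (c G) \<subseteq> elts (c F)" if "G \<subset> F" for G using s that by blast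
  qed
  define U where "U B = (\<Union>l\<in>lists B. elts (c (set l)))" for B
  have Umono: "U B \<subseteq> U B'" if "B \<subseteq> B'" for B B' unfolding U_def using lists_mono[OF that] by blast
  have Usmall: "U B \<prec> elts \<kappa>" if "B \<subseteq> A" "B \<prec> elts \<kappa>" for B
    unfolding U_def
  proof (rule regular_UN[OF regular lists_lesspoll[OF that(2)]])
    fix l assume "l \<in> lists B"
    then have "set l \<subseteq> A" using that(1) by auto
    then have "c (set l) \<in> Pk \<kappa> A" using cC CP by blast
    then show "elts (c (set l)) \<prec> elts \<kappa>" by (rule PkD)
  qed
  have UC: "vset (U B) \<in> C" if "\<alpha> \<in> elts \<kappa>" "B \<subseteq> A" "B \<approx> elts \<alpha>" for \<alpha> B
    using that
  proof (induction \<alpha> arbitrary: B rule: elts_induct)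
    case (step \<alpha>)
    have O\<alpha>: "Ord \<alpha>" by (rule Ord_mem[OF Ord step.prems(1)])
    have sub: "\<beta> \<in> elts \<kappa>" if "\<beta> \<in> elts \<alpha>" for \<beta> by (rule Ord_trans[OF Ord step.prems(1) that])
    \<comment> \<open>For finite B, monotonicity gives \<open>U B = elts (c B)\<close>. If \<alpha>
      is not initial, a smaller ordinal of the same size serves. Otherwise B is an increasing union,
      of length \<alpha>, of subsets of smaller size, and C is closed under such unions.\<close>
    consider "finite B" | \<beta> where "\<beta> \<in> elts \<alpha>" "elts \<beta> \<approx> elts \<alpha>"
      | "infinite B" "\<And>\<beta>. \<beta> \<in> elts \<alpha> \<Longrightarrow> \<not> elts \<beta> \<approx> elts \<alpha>" by blast
    then show ?case
    proof cases
      case 1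
      then obtain l where l: "set l = B" using finite_list by blast
      have "elts (c (set l')) \<subseteq> elts (c B)" if "l' \<in> lists B" for l'
        using that cm[OF 1 step.prems(2), of "set l'"] by (cases "set l' = B") auto
      moreover have "l \<in> lists B" using l by auto
      ultimately have "U B = elts (c B)" unfolding U_def using l by auto
      then show ?thesis using cC[OF 1 step.prems(2)] by simp
    next
      case 2
      then show ?thesis using step.IH[OF 2(1) sub[OF 2(1)] step.prems(2)] step.prems(3) by (metis eqpoll_sym eqpoll_trans)
    next
      case 3
      have inf: "infinite (elts \<alpha>)" using 3(1) step.prems(3) eqpoll_finite_iff by metis
      \<comment> \<open>An infinite initial ordinal is a limit: a last element \<zeta> would put
        \<alpha> in bijection with \<zeta>.\<close>
      have lim: "\<exists>\<eta>\<in>elts \<alpha>. \<zeta> \<in> elts \<eta>" if \<zeta>: "\<zeta> \<in> elts \<alpha>" for \<zeta>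
      proof (rule ccontr)
        assume n: "\<not> ?thesis"
        have "elts \<alpha> = insert \<zeta> (elts \<zeta>)"
        proof (intro equalityI subsetI)
          fix \<beta> assume "\<beta> \<in> elts \<alpha>"
          then show "\<beta> \<in> insert \<zeta> (elts \<zeta>)" using Ord_linear[of \<beta> \<zeta>] Ord_mem[OF O\<alpha>] \<zeta> n by blast
        qed (use \<zeta> Ord_trans[OF O\<alpha>] in blast)
        then have "elts \<alpha> \<approx> elts \<zeta>" using inf infinite_insert_eqpoll by (metis finite.insertI)
        then show False using 3(2)[OF \<zeta>] eqpoll_sym by blast
      qed
      obtain b where b: "bij_betw b (elts \<alpha>) B" using step.prems(3) eqpoll_sym unfolding eqpoll_def by blast
      define f where "f \<eta> = vset (U (b ` elts \<eta>))" for \<eta>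
      have bB: "b ` elts \<eta> \<subseteq> B" "b ` elts \<eta> \<approx> elts \<eta>" if "\<eta> \<in> elts \<alpha>" for \<eta>
      proof -
        have s: "elts \<eta> \<subseteq> elts \<alpha>" using that Ord_trans[OF O\<alpha>] by blast
        then show "b ` elts \<eta> \<subseteq> B" using b unfolding bij_betw_def by blast
        show "b ` elts \<eta> \<approx> elts \<eta>"
          by (rule inj_on_image_eqpoll_self) (use s b in \<open>auto simp: bij_betw_def intro: inj_on_subset\<close>)
      qed
      have fC: "f \<eta> \<in> C" if \<eta>: "\<eta> \<in> elts \<alpha>" for \<eta>
        unfolding f_def using step.IH[OF \<eta> sub[OF \<eta>] _ bB(2)[OF \<eta>]] bB(1)[OF \<eta>] step.prems(2) by blast
      have bs: "b ` elts \<eta> \<prec> elts \<kappa>" if "\<eta> \<in> elts \<alpha>" for \<eta>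
        by (rule eq_lesspoll_trans[OF bB(2)[OF that] Card_lesspoll[OF Card sub[OF that]]])
      have ef: "elts (f \<eta>) = U (b ` elts \<eta>)" if "\<eta> \<in> elts \<alpha>" for \<eta>
        unfolding f_def
        by (rule elts_vset[OF lesspoll_small[OF Usmall]]) (use bB(1)[OF that] step.prems(2) bs[OF that] in auto)
      have ex: "\<exists>\<eta>\<in>elts \<alpha>. l \<in> lists (b ` elts \<eta>)" if "l \<in> lists B" for l
        using that
      proof (induction l)
        case Nil
        have "elts \<alpha> \<noteq> {}" using inf by auto
        then show ?case by auto
      next
        case (Cons a l)
        then obtain \<eta> where \<eta>: "\<eta> \<in> elts \<alpha>" "l \<in> lists (b ` elts \<eta>)" by auto
        have "a \<in> B" using Cons.hyps by blast
        then obtain \<zeta> where \<zeta>: "\<zeta> \<in> elts \<alpha>" "a = b \<zeta>" using b unfolding bij_betw_def by blast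
        obtain \<zeta>' where \<zeta>': "\<zeta>' \<in> elts \<alpha>" "\<zeta> \<in> elts \<zeta>'" using lim[OF \<zeta>(1)] by blast
        have "elts \<eta> \<subseteq> elts \<zeta>' \<or> elts \<zeta>' \<subseteq> elts \<eta>"
          using Ord_linear[of \<eta> \<zeta>'] Ord_subset_iff[of \<eta> \<zeta>'] Ord_subset_iff[of \<zeta>' \<eta>] Ord_mem[OF O\<alpha>] \<eta>(1) \<zeta>'(1) by blast
        then show ?case
        proof
          assume "elts \<eta> \<subseteq> elts \<zeta>'"
          then have "l \<in> lists (b ` elts \<zeta>')" using \<eta>(2) lists_mono image_mono by blast
          then show ?thesis using \<zeta> \<zeta>' by (intro bexI[of _ \<zeta>']) auto
        next
          assume "elts \<zeta>' \<subseteq> elts \<eta>"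
          then show ?thesis using \<zeta> \<zeta>' \<eta> by (intro bexI[of _ \<eta>]) auto
        qed
      qed
      have "U B = (\<Union>\<eta>\<in>elts \<alpha>. U (b ` elts \<eta>))"
      proof
        show "(\<Union>\<eta>\<in>elts \<alpha>. U (b ` elts \<eta>)) \<subseteq> U B" using Umono[OF bB(1)] by blast
        show "U B \<subseteq> (\<Union>\<eta>\<in>elts \<alpha>. U (b ` elts \<eta>))"
        proof
          fix y assume "y \<in> U B"
          then obtain l where l: "l \<in> lists B" "y \<in> elts (c (set l))" unfolding U_def by blast
          then obtain \<eta> where "\<eta> \<in> elts \<alpha>" "l \<in> lists (b ` elts \<eta>)" using ex by metis
          then show "y \<in> (\<Union>\<eta>\<in>elts \<alpha>. U (b ` elts \<eta>))" using l(2) unfolding U_def by blast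
        qed
      qed
      also have "\<dots> = (\<Union>\<eta>\<in>elts \<alpha>. elts (f \<eta>))" using ef by simp
      finally have UB: "U B = (\<Union>\<eta>\<in>elts \<alpha>. elts (f \<eta>))" .
      have "elts (f \<xi>) \<subseteq> elts (f \<eta>)" if "\<eta> \<in> elts \<alpha>" "\<xi> \<in> elts \<eta>" for \<xi> \<eta>
      proof -
        have "elts \<xi> \<subseteq> elts \<eta>" using Ord_trans[OF Ord_mem[OF O\<alpha> that(1)] that(2)] by blast
        then show ?thesis using ef that Ord_trans[OF O\<alpha>] Umono[OF image_mono] by metis
      qed
      moreover have "elts \<alpha> \<noteq> {}" using inf by auto
      moreover have "\<forall>\<alpha>\<in>elts \<kappa>. \<forall>f. elts \<alpha> \<noteq> {} \<and> (\<forall>\<xi>\<in>elts \<alpha>. f \<xi> \<in> C) \<and>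
        (\<forall>\<eta>\<in>elts \<alpha>. \<forall>\<xi>\<in>elts \<eta>. elts (f \<xi>) \<subseteq> elts (f \<eta>)) \<longrightarrow> vset (\<Union>\<xi>\<in>elts \<alpha>. elts (f \<xi>)) \<in> C"
        using C unfolding club_def by blast
      ultimately show ?thesis unfolding UB using step.prems(1) fC by metis
    qed
  qed
  define T where "T l = elts (c (set l))" for l
  have TA: "c (set l) \<in> Pk \<kappa> A" if "l \<in> lists A" for l
    using cC[of "set l"] that CP by auto
  have "small_op A T"
    unfolding small_op_def T_def using TA PkD by blast
  moreover have "x \<in> C" if x: "x \<in> Pk \<kappa> A" and cl: "closed_under T (elts x)" for x
  proof -
    \<comment> \<open>For closed x the set \<open>U (elts x)\<close> is x itself, and
      \<open>UC\<close> says that it is in C.\<close>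
    have "U (elts x) \<subseteq> elts x" using cl unfolding U_def closed_under_def T_def by blast
    moreover have "a \<in> U (elts x)" if "a \<in> elts x" for a
    proof -
      have "{a} \<subseteq> elts (c {a})" using Fc[of "{a}"] that PkD(1)[OF x] by auto
      then show ?thesis unfolding U_def using that by (intro UN_I[of "[a]"]) auto
    qed
    ultimately have "U (elts x) = elts x" by blast
    moreover obtain \<alpha> where "\<alpha> \<in> elts \<kappa>" "elts x \<approx> elts \<alpha>"
      using lesspoll_Card[OF PkD(2)[OF x] Card] eqpoll_sym by metis
    ultimately show ?thesis using UC[of \<alpha> "elts x"] PkD(1)[OF x] by simp
  qed
  ultimately show ?thesis using that by blast
qed

end

section \<open>Hereditarily small sets\<close>

lemma small_opairs: "small A \<Longrightarrow> small B \<Longrightarrow> small {opair a b |a b. a \<in> A \<and> b \<in> B}"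
proof -
  assume "small A" "small B"
  then have "small (\<Union>a\<in>A. opair a ` B)" by (intro small_UN small_image)
  moreover have "{opair a b |a b. a \<in> A \<and> b \<in> B} = (\<Union>a\<in>A. opair a ` B)" by blast
  ultimately show ?thesis by simp
qed

lemma TC_cases: "u \<in> TC x \<Longrightarrow> u \<in> elts x \<or> (\<exists>v\<in>elts x. u \<in> TC v)"
  unfolding TC_def by (auto elim: tranclp.cases)

lemma TC_mem_subset: "y \<in> elts x \<Longrightarrow> TC y \<subseteq> TC x"
  using TC_least[OF transitive_TC] TC_step elts_subset_TC by blast

lemma TC_eq: "TC x = elts x \<union> (\<Union>y\<in>elts x. TC y)"
proof (intro equalityI subsetI)
  fix u assume "u \<in> TC x"
  then show "u \<in> elts x \<union> (\<Union>y\<in>elts x. TC y)" using TC_cases[of u x] by blast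
next
  fix u assume "u \<in> elts x \<union> (\<Union>y\<in>elts x. TC y)"
  then show "u \<in> TC x" using elts_subset_TC[of x] TC_mem_subset[of _ x] by blast
qed

text \<open>A set is determined by its elements together with the membership relation of its transitive closure,
  both transported along an injection into \<open>\<theta>\<close>.\<close>

lemma small_Hset: "small (Hset (\<theta> :: 'v::zfc))"
proof -
  have "\<forall>x. x \<in> Hset \<theta> \<longrightarrow> (\<exists>f. inj_on f (TC x) \<and> f ` TC x \<subseteq> elts \<theta>)"
    unfolding Hset_def by (auto dest!: lesspoll_imp_lepoll simp: lepoll_def)
  then obtain f :: "'v \<Rightarrow> 'v \<Rightarrow> 'v" where f: "\<And>x. x \<in> Hset \<theta> \<Longrightarrow> inj_on (f x) (TC x)"
    "\<And>x. x \<in> Hset \<theta> \<Longrightarrow> f x ` TC x \<subseteq> elts \<theta>" by metis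
  define P where "P = vset {opair a b |a b. a \<in> elts \<theta> \<and> b \<in> elts \<theta>}"
  have P: "elts P = {opair a b |a b. a \<in> elts \<theta> \<and> b \<in> elts \<theta>}"
    unfolding P_def by (intro elts_vset small_opairs small_elts)
  define R where "R x = {opair (f x u) (f x v) |u v. u \<in> TC x \<and> v \<in> TC x \<and> u \<in> elts v}" for x
  define E where "E x = f x ` elts x" for x
  have RE: "R x \<subseteq> elts P" "E x \<subseteq> elts \<theta>" if "x \<in> Hset \<theta>" for x
    using f(2)[OF that] elts_subset_TC[of x] unfolding R_def E_def P by blast+
  define code where "code x = opair (vset (R x)) (vset (E x))" for x
  have "inj_on code (Hset \<theta>)"
  proof (rule inj_onI)
    fix x y assume x: "x \<in> Hset \<theta>" and y: "y \<in> Hset \<theta>" and "code x = code y"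
    then have "vset (R x) = vset (R y)" "vset (E x) = vset (E y)" unfolding code_def by simp_all
    then have R: "R x = R y" and E: "E x = E y"
      using elts_vset[OF small_subset[OF small_elts]] RE x y by metis+
    have sub: "\<exists>w'\<in>elts v. f b w' = f a w"
      if a: "a \<in> Hset \<theta>" and b: "b \<in> Hset \<theta>" and Rab: "R a = R b"
        and u: "u \<in> TC a" and v: "v \<in> TC b" and uv: "f a u = f b v" and w: "w \<in> elts u" for a b u v w
    proof -
      have "w \<in> TC a" using w u TC_step by blast
      then have "opair (f a w) (f a u) \<in> R b" unfolding Rab[symmetric] unfolding R_def using u w by blast
      then obtain w' v' where "w' \<in> TC b" "v' \<in> TC b" "w' \<in> elts v'" "f b w' = f a w" "f b v' = f a u"
        unfolding R_def by auto
      then show ?thesis using uv f(1)[OF b] v by (metis inj_onD)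
    qed
    have agree: "u = v" if "u \<in> TC x" "v \<in> TC y" "f x u = f y v" for u v
      using that
    proof (induction u arbitrary: v rule: elts_induct)
      case (step u)
      have "elts u \<subseteq> elts v"
      proof
        fix w assume w: "w \<in> elts u"
        then obtain w' where "w' \<in> elts v" "f y w' = f x w" using sub[OF x y R step.prems w] by blast
        then show "w \<in> elts v" using step.IH[OF w, of w'] w step.prems(1,2) TC_step by (metis subsetD)
      qed
      moreover have "elts v \<subseteq> elts u"
      proof
        fix w' assume w': "w' \<in> elts v"
        then obtain w where w: "w \<in> elts u" "f x w = f y w'"
          using sub[OF y x R[symmetric] step.prems(2,1) step.prems(3)[symmetric] w'] by blast
        then show "w' \<in> elts u" using step.IH[of w w'] w' step.prems(1,2) TC_step by (metis subsetD)
      qed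
      ultimately show ?case using extensionality by blast
    qed
    have "elts x \<subseteq> elts y"
    proof
      fix u assume u: "u \<in> elts x"
      then have "f x u \<in> E y" using E unfolding E_def by blast
      then obtain v where "v \<in> elts y" "f x u = f y v" unfolding E_def by blast
      then show "u \<in> elts y" using agree u elts_subset_TC by blast
    qed
    moreover have "elts y \<subseteq> elts x"
    proof
      fix v assume v: "v \<in> elts y"
      then have "f y v \<in> E x" using E unfolding E_def by blast
      then obtain u where "u \<in> elts x" "f x u = f y v" unfolding E_def by (metis imageE)
      then show "v \<in> elts x" using agree v elts_subset_TC by blast
    qed
    ultimately show "x = y" using extensionality by blast
  qed
  moreover have "code ` Hset \<theta> \<subseteq> {opair a b |a b. a \<in> vset ` Pow (elts P) \<and> b \<in> vset ` Pow (elts \<theta>)}"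
    unfolding code_def using RE by blast
  ultimately have "Hset \<theta> \<lesssim> {opair a b |a b. a \<in> vset ` Pow (elts P) \<and> b \<in> vset ` Pow (elts \<theta>)}"
    unfolding lepoll_def by (intro exI[of _ code] conjI)
  then show ?thesis by (rule small_lepoll[OF small_opairs[OF small_Pow small_Pow]])
qed

lemma transitive_Hset: "transitive (Hset \<theta>)"
  unfolding transitive_def Hset_def
  using TC_mem_subset subset_imp_lepoll lesspoll_trans1 by (metis (no_types, lifting) mem_Collect_eq subsetI)

lemma HsetI: "transitive A \<Longrightarrow> elts x \<subseteq> A \<Longrightarrow> A \<prec> elts \<theta> \<Longrightarrow> x \<in> Hset \<theta>"
  unfolding Hset_def using TC_least subset_imp_lepoll lesspoll_trans1 by (metis mem_Collect_eq)

lemma Hset_lesspoll: "x \<in> Hset \<theta> \<Longrightarrow> elts x \<prec> elts \<theta>"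
  unfolding Hset_def using elts_subset_TC subset_imp_lepoll lesspoll_trans1 by (metis mem_Collect_eq)

lemma Card_mem_Hset: "Card \<theta> \<Longrightarrow> \<alpha> \<in> elts \<theta> \<Longrightarrow> \<alpha> \<in> Hset \<theta>"
  by (rule HsetI[of "elts \<alpha>"]) (auto intro: Card_lesspoll dest: Card_Ord Ord_mem simp: Ord_def)

text \<open>All that the absoluteness of pairs and injections requires, and common to H(\<theta>),
  to the domain of an embedding and to models of ZFC without Power Set.\<close>

definition pair_closed :: "'v::zfc set \<Rightarrow> bool" where
  "pair_closed N \<longleftrightarrow> transitive N \<and> (\<forall>x\<in>N. \<forall>y\<in>N. vset {x, y} \<in> N)"

lemma pair_closed_opair: "pair_closed N \<Longrightarrow> x \<in> N \<Longrightarrow> y \<in> N \<Longrightarrow> opair x y \<in> N"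
  unfolding pair_closed_def opair_def by (metis insert_absorb2)

lemma pair_closed_opairD:
  assumes "transitive N" "opair x y \<in> N" shows "x \<in> N" "y \<in> N"
proof -
  have "vset {x, y} \<in> N" using assms elts_opair[of x y] unfolding transitive_def by auto
  then have "{x, y} \<subseteq> N" using assms(1) elts_vset[OF small_doubleton, of x y] unfolding transitive_def by metis
  then show "x \<in> N" "y \<in> N" by auto
qed

context regular_above_omega1
begin

lemma Hset_iff: "x \<in> Hset \<kappa> \<longleftrightarrow> elts x \<subseteq> Hset \<kappa> \<and> elts x \<prec> elts \<kappa>"
proof
  assume "x \<in> Hset \<kappa>"
  then show "elts x \<subseteq> Hset \<kappa> \<and> elts x \<prec> elts \<kappa>"
    using transitive_Hset Hset_lesspoll unfolding transitive_def by blast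
next
  assume x: "elts x \<subseteq> Hset \<kappa> \<and> elts x \<prec> elts \<kappa>"
  have "(\<Union>y\<in>elts x. TC y) \<prec> elts \<kappa>"
    by (rule regular_UN[OF regular]) (use x in \<open>auto simp: Hset_def\<close>)
  then have "TC x \<prec> elts \<kappa>" unfolding TC_eq[of x] using x regular_Un[OF regular] by blast
  then show "x \<in> Hset \<kappa>" unfolding Hset_def by blast
qed

lemma vset_mem_Hset: "B \<subseteq> Hset \<kappa> \<Longrightarrow> B \<prec> elts \<kappa> \<Longrightarrow> vset B \<in> Hset \<kappa>"
  by (subst Hset_iff) (simp add: elts_vset[OF lesspoll_small])

lemma Hset_subset: "x \<in> Hset \<kappa> \<Longrightarrow> B \<subseteq> elts x \<Longrightarrow> vset B \<in> Hset \<kappa>"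
  using vset_mem_Hset Hset_iff subset_imp_lepoll lesspoll_trans1 by (metis order_trans)

lemma pair_closed_Hset: "pair_closed (Hset \<kappa>)"
  unfolding pair_closed_def by (auto intro!: transitive_Hset vset_mem_Hset finite_lesspoll)

lemma opair_Hset: "x \<in> Hset \<kappa> \<Longrightarrow> y \<in> Hset \<kappa> \<Longrightarrow> opair x y \<in> Hset \<kappa>"
  by (rule pair_closed_opair[OF pair_closed_Hset])

end

section \<open>Absoluteness\<close>

lemma ext_transitive: "transitive N \<Longrightarrow> x \<in> N \<Longrightarrow> ext N x = elts x"
  unfolding ext_def transitive_def by blast

lemma elts_eq_vset: "small A \<Longrightarrow> elts z = A \<longleftrightarrow> z = vset A"
  using elts_vset vset_elts by metis

lemma opair_in_iff:
  assumes N: "pair_closed N" and "x \<in> N" "y \<in> N" "p \<in> N"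
  shows "opair_in N x y p \<longleftrightarrow> p = opair x y"
proof -
  have T: "transitive N" and s: "vset {x} \<in> N" "vset {x, y} \<in> N"
    using N assms(2,3) unfolding pair_closed_def by (metis insert_absorb2)+
  have e: "ext N z = {x} \<or> ext N z = {x, y} \<longleftrightarrow> z \<in> elts (opair x y)" if "z \<in> N" for z
    unfolding ext_transitive[OF T that] elts_opair by (simp add: elts_eq_vset)
  have "opair_in N x y p \<longleftrightarrow> (\<forall>z\<in>N. z \<in> elts p \<longleftrightarrow> z \<in> elts (opair x y))"
    unfolding opair_in_def ext_transitive[OF T assms(4)] using e by simp
  also have "\<dots> \<longleftrightarrow> elts p = elts (opair x y)"
  proof -
    have "elts p \<subseteq> N" "elts (opair x y) \<subseteq> N"
      using s assms(4) T unfolding transitive_def elts_opair by auto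
    then show ?thesis by blast
  qed
  finally show ?thesis using extensionality[of p "opair x y"] by auto
qed

lemma rel_in_iff:
  assumes N: "pair_closed N" and "r \<in> N" "x \<in> N" "y \<in> N"
  shows "rel_in N r x y \<longleftrightarrow> opair x y \<in> elts r"
proof -
  have T: "transitive N" using N unfolding pair_closed_def by blast
  then have "p \<in> N" if "p \<in> elts r" for p using that assms(2) unfolding transitive_def by blast
  then show ?thesis
    unfolding rel_in_def ext_transitive[OF T assms(2)] using opair_in_iff[OF N assms(3,4)] by blast
qed

text \<open>As all members of f have to be pairs, f is the graph of a HOL function. This is the
  passage between injections coded in N and HOL cardinalities.\<close>

lemma injection_in_iff:
  assumes N: "pair_closed N" and f: "f \<in> N" and x: "x \<in> N" and y: "y \<in> N"
  shows "injection_in N f x y \<longleftrightarrow>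
    (\<exists>g. inj_on g (elts x) \<and> g ` elts x \<subseteq> elts y \<and> elts f = (\<lambda>u. opair u (g u)) ` elts x)"
    (is "_ \<longleftrightarrow> ?R")
proof -
  have T: "transitive N" using N unfolding pair_closed_def by blast
  have sub: "elts z \<subseteq> N" if "z \<in> N" for z using that T unfolding transitive_def by blast
  let ?I = "(\<forall>p\<in>elts f. \<exists>u\<in>elts x. \<exists>v\<in>elts y. p = opair u v) \<and>
     (\<forall>u\<in>elts x. \<exists>!v. v \<in> elts y \<and> opair u v \<in> elts f) \<and>
     (\<forall>u\<in>elts x. \<forall>u'\<in>elts x. \<forall>v\<in>elts y. opair u v \<in> elts f \<and> opair u' v \<in> elts f \<longrightarrow> u = u')"
  have "injection_in N f x y \<longleftrightarrow> ?I"
  proof -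
    have o: "opair_in N u v p \<longleftrightarrow> p = opair u v" if "p \<in> elts f" "u \<in> elts x" "v \<in> elts y" for u v p
      using opair_in_iff[OF N, of u v p] that sub[OF x] sub[OF y] sub[OF f] by blast
    have r: "rel_in N f u v \<longleftrightarrow> opair u v \<in> elts f" if "u \<in> elts x" "v \<in> elts y" for u v
      using rel_in_iff[OF N f, of u v] that sub[OF x] sub[OF y] by blast
    show ?thesis
      unfolding injection_in_def ext_transitive[OF T x] ext_transitive[OF T y] ext_transitive[OF T f]
      by (simp add: o r cong: ball_cong bex_cong conj_cong)
  qed
  also have "\<dots> \<longleftrightarrow> ?R"
  proof
    assume L: "?I"
    then have "\<forall>u\<in>elts x. \<exists>v. v \<in> elts y \<and> opair u v \<in> elts f" by (meson ex1_implies_ex)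
    then obtain g where g: "\<And>u. u \<in> elts x \<Longrightarrow> g u \<in> elts y \<and> opair u (g u) \<in> elts f" by metis
    have "inj_on g (elts x)"
    proof (rule inj_onI)
      fix u u' assume u: "u \<in> elts x" "u' \<in> elts x" "g u = g u'"
      have "opair u (g u) \<in> elts f \<and> opair u' (g u) \<in> elts f" using g[OF u(1)] g[OF u(2)] u(3) by simp
      then show "u = u'" using L u(1,2) g[OF u(1)] by blast
    qed
    moreover have "elts f = (\<lambda>u. opair u (g u)) ` elts x"
    proof (intro equalityI subsetI)
      fix p assume p: "p \<in> elts f"
      then obtain u v where uv: "u \<in> elts x" "v \<in> elts y" "p = opair u v" using L by blast
      then have "v = g u" using L g[OF uv(1)] p by blast
      then show "p \<in> (\<lambda>u. opair u (g u)) ` elts x" using uv by simp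
    qed (use g in auto)
    ultimately show ?R using g by blast
  next
    assume ?R
    then obtain g where "inj_on g (elts x)" "g ` elts x \<subseteq> elts y" "elts f = (\<lambda>u. opair u (g u)) ` elts x" by blast
    then show "?I"
      by (auto simp: image_iff inj_on_def image_subset_iff)
  qed
  finally show ?thesis .
qed

lemma bijection_in_iff:
  assumes N: "pair_closed N" and f: "f \<in> N" and x: "x \<in> N" and y: "y \<in> N"
  shows "bijection_in N f x y \<longleftrightarrow>
    (\<exists>g. bij_betw g (elts x) (elts y) \<and> elts f = (\<lambda>u. opair u (g u)) ` elts x)"
proof -
  have T: "transitive N" using N unfolding pair_closed_def by blast
  have sub: "elts z \<subseteq> N" if "z \<in> N" for z using that T unfolding transitive_def by blast
  have "(\<forall>v\<in>ext N y. \<exists>u\<in>ext N x. rel_in N f u v) \<longleftrightarrow> (\<forall>v\<in>elts y. \<exists>u\<in>elts x. opair u v \<in> elts f)"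
    unfolding ext_transitive[OF T x] ext_transitive[OF T y]
    using rel_in_iff[OF N f] sub[OF x] sub[OF y] by blast
  then show ?thesis
    unfolding bijection_in_def injection_in_iff[OF assms] by (auto simp: bij_betw_def image_iff) blast+
qed

lemma transitive_in_iff: "transitive N \<Longrightarrow> x \<in> N \<Longrightarrow> transitive_in N x \<longleftrightarrow> transitive (elts x)"
  unfolding transitive_in_def using ext_transitive unfolding transitive_def by (metis subsetD)

lemma Ord_in_iff: "transitive N \<Longrightarrow> x \<in> N \<Longrightarrow> Ord_in N x \<longleftrightarrow> Ord x"
  unfolding Ord_in_def Ord_def using transitive_in_iff ext_transitive by (metis subsetD transitive_def)

text \<open>Minimality in N compares t only with transitive sets in N, so the true closure has to be
  one of them.\<close>

lemma TC_in_iff: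
  assumes "transitive N" "x \<in> N" "t \<in> N" "vset (TC x) \<in> N"
  shows "TC_in N x t \<longleftrightarrow> elts t = TC x"
proof -
  have e: "elts (vset (TC x)) = TC x" by (simp add: elts_vset)
  have "TC_in N x t \<longleftrightarrow> transitive (elts t) \<and> elts x \<subseteq> elts t \<and>
      (\<forall>u\<in>N. transitive (elts u) \<and> elts x \<subseteq> elts u \<longrightarrow> elts t \<subseteq> elts u)"
    unfolding TC_in_def using assms transitive_in_iff ext_transitive by metis
  also have "\<dots> \<longleftrightarrow> elts t = TC x"
    using assms(4) e transitive_TC elts_subset_TC TC_least by (metis subset_antisym)
  finally show ?thesis .
qed

section \<open>Formulas\<close>

definition Or_fm :: "fm \<Rightarrow> fm \<Rightarrow> fm" where "Or_fm \<phi> \<psi> = Neg (Conj (Neg \<phi>) (Neg \<psi>))"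
definition Imp_fm :: "fm \<Rightarrow> fm \<Rightarrow> fm" where "Imp_fm \<phi> \<psi> = Neg (Conj \<phi> (Neg \<psi>))"
definition Iff_fm :: "fm \<Rightarrow> fm \<Rightarrow> fm" where "Iff_fm \<phi> \<psi> = Conj (Imp_fm \<phi> \<psi>) (Imp_fm \<psi> \<phi>)"
definition All_fm :: "nat \<Rightarrow> fm \<Rightarrow> fm" where "All_fm n \<phi> = Neg (Exists n (Neg \<phi>))"

lemma sat_derived [simp]:
  "sat N (Or_fm \<phi> \<psi>) s \<longleftrightarrow> sat N \<phi> s \<or> sat N \<psi> s"
  "sat N (Imp_fm \<phi> \<psi>) s \<longleftrightarrow> (sat N \<phi> s \<longrightarrow> sat N \<psi> s)"
  "sat N (Iff_fm \<phi> \<psi>) s \<longleftrightarrow> (sat N \<phi> s \<longleftrightarrow> sat N \<psi> s)"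
  "sat N (All_fm n \<phi>) s \<longleftrightarrow> (\<forall>x\<in>N. sat N \<phi> (s(n := x)))"
  unfolding Or_fm_def Imp_fm_def Iff_fm_def All_fm_def by auto

text \<open>Here and below, bound variables are numbered above the sum of the free ones, which makes
  them fresh.\<close>

definition doubleton_fm :: "nat \<Rightarrow> nat \<Rightarrow> nat \<Rightarrow> fm" where
  "doubleton_fm x y z = (let u = x + y + z + 1 in All_fm u (Iff_fm (Mem u z) (Or_fm (Eq u x) (Eq u y))))"

lemma sat_doubleton_fm [simp]:
  assumes "\<And>i. s i \<in> N"
  shows "sat N (doubleton_fm x y z) s \<longleftrightarrow> ext N (s z) = {s x, s y}"
  using assms unfolding doubleton_fm_def Let_def ext_def by auto

definition opair_fm :: "nat \<Rightarrow> nat \<Rightarrow> nat \<Rightarrow> fm" where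
  "opair_fm x y p = (let z = x + y + p + 1 in
     All_fm z (Iff_fm (Mem z p) (Or_fm (doubleton_fm x x z) (doubleton_fm x y z))))"

lemma sat_opair_fm [simp]:
  assumes "\<And>i. s i \<in> N"
  shows "sat N (opair_fm x y p) s \<longleftrightarrow> opair_in N (s x) (s y) (s p)"
proof -
  have "sat N (doubleton_fm a b c) (s(k := z)) \<longleftrightarrow> ext N ((s(k := z)) c) = {(s(k := z)) a, (s(k := z)) b}"
    if "z \<in> N" for a b c k z using that assms by (intro sat_doubleton_fm) simp
  then show ?thesis unfolding opair_fm_def Let_def opair_in_def by (simp add: ext_def)
qed

definition rel_fm :: "nat \<Rightarrow> nat \<Rightarrow> nat \<Rightarrow> fm" where
  "rel_fm r x y = (let p = r + x + y + 1 in Exists p (Conj (Mem p r) (opair_fm x y p)))"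

lemma sat_rel_fm [simp]:
  assumes "\<And>i. s i \<in> N"
  shows "sat N (rel_fm r x y) s \<longleftrightarrow> rel_in N (s r) (s x) (s y)"
proof -
  have "sat N (opair_fm a b c) (s(k := z)) \<longleftrightarrow> opair_in N ((s(k := z)) a) ((s(k := z)) b) ((s(k := z)) c)"
    if "z \<in> N" for a b c k z using that assms by (intro sat_opair_fm) simp
  then show ?thesis unfolding rel_fm_def Let_def rel_in_def by (auto simp: ext_def)
qed

definition injection_fm :: "nat \<Rightarrow> nat \<Rightarrow> nat \<Rightarrow> fm" where
  "injection_fm f x y = (let k = f + x + y in
     Conj (All_fm (k+3) (Imp_fm (Mem (k+3) f) (Exists (k+4) (Conj (Mem (k+4) x)
            (Exists (k+5) (Conj (Mem (k+5) y) (opair_fm (k+4) (k+5) (k+3))))))))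
    (Conj (All_fm (k+3) (Imp_fm (Mem (k+3) x) (Exists (k+4) (Conj (Mem (k+4) y) (Conj (rel_fm f (k+3) (k+4))
            (All_fm (k+5) (Imp_fm (Conj (Mem (k+5) y) (rel_fm f (k+3) (k+5))) (Eq (k+5) (k+4)))))))))
      (All_fm (k+3) (Imp_fm (Mem (k+3) x) (All_fm (k+4) (Imp_fm (Mem (k+4) x)
         (All_fm (k+5) (Imp_fm (Mem (k+5) y) (Imp_fm (Conj (rel_fm f (k+3) (k+5)) (rel_fm f (k+4) (k+5)))
            (Eq (k+3) (k+4)))))))))))"

lemma sat_injection_fm [simp]:
  assumes "\<And>i. s i \<in> N"
  shows "sat N (injection_fm f x y) s \<longleftrightarrow> injection_in N (s f) (s x) (s y)"
proof -
  define k where "k = f + x + y"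
  define q where "q a b c = s(k+3 := a, k+4 := b, k+5 := c)" for a b c
  have q: "q a b c i \<in> N" if "a \<in> N" "b \<in> N" "c \<in> N" for a b c i
    unfolding q_def using that assms by simp
  have o: "sat N (opair_fm (k+4) (k+5) (k+3)) (s(k+3 := a, k+4 := b, k+5 := c)) \<longleftrightarrow> opair_in N b c a"
    if "a \<in> N" "b \<in> N" "c \<in> N" for a b c
    using sat_opair_fm[of "q a b c" N "k+4" "k+5" "k+3"] q[OF that] unfolding q_def by simp
  have r: "sat N (rel_fm f (k+3) (k+4)) (s(k+3 := a, k+4 := b)) \<longleftrightarrow> rel_in N (s f) a b"
    if "a \<in> N" "b \<in> N" for a b
    using sat_rel_fm[of "s(k+3 := a, k+4 := b)" N f "k+3" "k+4"] that assms by (simp add: k_def)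
  have r3: "sat N (rel_fm f (k+3) (k+5)) (s(k+3 := a, k+4 := b, k+5 := c)) \<longleftrightarrow> rel_in N (s f) a c"
    "sat N (rel_fm f (k+4) (k+5)) (s(k+3 := a, k+4 := b, k+5 := c)) \<longleftrightarrow> rel_in N (s f) b c"
    if "a \<in> N" "b \<in> N" "c \<in> N" for a b c
    using sat_rel_fm[of "q a b c" N f "k+3" "k+5"] sat_rel_fm[of "q a b c" N f "k+4" "k+5"] q[OF that]
    unfolding q_def by (simp_all add: k_def)
  have s: "(s(k+3 := a)) f = s f" "(s(k+3 := a, k+4 := b)) x = s x" "(s(k+3 := a)) x = s x"
    "(s(k+3 := a, k+4 := b)) y = s y"
    "(s(k+3 := a, k+4 := b, k+5 := c)) y = s y" for a b c by (simp_all add: k_def)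
  have "sat N (injection_fm f x y) s \<longleftrightarrow>
     (\<forall>p\<in>N. p \<in> elts (s f) \<longrightarrow> (\<exists>u\<in>N. u \<in> elts (s x) \<and> (\<exists>v\<in>N. v \<in> elts (s y) \<and> opair_in N u v p))) \<and>
     (\<forall>u\<in>N. u \<in> elts (s x) \<longrightarrow> (\<exists>v\<in>N. v \<in> elts (s y) \<and> rel_in N (s f) u v \<and>
        (\<forall>v'\<in>N. v' \<in> elts (s y) \<and> rel_in N (s f) u v' \<longrightarrow> v' = v))) \<and>
     (\<forall>u\<in>N. u \<in> elts (s x) \<longrightarrow> (\<forall>u'\<in>N. u' \<in> elts (s x) \<longrightarrow> (\<forall>v\<in>N. v \<in> elts (s y) \<longrightarrow>
        rel_in N (s f) u v \<and> rel_in N (s f) u' v \<longrightarrow> u = u')))"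
    unfolding injection_fm_def Let_def k_def[symmetric] sat_derived sat.simps s
    by (simp add: o r r3 cong: ball_cong bex_cong)
  also have "\<dots> \<longleftrightarrow> injection_in N (s f) (s x) (s y)"
  proof -
    have "(\<exists>v\<in>N. v \<in> elts (s y) \<and> rel_in N (s f) u v \<and>
        (\<forall>v'\<in>N. v' \<in> elts (s y) \<and> rel_in N (s f) u v' \<longrightarrow> v' = v)) \<longleftrightarrow>
      (\<exists>!v. v \<in> {z \<in> N. z \<in> elts (s y)} \<and> rel_in N (s f) u v)" for u
      unfolding Ex1_def by auto
    then show ?thesis
      by (simp add: injection_in_def ext_def Ball_def Bex_def imp_conjL conj_assoc)
  qed
  finally show ?thesis .
qed

definition bijection_fm :: "nat \<Rightarrow> nat \<Rightarrow> nat \<Rightarrow> fm" where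
  "bijection_fm f x y = (let k = f + x + y in Conj (injection_fm f x y)
     (All_fm (k+3) (Imp_fm (Mem (k+3) y) (Exists (k+4) (Conj (Mem (k+4) x) (rel_fm f (k+4) (k+3)))))))"

lemma sat_bijection_fm [simp]:
  assumes "\<And>i. s i \<in> N"
  shows "sat N (bijection_fm f x y) s \<longleftrightarrow> bijection_in N (s f) (s x) (s y)"
proof -
  define k where "k = f + x + y"
  have r: "sat N (rel_fm f (k+4) (k+3)) (s(k+3 := a, k+4 := b)) \<longleftrightarrow> rel_in N (s f) b a"
    if "a \<in> N" "b \<in> N" for a b
    using sat_rel_fm[of "s(k+3 := a, k+4 := b)" N f "k+4" "k+3"] that assms by (simp add: k_def)
  have s: "(s(k+3 := a, k+4 := b)) x = s x" "(s(k+3 := a)) y = s y" for a b by (simp_all add: k_def)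
  have fk: "f \<noteq> k+3" "f \<noteq> k+4" by (simp_all add: k_def)
  have "sat N (bijection_fm f x y) s \<longleftrightarrow> injection_in N (s f) (s x) (s y) \<and>
      (\<forall>v\<in>N. v \<in> elts (s y) \<longrightarrow> (\<exists>u\<in>N. u \<in> elts (s x) \<and> rel_in N (s f) u v))"
    unfolding bijection_fm_def Let_def k_def[symmetric] sat_derived sat.simps s
    by (simp add: r assms fk cong: ball_cong bex_cong)
  then show ?thesis unfolding bijection_in_def ext_def by blast
qed

definition trans_fm :: "nat \<Rightarrow> fm" where
  "trans_fm x = All_fm (x+1) (Imp_fm (Mem (x+1) x) (All_fm (x+2) (Imp_fm (Mem (x+2) (x+1)) (Mem (x+2) x))))"

lemma sat_trans_fm [simp]: "sat N (trans_fm x) s \<longleftrightarrow> transitive_in N (s x)"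
  unfolding trans_fm_def transitive_in_def ext_def by auto

definition subset_fm :: "nat \<Rightarrow> nat \<Rightarrow> fm" where
  "subset_fm x y = (let k = x + y + 1 in All_fm k (Imp_fm (Mem k x) (Mem k y)))"

lemma sat_subset_fm [simp]: "sat N (subset_fm x y) s \<longleftrightarrow> ext N (s x) \<subseteq> ext N (s y)"
  unfolding subset_fm_def Let_def ext_def by auto

definition TC_fm :: "nat \<Rightarrow> nat \<Rightarrow> fm" where
  "TC_fm x t = (let u = x + t + 1 in Conj (Conj (trans_fm t) (subset_fm x t))
     (All_fm u (Imp_fm (Conj (trans_fm u) (subset_fm x u)) (subset_fm t u))))"

lemma sat_TC_fm [simp]: "sat N (TC_fm x t) s \<longleftrightarrow> TC_in N (s x) (s t)"
  unfolding TC_fm_def Let_def TC_in_def by auto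

definition Hset_fm :: "nat \<Rightarrow> nat \<Rightarrow> fm" where
  "Hset_fm z d = (let k = z + d in Exists (k+3) (Conj (TC_fm z (k+3))
     (Exists (k+4) (Conj (Mem (k+4) d) (Exists (k+5) (bijection_fm (k+5) (k+3) (k+4)))))))"

lemma sat_Hset_fm [simp]:
  assumes "\<And>i. s i \<in> N"
  shows "sat N (Hset_fm z d) s \<longleftrightarrow> s z \<in> Hset_in N (s d)"
proof -
  define k where "k = z + d"
  have b: "sat N (bijection_fm (k+5) (k+3) (k+4)) (s(k+3 := t, k+4 := \<alpha>, k+5 := f)) \<longleftrightarrow> bijection_in N f t \<alpha>"
    if "t \<in> N" "\<alpha> \<in> N" "f \<in> N" for t \<alpha> f
    using sat_bijection_fm[of "s(k+3 := t, k+4 := \<alpha>, k+5 := f)" N "k+5" "k+3" "k+4"] that assms by simp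
  have s: "(s(k+3 := a)) z = s z" "(s(k+3 := a, k+4 := b)) d = s d" "(s(k+3 := a)) (k+3) = a"
    "(s(k+3 := a, k+4 := b)) (k+4) = b" for a b by (simp_all add: k_def)
  show ?thesis
    unfolding Hset_fm_def Let_def k_def[symmetric] sat_derived sat.simps sat_TC_fm s Hset_in_def ext_def mem_Collect_eq
    by (simp add: b assms cong: bex_cong) (simp add: Bex_def)
qed

text \<open>A strict bound for free and bound variables. Below it an assignment becomes a finite
  list, on which closure operations can act.\<close>

primrec var_bound :: "fm \<Rightarrow> nat" where
  "var_bound (Mem m n) = Suc (max m n)"
| "var_bound (Eq m n) = Suc (max m n)"
| "var_bound (Neg \<phi>) = var_bound \<phi>"
| "var_bound (Conj \<phi> \<psi>) = max (var_bound \<phi>) (var_bound \<psi>)"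
| "var_bound (Exists n \<phi>) = max (Suc n) (var_bound \<phi>)"

lemma sat_cong: "(\<And>i. i < var_bound \<phi> \<Longrightarrow> s i = s' i) \<Longrightarrow> sat N \<phi> s \<longleftrightarrow> sat N \<phi> s'"
proof (induction \<phi> arbitrary: s s')
  case (Conj \<phi> \<psi>)
  have "sat N \<phi> s \<longleftrightarrow> sat N \<phi> s'" by (rule Conj.IH(1)) (use Conj.prems in auto)
  moreover have "sat N \<psi> s \<longleftrightarrow> sat N \<psi> s'" by (rule Conj.IH(2)) (use Conj.prems in auto)
  ultimately show ?case by simp
next
  case (Neg \<phi>)
  have "sat N \<phi> s \<longleftrightarrow> sat N \<phi> s'" by (rule Neg.IH) (use Neg.prems in auto)
  then show ?case by simp
next
  case (Exists n \<phi>)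
  have "sat N \<phi> (s(n := x)) \<longleftrightarrow> sat N \<phi> (s'(n := x))" for x
    by (rule Exists.IH) (use Exists.prems in auto)
  then show ?case by simp
qed auto

text \<open>Makes the family of Skolem operations countable, so that their union is still a small
  operation.\<close>

instance fm :: countable by countable_datatype

section \<open>Elementary embeddings\<close>

lemma elementary_sat:
  assumes "elementary_embedding j M N" "\<And>i. s i \<in> M"
  shows "sat M \<phi> s \<longleftrightarrow> sat N \<phi> (j \<circ> s)"
  using assms unfolding elementary_embedding_def by (metis image_subsetI)

text \<open>All variables from 2 on take the value c, so a formula in the variables 0, 1, 2 reads a,
  b, c.\<close>

lemma elementary_sat3:
  assumes "elementary_embedding j M N" "a \<in> M" "b \<in> M" "c \<in> M"
  shows "sat M \<phi> ((\<lambda>_. c)(0 := a, 1 := b)) \<longleftrightarrow> sat N \<phi> ((\<lambda>_. j c)(0 := j a, 1 := j b))"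
proof -
  have "j \<circ> ((\<lambda>_. c)(0 := a, 1 := b)) = (\<lambda>_. j c)(0 := j a, 1 := j b)" by auto
  moreover have "((\<lambda>_. c)(0 := a, 1 := b)) i \<in> M" for i using assms by simp
  ultimately show ?thesis using elementary_sat[OF assms(1)] by metis
qed

locale elementary =
  fixes j :: "'v::zfc \<Rightarrow> 'v" and M N :: "'v set"
  assumes elem: "elementary_embedding j M N" and trans_dom: "transitive M" and pair_cod: "pair_closed N"
begin

lemma in_cod: "x \<in> M \<Longrightarrow> j x \<in> N"
  using elem unfolding elementary_embedding_def by blast

lemma elts_dom: "x \<in> M \<Longrightarrow> elts x \<subseteq> M"
  using trans_dom unfolding transitive_def by blast

lemma trans_cod: "transitive N"
  using pair_cod unfolding pair_closed_def by blast

lemma elts_cod: "x \<in> N \<Longrightarrow> elts x \<subseteq> N"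
  using trans_cod unfolding transitive_def by blast

lemma mem_iff: "a \<in> M \<Longrightarrow> b \<in> M \<Longrightarrow> j a \<in> elts (j b) \<longleftrightarrow> a \<in> elts b"
  using elementary_sat3[OF elem, of a b b "Mem 0 1"] by simp

lemma eq_iff: "a \<in> M \<Longrightarrow> b \<in> M \<Longrightarrow> j a = j b \<longleftrightarrow> a = b"
  using elementary_sat3[OF elem, of a b b "Eq 0 1"] by simp

lemma inj: "inj_on j M"
  using eq_iff by (meson inj_onI)

text \<open>Existence of unordered pairs reflects from the codomain to the domain.\<close>

lemma pair_dom: "pair_closed M"
  unfolding pair_closed_def
proof (intro conjI ballI trans_dom)
  fix a b assume a: "a \<in> M" and b: "b \<in> M"
  let ?s = "(\<lambda>_. b)(0 := a, 1 := b)" and ?t = "(\<lambda>_. j b)(0 := j a, 1 := j b)"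
  have t: "(?t(2 := z)) i \<in> N" if "z \<in> N" for z i using that in_cod a b by simp
  have s: "(?s(2 := z)) i \<in> M" if "z \<in> M" for z i using that a b by simp
  have p: "vset {j a, j b} \<in> N" using pair_cod in_cod a b unfolding pair_closed_def by blast
  have "ext N (vset {j a, j b}) = {j a, j b}" unfolding ext_transitive[OF trans_cod p] by (simp add: elts_vset)
  then have "sat N (doubleton_fm 0 1 2) (?t(2 := vset {j a, j b}))" by (subst sat_doubleton_fm[OF t[OF p]]) simp
  then have "sat N (Exists 2 (doubleton_fm 0 1 2)) ?t" using p by auto
  then have "sat M (Exists 2 (doubleton_fm 0 1 2)) ?s" using elementary_sat3[OF elem a b b] by blast
  then obtain z where z: "z \<in> M" "sat M (doubleton_fm 0 1 2) (?s(2 := z))" by auto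
  then have "ext M z = {a, b}" by (subst (asm) sat_doubleton_fm[OF s[OF z(1)]]) simp
  then have "elts z = {a, b}" using ext_transitive[OF trans_dom z(1)] by simp
  then show "vset {a, b} \<in> M" using z(1) by (metis vset_elts)
qed

lemma j_opair:
  assumes "a \<in> M" "b \<in> M" shows "j (opair a b) = opair (j a) (j b)"
proof -
  have p: "opair a b \<in> M" by (rule pair_closed_opair[OF pair_dom assms])
  have "sat M (opair_fm 0 1 2) ((\<lambda>_. opair a b)(0 := a, 1 := b)) \<longleftrightarrow> opair_in M a b (opair a b)"
    by (subst sat_opair_fm) (use assms p in auto)
  moreover have "sat N (opair_fm 0 1 2) ((\<lambda>_. j (opair a b))(0 := j a, 1 := j b)) \<longleftrightarrow> opair_in N (j a) (j b) (j (opair a b))"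
    by (subst sat_opair_fm) (use assms p in_cod in auto)
  ultimately show ?thesis
    using elementary_sat3[OF elem assms p] opair_in_iff[OF pair_dom assms p]
      opair_in_iff[OF pair_cod in_cod[OF assms(1)] in_cod[OF assms(2)] in_cod[OF p]] by metis
qed

text \<open>Allows a single element of the range of j to carry several parameters, which are then
  unpacked one after the other.\<close>

lemma opair_ran:
  assumes q: "q \<in> M" and eq: "j q = opair a b"
  obtains u v where "u \<in> M" "v \<in> M" "j u = a" "j v = b"
proof -
  let ?\<phi> = "Exists 3 (Exists 4 (opair_fm 3 4 0))"
  have ab: "a \<in> N" "b \<in> N" using pair_closed_opairD[OF trans_cod] in_cod[OF q] eq by metis+
  let ?s = "(\<lambda>_. q)(0 := q, 1 := q)" and ?t = "(\<lambda>_. j q)(0 := j q, 1 := j q)"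
  have "sat N (opair_fm 3 4 0) (?t(3 := a, 4 := b)) \<longleftrightarrow> opair_in N a b (j q)"
    by (subst sat_opair_fm) (use ab q in_cod in auto)
  then have "sat N (opair_fm 3 4 0) (?t(3 := a, 4 := b))"
    using opair_in_iff[OF pair_cod ab in_cod[OF q]] eq by simp
  then have "sat N ?\<phi> ?t" using ab by auto
  then have "sat M ?\<phi> ?s" using elementary_sat3[OF elem q q q] by blast
  then obtain u v where uv: "u \<in> M" "v \<in> M" "sat M (opair_fm 3 4 0) (?s(3 := u, 4 := v))" by auto
  have "sat M (opair_fm 3 4 0) (?s(3 := u, 4 := v)) \<longleftrightarrow> opair_in M u v q"
    by (subst sat_opair_fm) (use uv q in auto)
  then have "q = opair u v" using uv(3) opair_in_iff[OF pair_dom uv(1,2) q] by simp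
  then have "opair a b = opair (j u) (j v)" using eq j_opair[OF uv(1,2)] by simp
  then show ?thesis using that uv by simp
qed

text \<open>A witness anywhere in \<open>j h\<close> yields one in the range of j. In this way
  images under j become closed under operations that are coded as sets of pairs.\<close>

lemma rel_ran:
  assumes R: "R \<in> M" and u: "u \<in> M" and h: "h \<in> M"
    and v: "v \<in> elts (j h)" "opair (j u) v \<in> elts (j R)"
  obtains w where "w \<in> elts h" "opair (j u) (j w) \<in> elts (j R)"
proof -
  let ?\<phi> = "Exists 3 (Conj (Mem 3 2) (rel_fm 0 1 3))"
  let ?s = "(\<lambda>_. h)(0 := R, 1 := u)" and ?t = "(\<lambda>_. j h)(0 := j R, 1 := j u)"
  have vN: "v \<in> N" using v(1) elts_cod in_cod[OF h] by blast
  have "sat N (rel_fm 0 1 3) (?t(3 := v)) \<longleftrightarrow> rel_in N (j R) (j u) v"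
    by (subst sat_rel_fm) (use vN assms in_cod in auto)
  then have "sat N (rel_fm 0 1 3) (?t(3 := v))"
    using rel_in_iff[OF pair_cod in_cod[OF R] in_cod[OF u] vN] v(2) by simp
  then have "sat N ?\<phi> ?t" using vN v(1) by auto
  then have "sat M ?\<phi> ?s" using elementary_sat3[OF elem R u h] by blast
  then obtain w where w: "w \<in> M" "w \<in> elts h" "sat M (rel_fm 0 1 3) (?s(3 := w))" by auto
  have "sat M (rel_fm 0 1 3) (?s(3 := w)) \<longleftrightarrow> rel_in M R u w"
    by (subst sat_rel_fm) (use w assms in auto)
  then have "opair u w \<in> elts R" using w(3) rel_in_iff[OF pair_dom R u w(1)] by simp
  then have "j (opair u w) \<in> elts (j R)"
    using mem_iff[OF pair_closed_opair[OF pair_dom u w(1)] R] by simp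
  then show ?thesis using that w(2) j_opair[OF u w(1)] by simp
qed

lemma injection_iff:
  assumes "f \<in> M" "x \<in> M" "y \<in> M"
  shows "injection_in M f x y \<longleftrightarrow> injection_in N (j f) (j x) (j y)"
proof -
  have "sat M (injection_fm 0 1 2) ((\<lambda>_. y)(0 := f, 1 := x)) \<longleftrightarrow> injection_in M f x y"
    by (subst sat_injection_fm) (use assms in auto)
  moreover have "sat N (injection_fm 0 1 2) ((\<lambda>_. j y)(0 := j f, 1 := j x)) \<longleftrightarrow> injection_in N (j f) (j x) (j y)"
    by (subst sat_injection_fm) (use assms in_cod in auto)
  ultimately show ?thesis using elementary_sat3[OF elem assms] by blast
qed

lemma j_mono:
  assumes "a \<in> M" "b \<in> M" "elts a \<subseteq> elts b" shows "elts (j a) \<subseteq> elts (j b)"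
proof -
  have "sat M (subset_fm 0 1) ((\<lambda>_. b)(0 := a, 1 := b))" using assms(3) by (auto simp: ext_def)
  then have "sat N (subset_fm 0 1) ((\<lambda>_. j b)(0 := j a, 1 := j b))" using elementary_sat3[OF elem assms(1,2,2)] by blast
  then show ?thesis
    using ext_transitive[OF trans_cod] in_cod[OF assms(1)] in_cod[OF assms(2)] by simp
qed

text \<open>Below the critical point, induction gives \<beta> \<subseteq> \<open>j \<beta>\<close>,
  and minimality excludes \<beta> \<in> \<open>j \<beta>\<close>. Since the image of the critical
  point is an ordinal, so is \<open>j \<beta>\<close>, and then equality is all that
  remains.\<close>

lemma crit:
  assumes nt: "nontrivial j M" and O: "Ord (j (crit j M))"
  shows "crit j M \<in> M" "Ord (crit j M)" "crit j M \<in> elts (j (crit j M))"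
    "\<And>\<beta>. \<beta> \<in> elts (crit j M) \<Longrightarrow> j \<beta> = \<beta>"
proof -
  define P where "P \<alpha> \<longleftrightarrow> \<alpha> \<in> M \<and> \<alpha> \<in> elts (j \<alpha>)" for \<alpha>
  obtain \<alpha>0 where "Ord \<alpha>0" "P \<alpha>0" using nt unfolding nontrivial_def P_def by blast
  then obtain \<alpha> where \<alpha>: "Ord \<alpha>" "P \<alpha>" "\<And>\<gamma>. \<gamma> \<in> elts \<alpha> \<Longrightarrow> \<not> P \<gamma>" using Ord_least by metis
  have least: "elts \<alpha> \<subseteq> elts \<beta>" if "Ord \<beta>" "P \<beta>" for \<beta>
    using Ord_linear[OF \<alpha>(1) that(1)] Ord_subset_iff[OF \<alpha>(1) that(1)] \<alpha>(3) that(2) by blast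
  have c: "crit j M = \<alpha>"
    unfolding crit_def
  proof (rule the_equality)
    show "\<alpha> \<in> M \<and> Ord \<alpha> \<and> \<alpha> \<in> elts (j \<alpha>) \<and> (\<forall>\<beta>\<in>M. Ord \<beta> \<and> \<beta> \<in> elts (j \<beta>) \<longrightarrow> elts \<alpha> \<subseteq> elts \<beta>)"
      using \<alpha>(1,2) least unfolding P_def by blast
    fix \<alpha>' assume a: "\<alpha>' \<in> M \<and> Ord \<alpha>' \<and> \<alpha>' \<in> elts (j \<alpha>') \<and> (\<forall>\<beta>\<in>M. Ord \<beta> \<and> \<beta> \<in> elts (j \<beta>) \<longrightarrow> elts \<alpha>' \<subseteq> elts \<beta>)"
    then have "elts \<alpha>' \<subseteq> elts \<alpha>" using \<alpha>(1,2) unfolding P_def by blast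
    moreover have "elts \<alpha> \<subseteq> elts \<alpha>'" using a least unfolding P_def by blast
    ultimately show "\<alpha>' = \<alpha>" by (intro extensionality equalityI)
  qed
  show cM: "crit j M \<in> M" and "Ord (crit j M)" and "crit j M \<in> elts (j (crit j M))"
    unfolding c using \<alpha> unfolding P_def by auto
  fix \<beta> assume "\<beta> \<in> elts (crit j M)"
  then show "j \<beta> = \<beta>"
  proof (induction \<beta> rule: elts_induct)
    case (step \<beta>)
    have bM: "\<beta> \<in> M" using step.prems cM elts_dom by blast
    have Ob: "Ord \<beta>" using step.prems \<alpha>(1) Ord_mem unfolding c by blast
    have "j \<beta> \<in> elts (j (crit j M))" using mem_iff[OF bM cM] step.prems by simp
    then have Oj: "Ord (j \<beta>)" using O Ord_mem by blast
    have "elts \<beta> \<subseteq> elts (j \<beta>)"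
    proof
      fix \<gamma> assume g: "\<gamma> \<in> elts \<beta>"
      then have "\<gamma> \<in> elts (crit j M)" using step.prems \<alpha>(1) Ord_trans unfolding c by blast
      then have "j \<gamma> = \<gamma>" using step.IH[OF g] by blast
      then show "\<gamma> \<in> elts (j \<beta>)" using mem_iff[of \<gamma> \<beta>] g bM elts_dom by force
    qed
    moreover have "\<not> \<beta> \<in> elts (j \<beta>)" using \<alpha>(3)[of \<beta>] step.prems bM unfolding P_def c by blast
    ultimately show ?case using Ord_subset_iff[OF Ob Oj] by metis
  qed
qed

end

section \<open>The natural numbers in transitive models\<close>

lemma Ord_omega: "Ord (vset (range vnat))"
  by (rule Ord_vset[OF small_range_vnat]) (auto simp: transitive_def elts_vnat)

lemma Limit_in_iff:
  assumes "transitive N" "\<alpha> \<in> N"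
  shows "Limit_in N \<alpha> \<longleftrightarrow> Ord \<alpha> \<and> elts \<alpha> \<noteq> {} \<and> (\<forall>\<beta>\<in>elts \<alpha>. \<exists>\<gamma>\<in>elts \<alpha>. \<beta> \<in> elts \<gamma>)"
proof -
  have "ext N \<gamma> = elts \<gamma>" if "\<gamma> \<in> elts \<alpha>" for \<gamma>
    using ext_transitive[OF assms(1)] assms that unfolding transitive_def by blast
  then show ?thesis unfolding Limit_in_def Ord_in_iff[OF assms] ext_transitive[OF assms] by simp
qed

text \<open>In a transitive class the description of \<omega> as the least limit ordinal involves
  only quantifiers bounded by w and its elements, hence is absolute.\<close>

lemma omega_in_iff:
  assumes N: "transitive N" "w \<in> N"
  shows "omega_in N w \<longleftrightarrow> elts w = range vnat"
proof -
  have L: "Limit_in N \<alpha> \<longleftrightarrow> Ord \<alpha> \<and> elts \<alpha> \<noteq> {} \<and> (\<forall>\<beta>\<in>elts \<alpha>. \<exists>\<gamma>\<in>elts \<alpha>. \<beta> \<in> elts \<gamma>)"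
    if "\<alpha> \<in> elts w" for \<alpha>
    using Limit_in_iff[OF N(1)] N that unfolding transitive_def by blast
  let ?L = "(Ord w \<and> elts w \<noteq> {} \<and> (\<forall>\<beta>\<in>elts w. \<exists>\<gamma>\<in>elts w. \<beta> \<in> elts \<gamma>)) \<and>
     (\<forall>\<alpha>\<in>elts w. \<not> (Ord \<alpha> \<and> elts \<alpha> \<noteq> {} \<and> (\<forall>\<beta>\<in>elts \<alpha>. \<exists>\<gamma>\<in>elts \<alpha>. \<beta> \<in> elts \<gamma>)))"
  have "omega_in N w \<longleftrightarrow> ?L"
    unfolding omega_in_def Limit_in_iff[OF N] ext_transitive[OF N] using L by simp
  also have "\<dots> \<longleftrightarrow> elts w = range vnat"
  proof
    assume A: "?L"
    then have O: "Ord w" by blast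
    have sub: "\<alpha> \<in> range vnat" if "\<alpha> \<in> elts w" for \<alpha>
      using that
    proof (induction \<alpha> rule: elts_induct)
      case (step \<alpha>)
      have Oa: "Ord \<alpha>" using O Ord_mem step.prems by blast
      show ?case
      proof (cases "elts \<alpha> = {}")
        case True
        then have "\<alpha> = vnat 0" by (metis vnat.simps(1) vset_elts)
        then show ?thesis by blast
      next
        case False
        then obtain \<beta> where b: "\<beta> \<in> elts \<alpha>" "\<And>\<gamma>. \<gamma> \<in> elts \<alpha> \<Longrightarrow> \<beta> \<notin> elts \<gamma>" using A step.prems Oa by blast
        have "elts \<alpha> = insert \<beta> (elts \<beta>)"
        proof (intro equalityI subsetI)
          fix \<gamma> assume "\<gamma> \<in> elts \<alpha>"
          then show "\<gamma> \<in> insert \<beta> (elts \<beta>)" using Ord_linear[of \<gamma> \<beta>] Ord_mem[OF Oa] b by blast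
        qed (use b(1) Ord_trans[OF Oa] in blast)
        moreover obtain n where "\<beta> = vnat n" using step.IH[OF b(1)] Ord_trans[OF O step.prems b(1)] by blast
        ultimately have "\<alpha> = vnat (Suc n)" by (metis vnat.simps(2) vset_elts)
        then show ?thesis by blast
      qed
    qed
    have "vnat n \<in> elts w" for n
    proof (induction n)
      case 0
      obtain m where m: "vnat m \<in> elts w" using A sub by blast
      show ?case
      proof (cases "m = 0")
        case False
        then have "vnat 0 \<in> elts (vnat m)" unfolding elts_vnat by (intro imageI) simp
        then show ?thesis using Ord_trans[OF O m] by blast
      qed (use m in simp)
    next
      case (Suc n)
      then obtain \<gamma> where g: "\<gamma> \<in> elts w" "vnat n \<in> elts \<gamma>" using A by blast
      then obtain k where k: "\<gamma> = vnat k" using sub by blast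
      then have "n < k" using g(2) unfolding k elts_vnat by (auto simp: vnat_inject)
      show ?case
      proof (cases "Suc n = k")
        case False
        then have "vnat (Suc n) \<in> elts (vnat k)" unfolding elts_vnat by (intro imageI) (use \<open>n < k\<close> in simp)
        then show ?thesis using Ord_trans[OF O g(1)] k by blast
      qed (use g k in simp)
    qed
    then show "elts w = range vnat" using sub by blast
  next
    assume w: "elts w = range vnat"
    have "w = vset (range vnat)" using w by (metis vset_elts)
    then have O: "Ord w" using Ord_omega by simp
    have lim: "\<exists>\<gamma>\<in>elts w. \<beta> \<in> elts \<gamma>" if b: "\<beta> \<in> elts w" for \<beta>
    proof -
      obtain n where n: "\<beta> = vnat n" using b unfolding w by (rule rangeE)
      have "\<beta> \<in> elts (vnat (Suc n))" unfolding n elts_vnat by simp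
      moreover have "vnat (Suc n) \<in> elts w" unfolding w by (rule rangeI)
      ultimately show ?thesis by (rule bexI)
    qed
    have nl: "\<not> (elts \<alpha> \<noteq> {} \<and> (\<forall>\<beta>\<in>elts \<alpha>. \<exists>\<gamma>\<in>elts \<alpha>. \<beta> \<in> elts \<gamma>))" if a: "\<alpha> \<in> elts w" for \<alpha>
    proof
      assume A: "elts \<alpha> \<noteq> {} \<and> (\<forall>\<beta>\<in>elts \<alpha>. \<exists>\<gamma>\<in>elts \<alpha>. \<beta> \<in> elts \<gamma>)"
      obtain n where n: "\<alpha> = vnat n" using a unfolding w by (rule rangeE)
      then obtain m where m: "n = Suc m" using A elts_vnat[of 0] by (cases n) auto
      have "vnat m \<in> elts \<alpha>" unfolding n m elts_vnat by simp
      then obtain \<gamma> where "\<gamma> \<in> elts \<alpha>" "vnat m \<in> elts \<gamma>" using A by blast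
      then obtain k where "k < Suc m" "vnat m \<in> elts (vnat k :: 'a)"
        unfolding n m elts_vnat[of "Suc m"] by auto
      then show False unfolding elts_vnat by (auto simp: vnat_inject)
    qed
    have ne: "elts w \<noteq> {}" using w by simp
    show "?L"
    proof (intro conjI ballI)
      fix \<alpha> assume "\<alpha> \<in> elts w"
      then show "\<not> (Ord \<alpha> \<and> elts \<alpha> \<noteq> {} \<and> (\<forall>\<beta>\<in>elts \<alpha>. \<exists>\<gamma>\<in>elts \<alpha>. \<beta> \<in> elts \<gamma>))"
        using nl by blast
    qed (fact O ne | rule lim)+
  qed
  finally show ?thesis .
qed

section \<open>Transitive models of ZFC without Power Set\<close>

locale ZFC_minus_model =
  fixes W :: "'v::zfc set"
  assumes trans: "transitive W" and model: "models_ZFC_minus W"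
begin

lemma elts_W: "x \<in> W \<Longrightarrow> elts x \<subseteq> W"
  using trans unfolding transitive_def by blast

lemma ext_W: "x \<in> W \<Longrightarrow> ext W x = elts x"
  by (rule ext_transitive[OF trans])

lemma pair_closed: "pair_closed W"
proof -
  have "\<exists>z\<in>W. ext W z = {x, y}" if "x \<in> W" "y \<in> W" for x y
    using model that unfolding models_ZFC_minus_def by (elim conjE) (drule (1) bspec)+
  then show ?thesis unfolding pair_closed_def using trans ext_W vset_elts by metis
qed

lemma union_closed: "x \<in> W \<Longrightarrow> vset (\<Union>y\<in>elts x. elts y) \<in> W"
proof -
  assume x: "x \<in> W"
  have "\<exists>z\<in>W. ext W z = (\<Union>y\<in>ext W x. ext W y)"
    using model x unfolding models_ZFC_minus_def by (elim conjE) (drule (1) bspec)+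
  then obtain z where z: "z \<in> W" "elts z = (\<Union>y\<in>elts x. ext W y)" using ext_W x by auto
  moreover have "(\<Union>y\<in>elts x. ext W y) = (\<Union>y\<in>elts x. elts y)"
    by (rule SUP_cong[OF refl]) (use ext_W elts_W[OF x] in blast)
  ultimately have "elts z = (\<Union>y\<in>elts x. elts y)" by simp
  then show ?thesis using z(1) by (metis vset_elts)
qed

lemma insert_closed:
  assumes "x \<in> W" "a \<in> W" shows "vset (insert a (elts x)) \<in> W"
proof -
  have "vset {a, a} \<in> W" using pair_closed assms unfolding pair_closed_def by blast
  then have "vset {vset {a, a}, x} \<in> W" using pair_closed assms(1) unfolding pair_closed_def by blast
  then have "vset (\<Union>y\<in>elts (vset {vset {a, a}, x}). elts y) \<in> W" by (rule union_closed)
  moreover have "(\<Union>y\<in>elts (vset {vset {a, a}, x}). elts y) = insert a (elts x)" by (simp add: elts_vset)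
  ultimately show ?thesis by simp
qed

lemma separation_closed:
  assumes "a \<in> W" "\<And>i. s i \<in> W" shows "vset {x \<in> elts a. sat W \<phi> (s(0 := x))} \<in> W"
proof -
  have "\<forall>\<phi> s. range s \<subseteq> W \<longrightarrow> (\<forall>a\<in>W. \<exists>b\<in>W. ext W b = {x \<in> ext W a. sat W \<phi> (s(0 := x))})"
    using model unfolding models_ZFC_minus_def by (elim conjE)
  moreover have "range s \<subseteq> W" using assms(2) by blast
  ultimately obtain b where "b \<in> W" "ext W b = {x \<in> ext W a. sat W \<phi> (s(0 := x))}" using assms(1) by metis
  then show ?thesis using ext_W assms(1) vset_elts by metis
qed

lemma Int_closed: "a \<in> W \<Longrightarrow> b \<in> W \<Longrightarrow> vset (elts a \<inter> elts b) \<in> W"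
  using separation_closed[of a "\<lambda>_. b" "Mem 0 1"] by (simp add: Int_def)

lemma remove_closed: "a \<in> W \<Longrightarrow> c \<in> W \<Longrightarrow> vset (elts a - {c}) \<in> W"
  using separation_closed[of a "\<lambda>_. c" "Neg (Eq 0 1)"] by (simp add: set_diff_eq)

text \<open>A transitive x is its own transitive closure, so no closures have to be formed in
  W.\<close>

lemma Hset_in_iff:
  assumes "\<delta> \<in> W" and x: "x \<in> W" "transitive (elts x)"
  shows "x \<in> Hset_in W \<delta> \<longleftrightarrow>
    (\<exists>\<alpha>\<in>elts \<delta>. \<exists>g. bij_betw g (elts x) (elts \<alpha>) \<and> vset ((\<lambda>u. opair u (g u)) ` elts x) \<in> W)"
proof -
  have t: "TC_in W x t \<longleftrightarrow> t = x" if "t \<in> W" for t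
    using TC_in_iff[OF trans x(1) that] TC_transitive[OF x(2)] x(1) extensionality by (metis vset_elts)
  have b: "(\<exists>f\<in>W. bijection_in W f x \<alpha>) \<longleftrightarrow>
      (\<exists>g. bij_betw g (elts x) (elts \<alpha>) \<and> vset ((\<lambda>u. opair u (g u)) ` elts x) \<in> W)" if "\<alpha> \<in> W" for \<alpha>
  proof
    assume "\<exists>f\<in>W. bijection_in W f x \<alpha>"
    then show "\<exists>g. bij_betw g (elts x) (elts \<alpha>) \<and> vset ((\<lambda>u. opair u (g u)) ` elts x) \<in> W"
      using bijection_in_iff[OF pair_closed _ x(1) that] by (metis vset_elts)
  next
    assume "\<exists>g. bij_betw g (elts x) (elts \<alpha>) \<and> vset ((\<lambda>u. opair u (g u)) ` elts x) \<in> W"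
    then obtain g where g: "bij_betw g (elts x) (elts \<alpha>)" "vset ((\<lambda>u. opair u (g u)) ` elts x) \<in> W" by blast
    have "elts (vset ((\<lambda>u. opair u (g u)) ` elts x)) = (\<lambda>u. opair u (g u)) ` elts x"
      by (rule elts_vset[OF small_image[OF small_elts]])
    then show "\<exists>f\<in>W. bijection_in W f x \<alpha>" using bijection_in_iff[OF pair_closed g(2) x(1) that] g by blast
  qed
  have "x \<in> Hset_in W \<delta> \<longleftrightarrow> (\<exists>\<alpha>\<in>elts \<delta>. \<exists>f\<in>W. bijection_in W f x \<alpha>)"
    unfolding Hset_in_def ext_W[OF assms(1)] using t x(1) by blast
  also have "\<dots> \<longleftrightarrow> (\<exists>\<alpha>\<in>elts \<delta>. \<exists>g. bij_betw g (elts x) (elts \<alpha>) \<and> vset ((\<lambda>u. opair u (g u)) ` elts x) \<in> W)"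
    using b elts_W[OF assms(1)] by (meson subsetD)
  finally show ?thesis .
qed

text \<open>The extra point of \<open>h \<union> {h}\<close> makes room for \<open>y\<close>: a bijection of \<open>h \<union> {h}\<close> with an ordinal
  becomes one of \<open>h \<union> {y}\<close>, so that no cardinal arithmetic inside \<open>W\<close> is needed.\<close>

lemma Hset_in_subset:
  assumes \<delta>: "\<delta> \<in> W" and h: "transitive (elts h)" and Z: "elts Z = insert h (elts h)"
    and ZH: "Z \<in> Hset_in W \<delta>" and y: "y \<in> W" "elts y \<subseteq> elts h"
  shows "\<exists>w\<in>Hset_in W \<delta>. y \<in> elts w"
proof (cases "y \<in> elts h")
  case True
  then show ?thesis using ZH Z by blast
next
  case False
  have ZW: "Z \<in> W" using ZH unfolding Hset_in_def by blast
  have hW: "h \<in> W" using elts_W[OF ZW] Z by blast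
  have TZ: "transitive (elts Z)" using h unfolding Z transitive_def by blast
  obtain \<alpha> g where \<alpha>: "\<alpha> \<in> elts \<delta>" and g: "bij_betw g (elts Z) (elts \<alpha>)"
    "vset ((\<lambda>u. opair u (g u)) ` elts Z) \<in> W"
    using ZH Hset_in_iff[OF \<delta> ZW TZ] by blast
  define f where "f = vset ((\<lambda>u. opair u (g u)) ` elts Z)"
  have f: "f \<in> W" "elts f = (\<lambda>u. opair u (g u)) ` elts Z"
    unfolding f_def using g(2) by (auto simp: elts_vset[OF small_image])
  have gh: "g h \<in> W"
    using g(1) Z elts_W[OF subsetD[OF elts_W[OF \<delta>] \<alpha>]] unfolding bij_betw_def by blast
  define w where "w = vset (insert y (elts h))"
  have w: "w \<in> W" "elts w = insert y (elts h)"
    unfolding w_def using insert_closed[OF hW y(1)] by (auto simp: elts_vset[OF small_insert])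
  have Tw: "transitive (elts w)" using h y(2) unfolding w transitive_def by blast
  define g' where "g' = g(y := g h)"
  have "bij_betw g' (elts w) (elts \<alpha>)"
    using g(1) False mem_irrefl[of h] unfolding w Z g'_def bij_betw_def by (auto simp: inj_on_def)
  moreover have "vset ((\<lambda>u. opair u (g' u)) ` elts w) \<in> W"
  proof -
    define f1 where "f1 = vset (elts f - {opair h (g h)})"
    have "f1 \<in> W" unfolding f1_def by (rule remove_closed[OF f(1) pair_closed_opair[OF pair_closed hW gh]])
    then have "vset (insert (opair y (g h)) (elts f1)) \<in> W"
      by (rule insert_closed) (rule pair_closed_opair[OF pair_closed y(1) gh])
    moreover have "elts f1 = (\<lambda>u. opair u (g u)) ` elts h"
      unfolding f1_def using f(2) Z mem_irrefl[of h] by (subst elts_vset) (auto intro: small_subset[of "elts f"])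
    moreover have "insert (opair y (g h)) ((\<lambda>u. opair u (g u)) ` elts h) = (\<lambda>u. opair u (g' u)) ` elts w"
      unfolding w g'_def using False by auto
    ultimately show ?thesis by simp
  qed
  ultimately have "w \<in> Hset_in W \<delta>" using Hset_in_iff[OF \<delta> w(1) Tw] \<alpha> by blast
  then show ?thesis using w by blast
qed

end

section \<open>Internal AP supercompactness implies ISP\<close>

definition AP_witness :: "'v::zfc \<Rightarrow> 'v \<Rightarrow> 'v \<Rightarrow> bool" where
  "AP_witness \<kappa> \<theta> x \<longleftrightarrow> (\<exists>j M N. small_embedding \<kappa> \<theta> j M \<and>
     transitive (elts N) \<and> models_ZFC_minus (elts N) \<and> x \<in> j ` elts M \<and>
     elts N \<subseteq> Hset \<theta> \<and> omega1_approximation (elts N) (Hset \<theta>) \<and>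
     M \<in> elts N \<and>
     (\<exists>\<delta>\<in>elts N. Card_in (elts N) \<delta> \<and> \<delta> \<in> elts \<kappa> \<and> elts M = Hset_in (elts N) \<delta>))"

lemma internally_AP_supercompact_iff:
  "internally_AP_supercompact \<kappa> \<longleftrightarrow> Card \<kappa> \<and>
     (\<exists>\<alpha>. Ord \<alpha> \<and> (\<forall>\<theta>. regular \<theta> \<and> \<alpha> \<in> elts \<theta> \<longrightarrow> (\<forall>x\<in>Hset \<theta>. AP_witness \<kappa> \<theta> x)))"
  unfolding internally_AP_supercompact_def AP_witness_def ..

text \<open>Finite sequences as sets, so that an operation on lists turns into a set of pairs that j
  can have in its range.\<close>

primrec list_code :: "'v::zfc list \<Rightarrow> 'v" where
  "list_code [] = vset {}"
| "list_code (x # l) = opair x (list_code l)"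

lemma list_code_inject: "list_code l = list_code l' \<longleftrightarrow> l = l'"
proof (induction l arbitrary: l')
  have ne: "opair x y \<noteq> vset {}" for x y :: 'a
    using elts_opair[of x y] elts_vset[OF small_empty] by (metis empty_not_insert)
  case Nil
  then show ?case using ne by (cases l') (auto simp: eq_commute[of "vset {}"])
next
  have ne: "opair x y \<noteq> vset {}" for x y :: 'a
    using elts_opair[of x y] elts_vset[OF small_empty] by (metis empty_not_insert)
  case (Cons a l)
  then show ?case using ne by (cases l') auto
qed

lemma countable_in_transitive:
  assumes N: "pair_closed N" and x: "x \<in> N" and c: "countable_in N x"
  shows "\<exists>f\<in>N. \<exists>g. inj_on g (elts x) \<and> g ` elts x \<subseteq> range vnat \<and> elts f = (\<lambda>u. opair u (g u)) ` elts x"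
proof -
  have T: "transitive N" using N unfolding pair_closed_def by blast
  obtain w f where w: "w \<in> N" "omega_in N w" and f: "f \<in> N" "injection_in N f x w"
    using c unfolding countable_in_def by blast
  have "elts w = range vnat" using w omega_in_iff[OF T] by blast
  then show ?thesis using f injection_in_iff[OF N f(1) x w(1)] by auto
qed

text \<open>W is the model called N in the definition. The parameters are preimages: h of
  H(\<open>\<theta>0\<close>), \<mu> of \<lambda>, w of \<omega>. The other two serve to bring sets
  from W into M: z, the preimage of H(\<open>\<theta>0\<close>) together with itself as an element,
  for \<open>W.Hset_in_subset\<close>, and q, the preimage of \<lambda> \<times> \<omega>, for
  enumerations of subsets of \<mu>.\<close>

locale AP_embedding = regular_above_omega1 \<kappa> for \<kappa> :: "'v::zfc" +
  fixes \<theta>0 \<theta> :: 'v and j :: "'v \<Rightarrow> 'v" and M W \<delta> h \<mu> w z q :: 'v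
  assumes \<theta>0: "regular_above_omega1 \<theta>0" and \<kappa>0: "\<kappa> \<in> elts \<theta>0"
    and \<theta>: "regular_above_omega1 \<theta>"
    and emb: "small_embedding \<kappa> \<theta> j M"
    and W: "ZFC_minus_model (elts W)" "elts W \<subseteq> Hset \<theta>" "omega1_approximation (elts W) (Hset \<theta>)"
    and \<delta>: "\<delta> \<in> elts W" "\<delta> \<in> elts \<kappa>" and MW: "M \<in> elts W" "elts M = Hset_in (elts W) \<delta>"
    and params: "h \<in> elts M" "\<mu> \<in> elts M" "w \<in> elts M" "z \<in> elts M" "q \<in> elts M"
    and jh: "elts (j h) = Hset \<theta>0" and j\<mu>: "j \<mu> \<in> Hset \<theta>0" and jw: "elts (j w) = range vnat"
    and jz: "elts (j z) = insert (j h) (elts (j h))"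
    and jq: "elts (j q) = {opair a b |a b. a \<in> elts (j \<mu>) \<and> b \<in> elts (j w)}"
begin

sublocale H0: regular_above_omega1 \<theta>0 by (rule \<theta>0)
sublocale H: regular_above_omega1 \<theta> by (rule \<theta>)
sublocale elementary j "elts M" "Hset \<theta>"
  using emb H.pair_closed_Hset unfolding small_embedding_def by unfold_locales auto
sublocale W: ZFC_minus_model "elts W" by (rule W(1))

abbreviation X where "X \<equiv> j ` elts h"

lemma M_sub_W: "elts M \<subseteq> elts W"
  using MW W.elts_W by blast

lemma h_sub_M: "elts h \<subseteq> elts M"
  using elts_dom params by blast

lemma Hset0_iff: "u \<in> elts M \<Longrightarrow> j u \<in> Hset \<theta>0 \<longleftrightarrow> u \<in> elts h"
  using mem_iff[OF _ params(1)] jh by simp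

lemma X_sub: "X \<subseteq> Hset \<theta>0"
  using Hset0_iff h_sub_M by blast

lemma transitive_h: "transitive (elts h)"
  unfolding transitive_def
proof (intro ballI subsetI)
  fix x y assume x: "x \<in> elts h" and y: "y \<in> elts x"
  have "x \<in> elts M" using x h_sub_M by blast
  then have yM: "y \<in> elts M" and "j y \<in> elts (j x)" using y elts_dom mem_iff by blast+
  moreover have "j x \<in> Hset \<theta>0" using Hset0_iff[OF \<open>x \<in> elts M\<close>] x by blast
  ultimately have "j y \<in> Hset \<theta>0" using transitive_Hset unfolding transitive_def by blast
  then show "y \<in> elts h" using Hset0_iff[OF yM] by blast
qed

abbreviation c where "c \<equiv> crit j (elts M)"

lemma jc: "j c = \<kappa>"
  using emb unfolding small_embedding_def by blast

lemma c: "c \<in> elts M" "Ord c" "c \<in> elts \<kappa>" "\<And>\<beta>. \<beta> \<in> elts c \<Longrightarrow> j \<beta> = \<beta>"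
  using crit emb Ord unfolding small_embedding_def by auto

lemma kappa_sub: "elts \<kappa> \<subseteq> Hset \<theta>0"
  using Card_mem_Hset[OF H0.Card \<kappa>0] transitive_Hset unfolding transitive_def by blast

lemma c_sub_h: "elts c \<subseteq> elts h"
proof
  fix \<beta> assume b: "\<beta> \<in> elts c"
  have "\<beta> \<in> elts M" using b c(1) elts_dom by blast
  moreover have "j \<beta> \<in> Hset \<theta>0"
    using c(4)[OF b] b Ord_trans[OF Ord c(3)] kappa_sub by auto
  ultimately show "\<beta> \<in> elts h" using Hset0_iff by blast
qed

text \<open>The embedding fixes everything below its critical point, which it sends to \<kappa>.
  Consequently an ordinal below \<kappa> in X is a subset of X.\<close>

lemma X_Int_kappa: "X \<inter> elts \<kappa> = elts c"
proof (intro equalityI subsetI)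
  fix \<beta> assume "\<beta> \<in> X \<inter> elts \<kappa>"
  then obtain \<gamma> where g: "\<gamma> \<in> elts h" "\<beta> = j \<gamma>" "j \<gamma> \<in> elts (j c)" using jc by auto
  then have "\<gamma> \<in> elts c" using mem_iff[OF _ c(1)] h_sub_M by blast
  then show "\<beta> \<in> elts c" using g c(4) by simp
next
  fix \<beta> assume b: "\<beta> \<in> elts c"
  then have "\<beta> = j \<beta>" using c(4) by simp
  then show "\<beta> \<in> X \<inter> elts \<kappa>" using b c_sub_h Ord_trans[OF Ord c(3)] by auto
qed

text \<open>As \<omega> is below \<kappa>, its preimage is below the critical point and hence
  fixed.\<close>

lemma w: "elts w = range vnat" "elts w \<subseteq> elts c" "w \<in> elts c"
proof -
  have wO: "j w = vset (range vnat)" using jw by (metis vset_elts)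
  have o: "Ord (j w)" unfolding wO by (rule Ord_omega)
  have jwk: "j w \<in> elts \<kappa>"
  proof (rule Ord_lesspoll_mem[OF o Ord])
    show "elts (j w) \<prec> elts \<kappa>" unfolding jw by (rule countable_lesspoll) simp
  qed
  then have wc: "w \<in> elts c" using mem_iff[OF params(3) c(1)] jc by simp
  then have "j w = w" by (rule c(4))
  then show "elts w = range vnat" using jw by simp
  show "w \<in> elts c" by (rule wc)
  then show "elts w \<subseteq> elts c" using Ord_trans[OF c(2)] by blast
qed

text \<open>The point where M = H(\<delta>) of W is used for closure: subsets of h that W knows are
  already in M.\<close>

lemma M_subset:
  assumes y: "y \<in> elts W" "elts y \<subseteq> elts h" shows "y \<in> elts M"
proof -
  have zM: "\<And>u. u \<in> elts z \<Longrightarrow> u \<in> elts M" using elts_dom params by blast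
  have "elts z = insert h (elts h)"
  proof (intro equalityI subsetI)
    fix u assume u: "u \<in> elts z"
    have "j u \<in> elts (j z)" using mem_iff[OF zM[OF u] params(4)] u by simp
    then show "u \<in> insert h (elts h)"
      unfolding jz using eq_iff[OF zM[OF u] params(1)] mem_iff[OF zM[OF u] params(1)] by blast
  next
    fix u assume u: "u \<in> insert h (elts h)"
    then have uM: "u \<in> elts M" using params h_sub_M by blast
    have "j u \<in> elts (j z)" unfolding jz using u mem_iff[OF uM params(1)] by blast
    then show "u \<in> elts z" using mem_iff[OF uM params(4)] by simp
  qed
  moreover have "z \<in> Hset_in (elts W) \<delta>" using params MW by simp
  ultimately obtain v where "v \<in> elts M" "y \<in> elts v"
    using W.Hset_in_subset[OF \<delta>(1) transitive_h _ _ y] MW(2) by blast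
  then show ?thesis using elts_dom by blast
qed

text \<open>As an element of H(\<delta>) of W, the transitive set h is in bijection with an ordinal
  below \<delta>, which is below \<kappa>.\<close>

lemma X_lesspoll: "X \<prec> elts \<kappa>"
proof -
  have hW: "h \<in> elts W" using params M_sub_W by blast
  have "h \<in> Hset_in (elts W) \<delta>" using params MW by simp
  then obtain \<alpha> g where a: "\<alpha> \<in> elts \<delta>" "bij_betw g (elts h) (elts \<alpha>)"
    using W.Hset_in_iff[OF \<delta>(1) hW transitive_h] by blast
  have "\<alpha> \<in> elts \<kappa>" by (rule Ord_trans[OF Ord \<delta>(2) a(1)])
  then have "elts h \<prec> elts \<kappa>"
    using a(2) eq_lesspoll_trans Card_lesspoll[OF Card] unfolding eqpoll_def by metis
  then show ?thesis by (rule lesspoll_trans1[OF image_lepoll])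
qed

lemma X_opair: "a \<in> X \<Longrightarrow> b \<in> X \<Longrightarrow> opair a b \<in> X"
proof -
  assume a: "a \<in> X" and b: "b \<in> X"
  then obtain u v where u: "u \<in> elts M" "a = j u" and v: "v \<in> elts M" "b = j v" using h_sub_M by blast
  have p: "opair u v \<in> elts M" by (rule pair_closed_opair[OF pair_dom u(1) v(1)])
  have "opair a b \<in> Hset \<theta>0" using H0.opair_Hset a b X_sub by blast
  then have "j (opair u v) \<in> Hset \<theta>0" using j_opair[OF u(1) v(1)] u v by simp
  then have "opair u v \<in> elts h" using Hset0_iff[OF p] by blast
  then show ?thesis using j_opair[OF u(1) v(1)] u(2) v(2) by (metis imageI)
qed

lemma X_list_code: "l \<in> lists X \<Longrightarrow> list_code l \<in> X"
proof (induction l)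
  case Nil
  have "vset {} = (vnat 0 :: 'v)" by simp
  then show ?case using w X_Int_kappa by (metis IntE list_code.simps(1) rangeI subsetD)
qed (simp add: X_opair)

lemma X_rel:
  assumes "R \<in> elts M" "a \<in> X" "v \<in> Hset \<theta>0" "opair a v \<in> elts (j R)"
  shows "\<exists>v\<in>X. opair a v \<in> elts (j R)"
proof -
  obtain u where u: "u \<in> elts M" "a = j u" using assms(2) h_sub_M by blast
  obtain b where "b \<in> elts h" "opair (j u) (j b) \<in> elts (j R)"
    by (rule rel_ran[OF assms(1) u(1) params(1), of v]) (use assms(3,4) jh u in auto)
  then show ?thesis unfolding u(2) by blast
qed

lemma mu_sub_h: "elts \<mu> \<subseteq> elts h"
  using transitive_h Hset0_iff[OF params(2)] j\<mu> unfolding transitive_def by blast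

abbreviation a where "a \<equiv> vset (X \<inter> elts (j \<mu>))"

lemma elts_a: "elts a = X \<inter> elts (j \<mu>)" "elts a = j ` elts \<mu>"
proof -
  have "X \<inter> elts (j \<mu>) \<prec> elts \<kappa>" using X_lesspoll lesspoll_trans1 subset_imp_lepoll by (metis Int_lower1)
  then show e: "elts a = X \<inter> elts (j \<mu>)" by (rule elts_vset[OF lesspoll_small])
  show "elts a = j ` elts \<mu>"
    unfolding e using mu_sub_h h_sub_M mem_iff[OF _ params(2)] by blast
qed

text \<open>The preimage of the set guessed at \<open>X\<close> lies in \<open>W\<close> by approximation: its countable pieces are
  preimages of elements of \<open>X\<close> by slenderness.\<close>

lemma preimage_mem:
  assumes sl: "\<And>b. b \<in> X \<Longrightarrow> b \<in> Pk omega1 (elts (j \<mu>)) \<Longrightarrow> vset (elts b \<inter> elts da) \<in> X"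
    and da: "elts da \<subseteq> elts a"
  shows "\<exists>D\<in>elts M. elts D \<subseteq> elts \<mu> \<and> (\<forall>\<xi>\<in>elts \<mu>. \<xi> \<in> elts D \<longleftrightarrow> j \<xi> \<in> elts da)"
proof -
  define D where "D = vset {\<xi> \<in> elts \<mu>. j \<xi> \<in> elts da}"
  have D: "elts D = {\<xi> \<in> elts \<mu>. j \<xi> \<in> elts da}"
    unfolding D_def by (rule elts_vset_subset[of _ \<mu>]) blast
  have muW: "\<mu> \<in> elts W" using params M_sub_W by blast
  have "D \<in> Hset \<theta>" unfolding D_def by (rule H.Hset_subset[of \<mu>]) (use muW W(2) in auto)
  moreover have "vset (elts D \<inter> elts x) \<in> elts W" if x: "x \<in> elts W" "countable_in (elts W) x" for x
  proof -
    obtain f g where f: "f \<in> elts W" and g: "inj_on g (elts x)" "g ` elts x \<subseteq> range vnat"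
      "elts f = (\<lambda>u. opair u (g u)) ` elts x"
      using countable_in_transitive[OF W.pair_closed x] by blast
    \<comment> \<open>The set x may leave \<mu>; only its trace on \<mu> is a subset of h and can be
      brought into M.\<close>
    define y where "y = vset (elts x \<inter> elts \<mu>)"
    have y: "elts y = elts x \<inter> elts \<mu>"
      unfolding y_def by (rule elts_vset_subset[of _ \<mu>]) blast
    have yW: "y \<in> elts W" unfolding y_def by (rule W.Int_closed[OF x(1) muW])
    then have yM: "y \<in> elts M" by (rule M_subset) (use y mu_sub_h in blast)
    have qM: "u \<in> elts q \<Longrightarrow> u \<in> elts M" for u using elts_dom params by blast
    have qi: "opair u v \<in> elts q \<longleftrightarrow> u \<in> elts \<mu> \<and> v \<in> elts w" if uv: "u \<in> elts M" "v \<in> elts M" for u v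
    proof -
      have "opair u v \<in> elts q \<longleftrightarrow> opair (j u) (j v) \<in> elts (j q)"
        using mem_iff[OF pair_closed_opair[OF pair_dom uv] params(5)] j_opair[OF uv] by simp
      also have "\<dots> \<longleftrightarrow> j u \<in> elts (j \<mu>) \<and> j v \<in> elts (j w)" unfolding jq by auto
      finally show ?thesis using mem_iff uv params by simp
    qed
    \<comment> \<open>Cutting the enumeration down to the preimage of \<lambda> \<times> \<omega>
      makes its graph a subset of h, so that \<open>M_subset\<close> applies to it as well.\<close>
    define f' where "f' = vset (elts f \<inter> elts q)"
    have qW: "q \<in> elts W" using params M_sub_W by blast
    have f'e: "elts f' = elts f \<inter> elts q"
      unfolding f'_def by (rule elts_vset_subset[of _ q]) blast
    have f'W: "f' \<in> elts W" unfolding f'_def by (rule W.Int_closed[OF f qW])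
    have mM: "elts \<mu> \<subseteq> elts M" and wM: "elts w \<subseteq> elts M" using elts_dom params by blast+
    have "elts f' = (\<lambda>u. opair u (g u)) ` elts y"
    proof (intro equalityI subsetI)
      fix p assume "p \<in> elts f'"
      then have p: "p \<in> elts f" "p \<in> elts q" using f'e by auto
      then obtain u where u: "u \<in> elts x" "p = opair u (g u)" using g(3) by blast
      have "u \<in> elts M \<and> g u \<in> elts M"
        using qM[OF p(2)] pair_closed_opairD[OF trans_dom] u(2) by metis
      then show "p \<in> (\<lambda>u. opair u (g u)) ` elts y" using qi p(2) u y by blast
    next
      fix p assume "p \<in> (\<lambda>u. opair u (g u)) ` elts y"
      then obtain u where u: "u \<in> elts x" "u \<in> elts \<mu>" "p = opair u (g u)" using y by blast
      have "g u \<in> elts w" using g(2) u(1) w(1) by blast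
      then have "p \<in> elts q" using qi u mM wM by blast
      then show "p \<in> elts f'" using f'e g(3) u by blast
    qed
    moreover have "inj_on g (elts y)" using g(1) y by (metis Int_lower1 inj_on_subset)
    moreover have "g ` elts y \<subseteq> elts w" using g(2) y w(1) by blast
    moreover have f'M: "f' \<in> elts M"
    proof (rule M_subset[OF f'W])
      have "j p \<in> Hset \<theta>0" if "p \<in> elts q" for p
      proof -
        have "j p \<in> elts (j q)" using mem_iff[OF qM[OF that] params(5)] that by simp
        then obtain u v where uv: "j p = opair u v" "u \<in> elts (j \<mu>)" "v \<in> elts (j w)" unfolding jq by blast
        have "u \<in> Hset \<theta>0" using uv(2) j\<mu> transitive_Hset unfolding transitive_def by blast
        moreover have "v \<in> Hset \<theta>0"
        proof -
          have "v \<in> elts w" using uv(3) jw w(1) by simp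
          then have "v \<in> elts \<kappa>" using w(2) Ord_trans[OF Ord c(3)] by blast
          then show ?thesis using kappa_sub by blast
        qed
        ultimately show ?thesis using uv(1) H0.opair_Hset by simp
      qed
      then show "elts f' \<subseteq> elts h" using f'e Hset0_iff[OF qM] by blast
    qed
    ultimately have "injection_in (elts M) f' y w"
      using injection_in_iff[OF pair_dom f'M yM params(3)] by blast
    \<comment> \<open>Elementarity makes \<open>j y\<close> truly countable, as slenderness
      demands.\<close>
    then have "injection_in (Hset \<theta>) (j f') (j y) (j w)" using injection_iff[OF f'M yM params(3)] by blast
    then obtain g' :: "'v \<Rightarrow> 'v" where "inj_on g' (elts (j y))" "g' ` elts (j y) \<subseteq> range vnat"
      using injection_in_iff[OF pair_cod in_cod[OF f'M] in_cod[OF yM] in_cod[OF params(3)]] jw by metis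
    then have "elts (j y) \<lesssim> range (vnat :: nat \<Rightarrow> 'v)" unfolding lepoll_def by blast
    then have "countable (elts (j y))" by (rule countable_lepoll[rotated]) simp
    moreover have jy: "elts (j y) \<subseteq> elts (j \<mu>)" by (rule j_mono[OF yM params(2)]) (use y in blast)
    ultimately have "j y \<in> Pk omega1 (elts (j \<mu>))" unfolding Pk_def lesspoll_omega1_iff by simp
    moreover have "j y \<in> X"
    proof -
      have "vset (elts (j y)) \<in> Hset \<theta>0" by (rule H0.Hset_subset[OF j\<mu> jy])
      then show ?thesis using Hset0_iff[OF yM] by simp
    qed
    ultimately have "vset (elts (j y) \<inter> elts da) \<in> X" using sl by blast
    then obtain t where t: "t \<in> elts h" "j t = vset (elts (j y) \<inter> elts da)" by auto
    have tM: "t \<in> elts M" using t(1) h_sub_M by blast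
    have "elts (j t) = elts (j y) \<inter> elts da"
      unfolding t(2) by (rule elts_vset_subset[of _ "j y"]) blast
    \<comment> \<open>The preimage t of the piece of \<open>da\<close> on \<open>j y\<close> agrees
      with D on y, so the piece of D on x is an intersection of two sets in W.\<close>
    then have "\<xi> \<in> elts t \<longleftrightarrow> \<xi> \<in> elts D" if "\<xi> \<in> elts y" for \<xi>
      using mem_iff[of \<xi> t] mem_iff[of \<xi> y] tM yM that elts_dom[OF yM] D y by blast
    then have "elts D \<inter> elts x = elts y \<inter> elts t" using y D by blast
    moreover have "vset (elts y \<inter> elts t) \<in> elts W"
      by (rule W.Int_closed[OF yW]) (use tM M_sub_W in blast)
    ultimately show ?thesis by simp
  qed
  moreover have "\<exists>B\<in>elts W. elts D \<subseteq> elts B" using muW D by blast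
  ultimately have "D \<in> elts W" using W(3) unfolding omega1_approximation_def by blast
  then have "D \<in> elts M" by (rule M_subset) (use D mu_sub_h in blast)
  then show ?thesis using D by blast
qed

end

context regular_above_omega1
begin

lemma AP_supercompact_imp_ISP:
  assumes AP: "internally_AP_supercompact \<kappa>" and \<mu>: "Card \<mu>" "elts \<kappa> \<subseteq> elts \<mu>"
  shows "ISP \<kappa> \<mu>"
proof (rule ccontr)
  assume "\<not> ISP \<kappa> \<mu>"
  then obtain d where d: "Pk_list \<kappa> \<mu> d" "slender \<kappa> \<mu> d"
    and no: "\<And>D. elts D \<subseteq> elts \<mu> \<Longrightarrow> \<not> stationary \<kappa> (elts \<mu>) {a \<in> Pk \<kappa> (elts \<mu>). elts (d a) = elts D \<inter> elts a}"
    unfolding ISP_def by blast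
  \<comment> \<open>One refuting club for every D at once, replaced below by the operation
    \<open>TD D\<close>.\<close>
  have "\<forall>D. \<exists>E. elts D \<subseteq> elts \<mu> \<longrightarrow> club \<kappa> (elts \<mu>) E \<and> {a \<in> Pk \<kappa> (elts \<mu>). elts (d a) = elts D \<inter> elts a} \<inter> E = {}"
    using no unfolding stationary_def by blast
  then obtain E where "\<forall>D. elts D \<subseteq> elts \<mu> \<longrightarrow> club \<kappa> (elts \<mu>) (E D) \<and>
      {a \<in> Pk \<kappa> (elts \<mu>). elts (d a) = elts D \<inter> elts a} \<inter> E D = {}" by (elim Hilbert_Choice.choice[elim_format] exE)
  then have E: "\<And>D. elts D \<subseteq> elts \<mu> \<Longrightarrow> club \<kappa> (elts \<mu>) (E D)"
    "\<And>D. elts D \<subseteq> elts \<mu> \<Longrightarrow> {a \<in> Pk \<kappa> (elts \<mu>). elts (d a) = elts D \<inter> elts a} \<inter> E D = {}" by simp_all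
  have "\<forall>D. \<exists>T. elts D \<subseteq> elts \<mu> \<longrightarrow> small_op (elts \<mu>) T \<and>
      (\<forall>x. x \<in> Pk \<kappa> (elts \<mu>) \<longrightarrow> closed_under T (elts x) \<longrightarrow> x \<in> E D)"
    using club_contains_closed[OF E(1)] by metis
  then obtain TD where TD: "\<And>D. elts D \<subseteq> elts \<mu> \<Longrightarrow> small_op (elts \<mu>) (TD D)"
    "\<And>D x. elts D \<subseteq> elts \<mu> \<Longrightarrow> x \<in> Pk \<kappa> (elts \<mu>) \<Longrightarrow> closed_under (TD D) (elts x) \<Longrightarrow> x \<in> E D" by metis
  obtain \<alpha>0 :: 'v where \<alpha>0: "Ord \<alpha>0" and sl: "\<And>\<theta>. Card \<theta> \<Longrightarrow> \<alpha>0 \<in> elts \<theta> \<Longrightarrow>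
        (\<exists>C. club \<kappa> (Hset \<theta>) C \<and> (\<forall>X\<in>C. \<forall>b\<in>elts X \<inter> Pk omega1 (elts \<mu>).
              vset (elts b \<inter> elts (d (vset (elts X \<inter> elts \<mu>)))) \<in> elts X))"
    using d(2) unfolding slender_def by blast
  have above: "\<exists>\<theta>::'v. regular_above_omega1 \<theta> \<and> elts x \<prec> elts \<theta> \<and> \<alpha> \<in> elts \<theta>" if "Ord \<alpha>" "\<kappa> \<in> elts x \<or> elts \<kappa> \<subseteq> elts x" "transitive (elts x)" for x \<alpha> :: 'v
  proof -
    have kx: "elts \<kappa> \<subseteq> elts x" using that unfolding transitive_def by blast
    define y where "y = vset (elts x \<union> elts \<alpha>)"
    have y: "elts y = elts x \<union> elts \<alpha>" unfolding y_def by (intro elts_vset small_Un small_elts)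
    obtain \<theta> :: 'v where t: "regular \<theta>" "elts y \<prec> elts \<theta>" using regular_exists[of y] by blast
    have O: "Ord \<theta>" using t(1) regular_Card Card_Ord by blast
    have x: "elts x \<prec> elts \<theta>" and a: "elts \<alpha> \<prec> elts \<theta>"
      using t(2) y subset_imp_lepoll lesspoll_trans1 by (metis Un_upper1, metis Un_upper2)
    have "elts (omega1 :: 'v) \<subseteq> elts x" using kx Ord_trans[OF Ord omega1_mem] by blast
    then have "elts (omega1 :: 'v) \<prec> elts \<theta>" using x subset_imp_lepoll lesspoll_trans1 by metis
    then have "omega1 \<in> elts \<theta>" by (rule Ord_lesspoll_mem[OF omega1(1) O])
    moreover have "\<alpha> \<in> elts \<theta>" by (rule Ord_lesspoll_mem[OF that(1) O a])
    ultimately show ?thesis using t x unfolding regular_above_omega1_def by blast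
  qed
  have tmu: "transitive (elts \<mu>)" using Card_Ord[OF \<mu>(1)] unfolding Ord_def by blast
  \<comment> \<open>Above the threshold of slenderness, and above \<lambda> so that all subsets of
    \<lambda> are elements of H(\<open>\<theta>0\<close>).\<close>
  obtain \<theta>0 :: 'v where \<theta>0: "regular_above_omega1 \<theta>0" "elts \<mu> \<prec> elts \<theta>0" "\<alpha>0 \<in> elts \<theta>0"
    using above[OF \<alpha>0 _ tmu] \<mu>(2) by blast
  interpret H0: regular_above_omega1 \<theta>0 by (rule \<theta>0(1))
  have mu0: "\<mu> \<in> elts \<theta>0" by (rule Ord_lesspoll_mem[OF Card_Ord[OF \<mu>(1)] H0.Ord \<theta>0(2)])
  have k0: "\<kappa> \<in> elts \<theta>0"
    using Ord_subset_iff[OF Ord Card_Ord[OF \<mu>(1)]] \<mu>(2) mu0 Ord_trans[OF H0.Ord mu0] by blast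
  have muH: "\<mu> \<in> Hset \<theta>0" by (rule Card_mem_Hset[OF H0.Card mu0])
  have kH: "elts \<kappa> \<subseteq> Hset \<theta>0"
    using Card_mem_Hset[OF H0.Card k0] transitive_Hset unfolding transitive_def by blast
  have muHs: "elts \<mu> \<subseteq> Hset \<theta>0" using muH transitive_Hset unfolding transitive_def by blast
  obtain C where C: "club \<kappa> (Hset \<theta>0) C" "\<And>X b. X \<in> C \<Longrightarrow> b \<in> elts X \<Longrightarrow> b \<in> Pk omega1 (elts \<mu>) \<Longrightarrow>
              vset (elts b \<inter> elts (d (vset (elts X \<inter> elts \<mu>)))) \<in> elts X"
    using sl[OF H0.Card \<theta>0(3)] by blast
  obtain TC where TC: "small_op (Hset \<theta>0) TC" "\<And>x. x \<in> Pk \<kappa> (Hset \<theta>0) \<Longrightarrow> closed_under TC (elts x) \<Longrightarrow> x \<in> C"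
    using club_contains_closed[OF C(1)] by metis
  \<comment> \<open>Besides closing under the operation for the slenderness club, T reads its first
    entry as a subset D of \<lambda> and applies \<open>TD D\<close> to the rest. So closure under T
    serves any D that turns out to be in X.\<close>
  define T where "T l = TC l \<union> (case l of [] \<Rightarrow> {} | D # l' \<Rightarrow>
      if elts D \<subseteq> elts \<mu> \<and> l' \<in> lists (elts \<mu>) then TD D l' else {})" for l
  have T: "T l \<subseteq> Hset \<theta>0" "T l \<prec> elts \<kappa>" if l: "l \<in> lists (Hset \<theta>0)" for l
  proof -
    let ?U = "case l of [] \<Rightarrow> {} | D # l' \<Rightarrow> if elts D \<subseteq> elts \<mu> \<and> l' \<in> lists (elts \<mu>) then TD D l' else {}"
    have "?U \<subseteq> Hset \<theta>0 \<and> ?U \<prec> elts \<kappa>"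
    proof (cases "\<exists>D l'. l = D # l' \<and> elts D \<subseteq> elts \<mu> \<and> l' \<in> lists (elts \<mu>)")
      case True
      then obtain D l' where D: "l = D # l'" "elts D \<subseteq> elts \<mu>" "l' \<in> lists (elts \<mu>)" by blast
      then have "?U = TD D l'" by simp
      then show ?thesis using small_opD[OF TD(1)[OF D(2)] D(3)] muHs by auto
    next
      case False
      then have "?U = {}" by (auto split: list.split)
      then show ?thesis using finite_lesspoll[OF finite.emptyI] by simp
    qed
    then show "T l \<subseteq> Hset \<theta>0" "T l \<prec> elts \<kappa>"
      unfolding T_def using small_opD[OF TC(1) l] regular_Un[OF regular] by auto
  qed
  \<comment> \<open>The set \<open>T l\<close> is enumerated in length \<open>\<beta> l\<close>
    below \<kappa>. The relations \<open>R1\<close> and \<open>R2\<close> record the length and the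
    \<xi>-th value, thus code T by single-valued functions.\<close>
  have "\<forall>l. \<exists>\<beta> g. l \<in> lists (Hset \<theta>0) \<longrightarrow> \<beta> \<in> elts \<kappa> \<and> g ` elts \<beta> = T l"
    using lesspoll_Card[OF T(2) Card] unfolding eqpoll_def bij_betw_def by metis
  then obtain \<beta> g where \<beta>: "\<And>l. l \<in> lists (Hset \<theta>0) \<Longrightarrow> \<beta> l \<in> elts \<kappa>"
    and g: "\<And>l. l \<in> lists (Hset \<theta>0) \<Longrightarrow> g l ` elts (\<beta> l) = T l" by metis
  have lcH: "list_code l \<in> Hset \<theta>0" if "l \<in> lists (Hset \<theta>0)" for l
    using that
  proof (induction l)
    case Nil
    show ?case using H0.vset_mem_Hset[of "{}"] H0.finite_lesspoll[of "{}"] by simp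
  qed (simp add: H0.opair_Hset)
  define R1 where "R1 = {opair (list_code l) (\<beta> l) |l. l \<in> lists (Hset \<theta>0)}"
  define R2 where "R2 = {opair (opair (list_code l) \<xi>) (g l \<xi>) |l \<xi>. l \<in> lists (Hset \<theta>0) \<and> \<xi> \<in> elts (\<beta> l)}"
  define w :: 'v where "w = vset (range vnat)"
  have w: "elts w = range vnat" unfolding w_def by (rule elts_vset[OF small_range_vnat])
  have wk: "w \<in> elts \<kappa>"
    unfolding w_def by (rule Ord_lesspoll_mem[OF Ord_omega Ord])
      (metis countable_lesspoll w w_def countable_image uncountable_def countableI_type)
  define Q where "Q = {opair a b |a b. a \<in> elts \<mu> \<and> b \<in> elts w}"
  have bk: "\<xi> \<in> elts \<kappa>" if "l \<in> lists (Hset \<theta>0)" "\<xi> \<in> elts (\<beta> l)" for l \<xi>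
    by (rule Ord_trans[OF Ord \<beta>[OF that(1)] that(2)])
  have gH: "g l \<xi> \<in> Hset \<theta>0" if "l \<in> lists (Hset \<theta>0)" "\<xi> \<in> elts (\<beta> l)" for l \<xi>
    using g[OF that(1)] T(1)[OF that(1)] that(2) by blast
  have R1H: "R1 \<subseteq> Hset \<theta>0"
  proof
    fix p assume "p \<in> R1"
    then obtain l where l: "l \<in> lists (Hset \<theta>0)" "p = opair (list_code l) (\<beta> l)" unfolding R1_def by blast
    show "p \<in> Hset \<theta>0" unfolding l(2) by (rule H0.opair_Hset[OF lcH[OF l(1)] subsetD[OF kH \<beta>[OF l(1)]]])
  qed
  have R2H: "R2 \<subseteq> Hset \<theta>0"
  proof
    fix p assume "p \<in> R2"
    then obtain l \<xi> where l: "l \<in> lists (Hset \<theta>0)" "\<xi> \<in> elts (\<beta> l)" "p = opair (opair (list_code l) \<xi>) (g l \<xi>)"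
      unfolding R2_def by blast
    show "p \<in> Hset \<theta>0" unfolding l(3)
      by (rule H0.opair_Hset[OF H0.opair_Hset[OF lcH[OF l(1)] subsetD[OF kH bk[OF l(1,2)]]] gH[OF l(1,2)]])
  qed
  have wH: "w \<in> Hset \<theta>0" using wk kH by blast
  have QH: "Q \<subseteq> Hset \<theta>0"
    unfolding Q_def using H0.opair_Hset muHs wH transitive_Hset[of \<theta>0] unfolding transitive_def by blast
  define h where "h = vset (Hset \<theta>0)"
  have h: "elts h = Hset \<theta>0" unfolding h_def by (rule elts_vset[OF small_Hset])
  define z where "z = vset (insert h (elts h))"
  have z: "elts z = insert h (elts h)" unfolding z_def by (intro elts_vset small_insert small_elts)
  have sub: "elts (vset R) = R" if "R \<subseteq> Hset \<theta>0" for R by (rule elts_vset[OF small_subset[OF small_Hset that]])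
  obtain \<alpha>1 where \<alpha>1: "Ord \<alpha>1" and ap: "\<And>\<theta> x. regular \<theta> \<Longrightarrow> \<alpha>1 \<in> elts \<theta> \<Longrightarrow> x \<in> Hset \<theta> \<Longrightarrow>
        AP_witness \<kappa> \<theta> x"
    using AP unfolding internally_AP_supercompact_iff by blast
  obtain \<theta> :: 'v where \<theta>: "regular_above_omega1 \<theta>" "elts h \<prec> elts \<theta>" "\<alpha>1 \<in> elts \<theta>"
    using above[OF \<alpha>1, of h] kH transitive_Hset[of \<theta>0] h by auto
  interpret H: regular_above_omega1 \<theta> by (rule \<theta>(1))
  have hH: "h \<in> Hset \<theta>" by (rule HsetI[OF _ _ \<theta>(2)]) (simp_all add: h transitive_Hset)
  have hs: "Hset \<theta>0 \<subseteq> Hset \<theta>" using hH transitive_Hset[of \<theta>] h unfolding transitive_def by blast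
  have zH: "z \<in> Hset \<theta>" unfolding H.Hset_iff[of z] z using hH hs h regular_insert[OF H.regular \<theta>(2)] by auto
  have RH: "vset R \<in> Hset \<theta>" if "R \<subseteq> Hset \<theta>0" for R by (rule H.Hset_subset[OF hH]) (use that h in simp)
  \<comment> \<open>One parameter for the definition of internal AP supercompactness, from which
    \<open>el.opair_ran\<close> recovers the seven components.\<close>
  let ?p = "opair h (opair \<mu> (opair w (opair z (opair (vset Q) (opair (vset R1) (vset R2))))))"
  have "?p \<in> Hset \<theta>"
    by (intro H.opair_Hset hH zH RH QH R1H R2H) (use muH wH hs in auto)
  then obtain j M N \<delta> p where N: "small_embedding \<kappa> \<theta> j M"
    "transitive (elts N)" "models_ZFC_minus (elts N)" "elts N \<subseteq> Hset \<theta>"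
    "omega1_approximation (elts N) (Hset \<theta>)" "M \<in> elts N" and p: "p \<in> elts M" "j p = ?p"
    and \<delta>: "\<delta> \<in> elts N" "\<delta> \<in> elts \<kappa>" "elts M = Hset_in (elts N) \<delta>"
    using ap[OF H.regular \<theta>(3)] unfolding AP_witness_def by (smt (verit) imageE)
  interpret el: elementary j "elts M" "Hset \<theta>"
    using N(1) H.pair_closed_Hset unfolding small_embedding_def by unfold_locales auto
  obtain h' p1 where h': "h' \<in> elts M" "j h' = h" and p1: "p1 \<in> elts M"
    "j p1 = opair \<mu> (opair w (opair z (opair (vset Q) (opair (vset R1) (vset R2)))))" by (rule el.opair_ran[OF p])
  obtain \<mu>' p2 where \<mu>': "\<mu>' \<in> elts M" "j \<mu>' = \<mu>" and p2: "p2 \<in> elts M"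
    "j p2 = opair w (opair z (opair (vset Q) (opair (vset R1) (vset R2))))" by (rule el.opair_ran[OF p1])
  obtain w' p3 where w': "w' \<in> elts M" "j w' = w" and p3: "p3 \<in> elts M"
    "j p3 = opair z (opair (vset Q) (opair (vset R1) (vset R2)))" by (rule el.opair_ran[OF p2])
  obtain z' p4 where z': "z' \<in> elts M" "j z' = z" and p4: "p4 \<in> elts M"
    "j p4 = opair (vset Q) (opair (vset R1) (vset R2))" by (rule el.opair_ran[OF p3])
  obtain q' p5 where q': "q' \<in> elts M" "j q' = vset Q" and p5: "p5 \<in> elts M"
    "j p5 = opair (vset R1) (vset R2)" by (rule el.opair_ran[OF p4])
  obtain r1 r2 where r1: "r1 \<in> elts M" "j r1 = vset R1" and r2: "r2 \<in> elts M" "j r2 = vset R2"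
    by (rule el.opair_ran[OF p5])
  interpret A: AP_embedding \<kappa> \<theta>0 \<theta> j M N \<delta> h' \<mu>' w' z' q'
  proof (unfold_locales; (fact)?)
    show "elts (j h') = Hset \<theta>0" "j \<mu>' \<in> Hset \<theta>0" "elts (j w') = range vnat"
      "elts (j z') = insert (j h') (elts (j h'))"
      using h' \<mu>' w' z' h muH w z by auto
    show "elts (j q') = {opair a b |a b. a \<in> elts (j \<mu>') \<and> b \<in> elts (j w')}"
      unfolding q'(2) \<mu>'(2) w'(2) sub[OF QH] unfolding Q_def ..
  qed
  have T_closed: "T l \<subseteq> A.X" if l: "l \<in> lists A.X" for l
  proof
    fix y assume y: "y \<in> T l"
    have lH: "l \<in> lists (Hset \<theta>0)" using l A.X_sub by auto
    have lc: "list_code l \<in> A.X" by (rule A.X_list_code[OF l])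
    have r1i: "opair (list_code l) v \<in> elts (j r1) \<longleftrightarrow> v = \<beta> l" for v
      unfolding r1(2) sub[OF R1H] unfolding R1_def using lH by (auto simp: list_code_inject)
    have "\<exists>v\<in>A.X. opair (list_code l) v \<in> elts (j r1)"
      by (rule A.X_rel[OF r1(1) lc, of "\<beta> l"]) (use r1i \<beta>[OF lH] kH in auto)
    then have "\<beta> l \<in> A.X" using r1i by metis
    \<comment> \<open>The length is in X and below \<kappa>, hence below the critical point, so all
      indices \<xi> are in X and with them all values.\<close>
    then have bc: "\<beta> l \<in> elts A.c" unfolding A.X_Int_kappa[symmetric] using \<beta>[OF lH] by (rule IntI)
    have bX: "\<xi> \<in> A.X" if "\<xi> \<in> elts (\<beta> l)" for \<xi>
      using Ord_trans[OF A.c(2) bc that] unfolding A.X_Int_kappa[symmetric] by (rule IntD1)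
    obtain \<xi> where x: "\<xi> \<in> elts (\<beta> l)" "y = g l \<xi>" using y g[OF lH] by blast
    have oX: "opair (list_code l) \<xi> \<in> A.X" by (rule A.X_opair[OF lc]) (rule bX[OF x(1)])
    have r2i: "opair (opair (list_code l) \<xi>) v \<in> elts (j r2) \<longleftrightarrow> v = g l \<xi>" for v
      unfolding r2(2) sub[OF R2H] unfolding R2_def using lH x by (auto simp: list_code_inject)
    have "\<exists>v\<in>A.X. opair (opair (list_code l) \<xi>) v \<in> elts (j r2)"
      by (rule A.X_rel[OF r2(1) oX, of "g l \<xi>"]) (use r2i gH[OF lH x(1)] in auto)
    then show "y \<in> A.X" using r2i x(2) by metis
  qed
  define X where "X = vset A.X"
  have X: "elts X = A.X" unfolding X_def by (rule elts_vset[OF lesspoll_small[OF A.X_lesspoll]])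
  have XC: "X \<in> C"
  proof (rule TC(2))
    show "X \<in> Pk \<kappa> (Hset \<theta>0)" unfolding X_def by (rule vset_mem_Pk[OF A.X_sub A.X_lesspoll])
    show "closed_under TC (elts X)" unfolding closed_under_def X using T_closed unfolding T_def by blast
  qed
  have ae: "vset (elts X \<inter> elts \<mu>) = A.a" unfolding X \<mu>'(2) ..
  have aP: "A.a \<in> Pk \<kappa> (elts \<mu>)"
    unfolding \<mu>'(2)
    by (rule vset_mem_Pk) (use A.X_lesspoll lesspoll_trans1 subset_imp_lepoll in \<open>blast, metis Int_lower1\<close>)
  have da: "elts (d A.a) \<subseteq> elts A.a" using d(1) aP unfolding Pk_list_def by blast
  obtain D' where D': "D' \<in> elts M" "elts D' \<subseteq> elts \<mu>'" "\<And>\<xi>. \<xi> \<in> elts \<mu>' \<Longrightarrow> \<xi> \<in> elts D' \<longleftrightarrow> j \<xi> \<in> elts (d A.a)"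
    using A.preimage_mem[OF _ da] C(2)[OF XC] unfolding ae unfolding X \<mu>'(2) by blast
  define D where "D = j D'"
  have Dmu: "elts D \<subseteq> elts \<mu>" unfolding D_def using el.j_mono[OF D'(1) \<mu>'(1) D'(2)] \<mu>'(2) by simp
  \<comment> \<open>Being in X, D is a legitimate first entry for T.\<close>
  have DX: "D \<in> A.X"
  proof -
    have "vset (elts D) \<in> Hset \<theta>0" by (rule H0.Hset_subset[OF muH Dmu])
    then show ?thesis unfolding D_def using A.Hset0_iff[OF D'(1)] by simp
  qed
  have "elts (d A.a) = elts D \<inter> elts A.a"
  proof -
    have "elts A.a = j ` elts \<mu>'" by (rule A.elts_a(2))
    moreover have "j \<xi> \<in> elts D \<longleftrightarrow> j \<xi> \<in> elts (d A.a)" if x: "\<xi> \<in> elts \<mu>'" for \<xi>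
      unfolding D_def D'(3)[OF x, symmetric]
      by (rule el.mem_iff[OF subsetD[OF el.elts_dom[OF \<mu>'(1)] x] D'(1)])
    ultimately show ?thesis using da by auto
  qed
  moreover have ea: "elts A.a = A.X \<inter> elts \<mu>" using A.elts_a(1) \<mu>'(2) by metis
  \<comment> \<open>The same a is guessed by D and lies in the club chosen to avoid all sets guessed
    by D.\<close>
  have "A.a \<in> E D"
  proof (rule TD(2)[OF Dmu aP])
    show "closed_under (TD D) (elts A.a)"
      unfolding closed_under_def
    proof
      fix l assume l: "l \<in> lists (elts A.a)"
      then have lm: "l \<in> lists (elts \<mu>)" and "l \<in> lists A.X" unfolding ea by auto
      then have "T (D # l) \<subseteq> A.X" using DX by (intro T_closed) auto
      then have "TD D l \<subseteq> A.X" unfolding T_def using Dmu lm by simp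
      then show "TD D l \<subseteq> elts A.a" unfolding ea using small_opD(1)[OF TD(1)[OF Dmu] lm] by blast
    qed
  qed
  ultimately show False using E(2)[OF Dmu] aP by blast
qed

end

section \<open>Guessing models from ISP\<close>

text \<open>A Skolem function for P with values in A, as a set-valued operation: no value where no
  witness exists.\<close>

definition choice_op :: "'v set \<Rightarrow> ('v list \<Rightarrow> 'v \<Rightarrow> bool) \<Rightarrow> 'v list \<Rightarrow> 'v set" where
  "choice_op A P l = (if \<exists>y\<in>A. P l y then {SOME y. y \<in> A \<and> P l y} else {})"

lemma choice_op_sub: "choice_op A P l \<subseteq> A"
  unfolding choice_op_def by (auto intro: someI2_ex)

lemma finite_choice_op: "finite (choice_op A P l)"
  unfolding choice_op_def by simp

lemma closed_under_choice_op:
  assumes "closed_under (choice_op A P) X" "l \<in> lists X" "y \<in> A" "P l y"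
  shows "\<exists>y\<in>X. P l y"
proof -
  have ex: "\<exists>y\<in>A. P l y" using assms(3,4) by blast
  then have "(SOME y. y \<in> A \<and> P l y) \<in> choice_op A P l" unfolding choice_op_def by simp
  then have "(SOME y. y \<in> A \<and> P l y) \<in> X" by (rule closed_underD[OF assms(1,2)])
  moreover have "P l (SOME y. y \<in> A \<and> P l y)" using someI_ex[of "\<lambda>y. y \<in> A \<and> P l y"] ex by blast
  ultimately show ?thesis by blast
qed

lemma closed_under_Un: "closed_under (\<lambda>l. S l \<union> T l) X \<longleftrightarrow> closed_under S X \<and> closed_under T X"
  unfolding closed_under_def by auto

lemma closed_under_UN: "closed_under (\<lambda>l. \<Union>i\<in>I. T i l) X \<longleftrightarrow> (\<forall>i\<in>I. closed_under (T i) X)"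
  by (auto simp: closed_under_def UN_subset_iff)

context regular_above_omega1
begin

lemma small_op_choice: "small_op A (choice_op A P)"
  by (simp add: small_op_def choice_op_sub finite_lesspoll finite_choice_op)

lemma small_op_Un: "small_op A S \<Longrightarrow> small_op A T \<Longrightarrow> small_op A (\<lambda>l. S l \<union> T l)"
  unfolding small_op_def by (blast intro: regular_Un[OF regular])

lemma small_op_UN:
  assumes "countable I" "\<And>i. i \<in> I \<Longrightarrow> small_op A (T i)"
  shows "small_op A (\<lambda>l. \<Union>i\<in>I. T i l)"
  unfolding small_op_def
proof
  fix l assume l: "l \<in> lists A"
  have "(\<Union>i\<in>I. T i l) \<prec> elts \<kappa>"
    by (rule regular_UN[OF regular countable_lesspoll[OF assms(1)]]) (use assms(2) l small_opD(2) in blast)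
  then show "(\<Union>i\<in>I. T i l) \<subseteq> A \<and> (\<Union>i\<in>I. T i l) \<prec> elts \<kappa>"
    using assms(2) l small_opD(1) by (metis UN_least)
qed

text \<open>Closure under it makes \<open>X \<inter> elts \<kappa>\<close> transitive and all
  countable elements of X subsets of X.\<close>

definition elts_op :: "'v list \<Rightarrow> 'v set" where
  "elts_op l = (if length l = 1 \<and> (hd l \<in> elts \<kappa> \<or> countable (elts (hd l))) then elts (hd l) else {})"

lemma small_op_elts_op: "transitive A \<Longrightarrow> small_op A elts_op"
  unfolding small_op_def
proof
  fix l assume A: "transitive A" and l: "l \<in> lists A"
  have "elts (hd l) \<subseteq> A" if "length l = 1" using that l A unfolding transitive_def by (cases l) auto
  moreover have "elts_op l \<prec> elts \<kappa>"
    unfolding elts_op_def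
    by (auto intro: Card_lesspoll[OF Card] countable_lesspoll finite_lesspoll[OF finite.emptyI])
  ultimately show "elts_op l \<subseteq> A \<and> elts_op l \<prec> elts \<kappa>" unfolding elts_op_def by auto
qed

lemma closed_under_elts_op:
  assumes "closed_under elts_op X" "b \<in> X" "b \<in> elts \<kappa> \<or> countable (elts b)" shows "elts b \<subseteq> X"
proof -
  have "elts_op [b] \<subseteq> X" using assms(1,2) unfolding closed_under_def by auto
  then show ?thesis using assms(3) unfolding elts_op_def by simp
qed

text \<open>The guessing models of Viale and Weiss for \<omega>1. Only countable pieces inside B are
  tested, which is all that approximation provides after pulling back along the collapse.\<close>

definition guessing :: "'v set \<Rightarrow> bool" where
  "guessing X \<longleftrightarrow> (\<forall>B\<in>X. \<forall>A\<subseteq>elts B.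
     (\<forall>b\<in>X. countable (elts b) \<longrightarrow> elts b \<subseteq> elts B \<longrightarrow> vset (A \<inter> elts b) \<in> X) \<longrightarrow>
     (\<exists>A'\<in>X. A \<inter> X = elts A' \<inter> X))"

text \<open>Otherwise the unguessed subsets of the closed \<open>X\<close> form a slender list. If \<open>D\<close> is as in ISP for this
  list, then \<open>D\<close> is covered by an element of \<open>H(\<theta>)\<close>: a function choosing elements of \<open>D\<close> outside every
  \<open>B\<close> would contradict closure under it. So \<open>D \<in> H(\<theta>)\<close>, and it guesses correctly at every \<open>X\<close> containing it.\<close>

lemma guessing_model:
  assumes ISP: "\<And>\<mu>. Card \<mu> \<Longrightarrow> elts \<kappa> \<subseteq> elts \<mu> \<Longrightarrow> ISP \<kappa> \<mu>"
    and \<theta>: "regular_above_omega1 \<theta>" "\<kappa> \<in> elts \<theta>"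
    and T: "small_op (Hset \<theta>) T"
  obtains X where "X \<subseteq> Hset \<theta>" "X \<prec> elts \<kappa>" "closed_under T X" "closed_under elts_op X"
    "\<And>b B. b \<in> X \<Longrightarrow> B \<in> X \<Longrightarrow> vset (elts b \<inter> elts B) \<in> X" "guessing X"
proof (rule ccontr)
  assume no: "\<not> thesis"
  note witness = that
  interpret H: regular_above_omega1 \<theta> by (rule \<theta>(1))
  define K where "K = Hset \<theta>"
  have Kt: "transitive K" unfolding K_def by (rule transitive_Hset)
  define PI where "PI l y \<longleftrightarrow> (\<exists>b B. l = [b, B] \<and> y = vset (elts b \<inter> elts B))" for l :: "'v list" and y
  define T' where "T' l = (T l \<union> elts_op l) \<union> choice_op K PI l" for l
  have T': "small_op K T'"
    unfolding T'_def using T small_op_elts_op[OF Kt] unfolding K_def by (intro small_op_Un small_op_choice)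
  have cl: "closed_under T X" "closed_under elts_op X" "\<And>b B. b \<in> X \<Longrightarrow> B \<in> X \<Longrightarrow> vset (elts b \<inter> elts B) \<in> X"
    if X: "closed_under T' X" "X \<subseteq> K" for X
  proof -
    have c: "closed_under T X" "closed_under elts_op X" "closed_under (choice_op K PI) X"
      using X unfolding T'_def closed_under_Un by auto
    then show "closed_under T X" "closed_under elts_op X" by auto
    fix b B assume b: "b \<in> X" "B \<in> X"
    have "vset (elts b \<inter> elts B) \<in> K" using b(1) X(2) unfolding K_def by (intro H.Hset_subset[of b]) auto
    then have "\<exists>y\<in>X. PI [b, B] y"
      by (rule closed_under_choice_op[OF c(3), rotated]) (use b in \<open>auto simp: PI_def\<close>)
    then show "vset (elts b \<inter> elts B) \<in> X" unfolding PI_def by auto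
  qed
  have "\<forall>X. \<exists>B A. X \<subseteq> K \<and> X \<prec> elts \<kappa> \<and> closed_under T' X \<longrightarrow> B \<in> X \<and> A \<subseteq> elts B \<and>
      (\<forall>b\<in>X. countable (elts b) \<longrightarrow> elts b \<subseteq> elts B \<longrightarrow> vset (A \<inter> elts b) \<in> X) \<and>
      \<not> (\<exists>A'\<in>X. A \<inter> X = elts A' \<inter> X)"
  proof
    fix X
    have "\<not> guessing X" if X: "X \<subseteq> K \<and> X \<prec> elts \<kappa> \<and> closed_under T' X"
    proof
      assume "guessing X"
      then have thesis
        using X cl[of X] by (intro witness[of X]) (simp_all add: K_def)
      then show False using no by blast
    qed
    then show "\<exists>B A. X \<subseteq> K \<and> X \<prec> elts \<kappa> \<and> closed_under T' X \<longrightarrow> B \<in> X \<and> A \<subseteq> elts B \<and>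
      (\<forall>b\<in>X. countable (elts b) \<longrightarrow> elts b \<subseteq> elts B \<longrightarrow> vset (A \<inter> elts b) \<in> X) \<and>
      \<not> (\<exists>A'\<in>X. A \<inter> X = elts A' \<inter> X)" unfolding guessing_def by meson
  qed
  \<comment> \<open>A counterexample to guessing for every closed X: the subset \<open>Af X\<close>
    of the element \<open>Bf X\<close> is approximated in X but not guessed.\<close>
  then obtain Bf Af where bad: "\<And>X. X \<subseteq> K \<Longrightarrow> X \<prec> elts \<kappa> \<Longrightarrow> closed_under T' X \<Longrightarrow> Bf X \<in> X \<and> Af X \<subseteq> elts (Bf X) \<and>
      (\<forall>b\<in>X. countable (elts b) \<longrightarrow> elts b \<subseteq> elts (Bf X) \<longrightarrow> vset (Af X \<inter> elts b) \<in> X) \<and>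
      \<not> (\<exists>A'\<in>X. Af X \<inter> X = elts A' \<inter> X)" by metis
  \<comment> \<open>ISP speaks of lists on a cardinal, so K is indexed by its cardinality through
    the bijection e.\<close>
  obtain \<mu> :: 'v where \<mu>: "Card \<mu>" "elts \<mu> \<approx> K"
    using Card_exists_eqpoll[OF small_Hset[of \<theta>]] unfolding K_def by blast
  then obtain e where e: "bij_betw e (elts \<mu>) K" unfolding eqpoll_def by blast
  define e' where "e' = the_inv_into (elts \<mu>) e"
  have ee: "e' (e \<xi>) = \<xi>" "e \<xi> \<in> K" if "\<xi> \<in> elts \<mu>" for \<xi>
    using e that the_inv_into_f_f[of e "elts \<mu>"] unfolding e'_def bij_betw_def by auto
  have ee': "e (e' y) = y" "e' y \<in> elts \<mu>" if "y \<in> K" for y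
    using e that f_the_inv_into_f[of e "elts \<mu>" y] the_inv_into_into[of e "elts \<mu>" y "elts \<mu>"] unfolding e'_def bij_betw_def by auto
  have kK: "elts \<kappa> \<subseteq> K"
    using Card_mem_Hset[OF H.Card \<theta>(2)] Kt unfolding K_def transitive_def by blast
  have "elts \<kappa> \<lesssim> elts \<mu>" by (rule lepoll_trans2[OF subset_imp_lepoll[OF kK] eqpoll_sym[OF \<mu>(2)]])
  then have k\<mu>: "elts \<kappa> \<subseteq> elts \<mu>" by (rule Card_subset[OF Card \<mu>(1)])
  \<comment> \<open>The pullback of the counterexample along e. The empty default covers those a
    whose image is not closed and for which there is no counterexample.\<close>
  define d where "d a = vset (if closed_under T' (e ` elts a) then {\<xi> \<in> elts a. e \<xi> \<in> Af (e ` elts a)} else {})" for a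
  have d: "elts (d a) = (if closed_under T' (e ` elts a) then {\<xi> \<in> elts a. e \<xi> \<in> Af (e ` elts a)} else {})" for a
    unfolding d_def by (rule elts_vset, rule small_subset[OF small_elts, of _ a]) auto
  have eP: "e ` elts a \<subseteq> K" "e ` elts a \<prec> elts \<kappa>" if "a \<in> Pk \<kappa> (elts \<mu>)" for a
  proof -
    show "e ` elts a \<subseteq> K" using PkD(1)[OF that] ee(2) by blast
    show "e ` elts a \<prec> elts \<kappa>" by (rule lesspoll_trans1[OF image_lepoll PkD(2)[OF that]])
  qed
  have "Pk_list \<kappa> \<mu> d" unfolding Pk_list_def d by auto
  moreover have "slender \<kappa> \<mu> d"
    unfolding slender_def
  proof (rule exI[of _ \<mu>], intro conjI allI impI)
    show "Ord \<mu>" by (rule Card_Ord[OF \<mu>(1)])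
    fix \<theta>2 :: 'v assume t2: "Card \<theta>2 \<and> \<mu> \<in> elts \<theta>2"
    then have m2: "elts \<mu> \<prec> elts \<theta>2" using Card_lesspoll by blast
    have K2: "K \<prec> elts \<theta>2" by (rule eq_lesspoll_trans[OF eqpoll_sym[OF \<mu>(2)] m2])
    have tmu: "transitive (elts \<mu>)" using Card_Ord[OF \<mu>(1)] unfolding Ord_def by blast
    have inH: "y \<in> Hset \<theta>2" if "elts y \<subseteq> elts \<mu> \<or> elts y \<subseteq> K" for y
      using that HsetI[OF tmu _ m2] HsetI[OF Kt _ K2] by blast
    have muH: "elts \<mu> \<subseteq> Hset \<theta>2" using inH tmu unfolding transitive_def by blast
    have KH: "K \<subseteq> Hset \<theta>2" using inH Kt unfolding transitive_def by blast
    \<comment> \<open>\<open>P1\<close> and \<open>P2\<close> ensure that the elements of Y in K are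
      the images of those in \<mu>. \<open>P3\<close> moves the test set b to K, \<open>P4\<close>
      moves the answer back, and \<open>P5\<close> supplies the empty set for the default value of
      d.\<close>
    define P1 where "P1 l y \<longleftrightarrow> (\<exists>\<xi>\<in>elts \<mu>. l = [\<xi>] \<and> y = e \<xi>)" for l y
    define P2 where "P2 l y \<longleftrightarrow> (\<exists>u\<in>K. l = [u] \<and> y = e' u)" for l y
    define P3 where "P3 l y \<longleftrightarrow> (\<exists>b. elts b \<subseteq> elts \<mu> \<and> l = [b] \<and> y = vset (e ` elts b))" for l y
    define P4 where "P4 l y \<longleftrightarrow> (\<exists>b. elts b \<subseteq> K \<and> l = [b] \<and> y = vset (e' ` elts b))" for l y
    define P5 where "P5 l y \<longleftrightarrow> y = vset {}" for l :: "'v list" and y :: 'v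
    define S where "S l = (\<Union>P\<in>{P1, P2, P3, P4, P5}. choice_op (Hset \<theta>2) P l)" for l
    have S: "small_op (Hset \<theta>2) S" unfolding S_def by (intro small_op_UN small_op_choice) simp
    let ?C = "{Y \<in> Pk \<kappa> (Hset \<theta>2). closed_under S (elts Y)}"
    show "\<exists>C. club \<kappa> (Hset \<theta>2) C \<and> (\<forall>X\<in>C. \<forall>b\<in>elts X \<inter> Pk omega1 (elts \<mu>).
              vset (elts b \<inter> elts (d (vset (elts X \<inter> elts \<mu>)))) \<in> elts X)"
    proof (intro exI[of _ ?C] conjI ballI)
      show "club \<kappa> (Hset \<theta>2) ?C" by (rule club_closed_under[OF S])
      fix Y b assume "Y \<in> ?C" and "b \<in> elts Y \<inter> Pk omega1 (elts \<mu>)"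
      then have Y: "Y \<in> Pk \<kappa> (Hset \<theta>2)" and clS: "closed_under S (elts Y)" and bY: "b \<in> elts Y"
        and b: "elts b \<subseteq> elts \<mu>" "countable (elts b)" unfolding Pk_def lesspoll_omega1_iff by auto
      have SP: "\<exists>y\<in>elts Y. P l y" if "P \<in> {P1, P2, P3, P4, P5}" "l \<in> lists (elts Y)" "y \<in> Hset \<theta>2" "P l y" for P l y
      proof (rule closed_under_choice_op[where y = y and l = l and P = P and A = "Hset \<theta>2"])
        show "closed_under (choice_op (Hset \<theta>2) P) (elts Y)"
          using clS that(1) unfolding S_def closed_under_UN by (rule bspec)
      qed (fact that)+
      define a where "a = vset (elts Y \<inter> elts \<mu>)"
      have a: "elts a = elts Y \<inter> elts \<mu>"
        unfolding a_def by (rule elts_vset_subset[of _ \<mu>]) blast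
      have aP: "a \<in> Pk \<kappa> (elts \<mu>)"
        unfolding a_def by (rule vset_mem_Pk[OF Int_lower2 lesspoll_trans1[OF subset_imp_lepoll PkD(2)[OF Y]]]) blast
      define X where "X = e ` elts a"
      have XY: "y \<in> X \<longleftrightarrow> y \<in> elts Y" if "y \<in> K" for y
      proof
        assume "y \<in> X"
        then obtain \<xi> where x: "\<xi> \<in> elts Y" "\<xi> \<in> elts \<mu>" "y = e \<xi>" unfolding X_def a by blast
        have "\<exists>y\<in>elts Y. P1 [\<xi>] y"
          by (rule SP[of P1 _ y]) (use x KH that in \<open>auto simp: P1_def\<close>)
        then show "y \<in> elts Y" unfolding P1_def x(3) by auto
      next
        assume y: "y \<in> elts Y"
        have "\<exists>\<xi>\<in>elts Y. P2 [y] \<xi>"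
          by (rule SP[of P2 _ "e' y"]) (use y that ee'(2) muH in \<open>auto simp: P2_def\<close>)
        then have "e' y \<in> elts Y" unfolding P2_def by auto
        then have "e' y \<in> elts a" unfolding a using ee'(2)[OF that] by blast
        then show "y \<in> X" unfolding X_def using ee'(1)[OF that] by (metis imageI)
      qed
      have XK: "X \<subseteq> K" and Xk: "X \<prec> elts \<kappa>" unfolding X_def by (rule eP[OF aP])+
      have "vset (elts b \<inter> elts (d a)) \<in> elts Y"
      proof (cases "closed_under T' X")
        case False
        then have "elts (d a) = {}" unfolding d X_def by simp
        moreover have "\<exists>y\<in>elts Y. P5 [] y"
          by (rule SP[of P5 _ "vset {}"]) (auto simp: P5_def elts_vset intro: inH)
        ultimately show ?thesis unfolding P5_def by simp
      next
        case True
        note bd = bad[OF XK Xk True]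
        define c where "c = vset (e ` elts b)"
        have c: "elts c = e ` elts b" unfolding c_def by (intro elts_vset small_image small_elts)
        have cs: "elts c \<subseteq> K" unfolding c using b(1) ee(2) by blast
        have cc: "countable (elts c)" unfolding c using b(2) by (rule countable_image)
        have "elts c \<prec> elts \<theta>" by (rule H.countable_lesspoll[OF cc])
        then have cK: "c \<in> K" using cs H.Hset_iff unfolding K_def by blast
        have "\<exists>y\<in>elts Y. P3 [b] y"
          by (rule SP[of P3 _ c]) (use bY b cK KH in \<open>auto simp: P3_def c_def\<close>)
        then have "c \<in> elts Y" unfolding P3_def c_def by auto
        then have cX: "c \<in> X" using XY[OF cK] by blast
        have cX': "elts c \<subseteq> X" by (rule closed_under_elts_op[OF cl(2)[OF True XK] cX disjI2[OF cc]])
        \<comment> \<open>The counterexample answers only for countable subsets of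
          \<open>Bf X\<close>. Intersecting with \<open>Bf X\<close> loses nothing, since
          \<open>Af X\<close> is a subset of it.\<close>
        define c' where "c' = vset (elts c \<inter> elts (Bf X))"
        have c': "elts c' = elts c \<inter> elts (Bf X)"
          unfolding c'_def by (rule elts_vset_subset[of _ c]) blast
        have c'X: "c' \<in> X" unfolding c'_def by (rule cl(3)[OF True XK cX conjunct1[OF bd]])
        define t where "t = vset (Af X \<inter> elts c')"
        have "countable (elts c')" unfolding c' using cc by (rule countable_Int1)
        moreover have "elts c' \<subseteq> elts (Bf X)" unfolding c' by (rule Int_lower2)
        ultimately have tX: "t \<in> X" unfolding t_def using bd c'X by metis
        have t: "elts t = Af X \<inter> elts c"
          unfolding t_def by (subst elts_vset_subset[of _ c']) (use bd c' in auto)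
        have tK: "t \<in> K" using tX XK by blast
        have tY: "t \<in> elts Y" using XY[OF tK] tX by blast
        have tKs: "elts t \<subseteq> K" using t cs by blast
        have e't: "e' ` elts t = elts b \<inter> elts (d a)"
        proof (intro equalityI subsetI)
          fix \<xi> assume "\<xi> \<in> e' ` elts t"
          then obtain \<eta> where h: "\<eta> \<in> elts b" "e \<eta> \<in> Af X" "\<xi> = e' (e \<eta>)" unfolding t c by blast
          have hm: "\<eta> \<in> elts \<mu>" using h(1) b(1) by blast
          then have xe: "\<xi> = \<eta>" using h(3) ee(1) by simp
          have "e \<eta> \<in> X" using h(1) cX' c by blast
          then obtain \<zeta> where "\<zeta> \<in> elts a" "e \<eta> = e \<zeta>" unfolding X_def by blast
          then have "\<eta> \<in> elts a" using ee(1)[OF hm] ee(1)[of \<zeta>] PkD(1)[OF aP] by (metis subsetD)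
          then show "\<xi> \<in> elts b \<inter> elts (d a)" unfolding d xe using h True unfolding X_def by simp
        next
          fix \<xi> assume x: "\<xi> \<in> elts b \<inter> elts (d a)"
          then have "e \<xi> \<in> Af X" using True unfolding d X_def by simp
          then have "e \<xi> \<in> elts t" unfolding t c using x by blast
          then show "\<xi> \<in> e' ` elts t" using ee(1)[of \<xi>] x b(1) by (metis IntD1 imageI subsetD)
        qed
        have "elts (vset (e' ` elts t)) \<subseteq> elts \<mu>"
          using e't b(1) elts_vset[OF small_image[OF small_elts], of e' t] by (metis le_infI1)
        then have "vset (e' ` elts t) \<in> Hset \<theta>2" by (intro inH disjI1)
        then have "\<exists>y\<in>elts Y. P4 [t] y"
          by (rule SP[of P4, rotated 2]) (use tY tKs in \<open>auto simp: P4_def\<close>)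
        then show ?thesis unfolding P4_def e't[symmetric] by auto
      qed
      then show "vset (elts b \<inter> elts (d (vset (elts Y \<inter> elts \<mu>)))) \<in> elts Y" unfolding a_def .
    qed
  qed
  ultimately obtain D where D: "elts D \<subseteq> elts \<mu>"
    and st: "stationary \<kappa> (elts \<mu>) {a \<in> Pk \<kappa> (elts \<mu>). elts (d a) = elts D \<inter> elts a}"
    using ISP[OF \<mu>(1) k\<mu>] unfolding ISP_def by blast
  \<comment> \<open>An operation on K pulls back along e to one on \<mu>, whose closed sets form a
    club that the stationary set meets.\<close>
  have hit: "\<exists>a\<in>Pk \<kappa> (elts \<mu>). elts (d a) = elts D \<inter> elts a \<and> closed_under U (e ` elts a)"
    if U: "small_op K U" for U
  proof -
    define V where "V l = e' ` U (map e l)" for l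
    have me: "map e l \<in> lists K" if "l \<in> lists (elts \<mu>)" for l using that ee(2) by auto
    have "small_op (elts \<mu>) V"
      unfolding small_op_def V_def
    proof (intro ballI conjI)
      fix l assume "l \<in> lists (elts \<mu>)"
      note m = me[OF this]
      show "e' ` U (map e l) \<subseteq> elts \<mu>" using small_opD(1)[OF U m] ee'(2) by blast
      show "e' ` U (map e l) \<prec> elts \<kappa>" by (rule lesspoll_trans1[OF image_lepoll small_opD(2)[OF U m]])
    qed
    then have "club \<kappa> (elts \<mu>) {x \<in> Pk \<kappa> (elts \<mu>). closed_under V (elts x)}" by (rule club_closed_under)
    then obtain a where a: "a \<in> Pk \<kappa> (elts \<mu>)" "elts (d a) = elts D \<inter> elts a" "closed_under V (elts a)"
      using st unfolding stationary_def by blast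
    have "closed_under U (e ` elts a)"
      unfolding closed_under_def
    proof (intro ballI subsetI)
      fix l y assume l: "l \<in> lists (e ` elts a)" and y: "y \<in> U l"
      have sub: "elts a \<subseteq> elts \<mu>" by (rule PkD(1)[OF a(1)])
      have lK: "l \<in> lists K" using l eP(1)[OF a(1)] by auto
      have l': "map e' l \<in> lists (elts a)" using l ee(1) sub by (force simp: in_lists_conv_set)
      have "map e (map e' l) = l" using lK ee'(1) by (auto simp: in_lists_conv_set intro!: map_idI)
      then have "e' y \<in> V (map e' l)" unfolding V_def using y by simp
      then have "e' y \<in> elts a" by (rule closed_underD[OF a(3) l'])
      moreover have "y \<in> K" using small_opD(1)[OF U lK] y by blast
      ultimately show "y \<in> e ` elts a" using ee'(1) by (metis imageI)
    qed
    then show ?thesis using a by blast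
  qed
  have bd: "Af (e ` elts a) \<inter> e ` elts a = e ` elts D \<inter> e ` elts a" "Af (e ` elts a) \<subseteq> elts (Bf (e ` elts a))" "Bf (e ` elts a) \<in> e ` elts a"
    "\<not> (\<exists>A'\<in>e ` elts a. Af (e ` elts a) \<inter> e ` elts a = elts A' \<inter> e ` elts a)"
    if a: "a \<in> Pk \<kappa> (elts \<mu>)" and da: "elts (d a) = elts D \<inter> elts a" and clT: "closed_under T' (e ` elts a)" for a
  proof -
    have sub: "elts a \<subseteq> elts \<mu>" by (rule PkD(1)[OF a])
    have dd: "{\<xi> \<in> elts a. e \<xi> \<in> Af (e ` elts a)} = elts D \<inter> elts a" using da clT unfolding d by simp
    have "e ` {\<xi> \<in> elts a. e \<xi> \<in> Af (e ` elts a)} = Af (e ` elts a) \<inter> e ` elts a" by blast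
    moreover have "e ` (elts D \<inter> elts a) = e ` elts D \<inter> e ` elts a"
      by (rule inj_on_image_Int[of e "elts \<mu>"]) (use e D sub in \<open>auto simp: bij_betw_def\<close>)
    ultimately show "Af (e ` elts a) \<inter> e ` elts a = e ` elts D \<inter> e ` elts a" using dd by simp
    show "Af (e ` elts a) \<subseteq> elts (Bf (e ` elts a))" "Bf (e ` elts a) \<in> e ` elts a"
      "\<not> (\<exists>A'\<in>e ` elts a. Af (e ` elts a) \<inter> e ` elts a = elts A' \<inter> e ` elts a)"
      using bad[OF eP[OF a] clT] by simp_all
  qed
  have "\<exists>B\<in>K. e ` elts D \<subseteq> elts B"
  proof (rule ccontr)
    assume nB: "\<not> ?thesis"
    \<comment> \<open>Closure under this choice puts into X an element of the image of D outside
      \<open>Bf X\<close>. But on X the image of D agrees with \<open>Af X\<close>, a subset of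
      \<open>Bf X\<close>.\<close>
    define PF where "PF l y \<longleftrightarrow> (\<exists>B. l = [B] \<and> y \<in> e ` elts D \<and> y \<notin> elts B)" for l y
    obtain a where a: "a \<in> Pk \<kappa> (elts \<mu>)" "elts (d a) = elts D \<inter> elts a"
      "closed_under T' (e ` elts a)" "closed_under (choice_op K PF) (e ` elts a)"
      using hit[OF small_op_Un[OF T' small_op_choice[of K PF]]] unfolding closed_under_Un by blast
    note b = bd[OF a(1-3)]
    have BK: "Bf (e ` elts a) \<in> K" using b(3) eP(1)[OF a(1)] by blast
    then obtain y where y: "y \<in> e ` elts D" "y \<notin> elts (Bf (e ` elts a))" using nB by blast
    have yK: "y \<in> K" using y(1) D ee(2) by blast
    have "\<exists>y\<in>e ` elts a. PF [Bf (e ` elts a)] y"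
      by (rule closed_under_choice_op[OF a(4) _ yK]) (use b(3) y in \<open>auto simp: PF_def\<close>)
    then obtain y where "y \<in> e ` elts a" "y \<in> e ` elts D" "y \<notin> elts (Bf (e ` elts a))"
      unfolding PF_def by auto
    then show False using b(1,2) by blast
  qed
  then obtain B where B: "B \<in> K" "e ` elts D \<subseteq> elts B" by blast
  define D' where "D' = vset (e ` elts D)"
  have D': "elts D' = e ` elts D" unfolding D'_def by (intro elts_vset small_image small_elts)
  have D'K: "D' \<in> K" using B unfolding D'_def K_def by (rule H.Hset_subset)
  \<comment> \<open>The constant operation with value \<open>D'\<close> forces \<open>D'\<close>
    into X, where it guesses \<open>Af X\<close>, against the choice of \<open>Af\<close>.\<close>
  obtain a where a: "a \<in> Pk \<kappa> (elts \<mu>)" "elts (d a) = elts D \<inter> elts a"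
      "closed_under T' (e ` elts a)" "closed_under (choice_op K (\<lambda>_ y. y = D')) (e ` elts a)"
    using hit[OF small_op_Un[OF T' small_op_choice[of K "\<lambda>_ y. y = D'"]]] unfolding closed_under_Un by blast
  have "D' \<in> e ` elts a" using closed_under_choice_op[OF a(4) _ D'K, of "[]"] by auto
  then have "\<exists>A'\<in>e ` elts a. Af (e ` elts a) \<inter> e ` elts a = elts A' \<inter> e ` elts a"
    using bd(1)[OF a(1-3)] D' by (intro bexI[of _ D']) simp_all
  then show False using bd(4)[OF a(1-3)] by simp
qed

end

section \<open>The collapse of a guessing model\<close>

text \<open>Turns a finite list of parameters into an assignment. The default beyond the list is
  harmless for formulas whose variables are below its length.\<close>

definition env :: "'v::zfc list \<Rightarrow> nat \<Rightarrow> 'v" where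
  "env l i = (if i < length l then l ! i else vset {})"

lemma sat_env1: "sat N \<phi> ((env (map s [0..<var_bound \<phi>]))(n := v)) \<longleftrightarrow> sat N \<phi> (s(n := v))"
  by (rule sat_cong) (simp add: env_def)

lemma sat_env2: "sat N \<phi> ((env (map s [0..<var_bound \<phi>]))(m := u, n := v)) \<longleftrightarrow> sat N \<phi> (s(m := u, n := v))"
  by (rule sat_cong) (simp add: env_def)

lemma Tarski_Vaught:
  assumes sub: "X \<subseteq> K"
    and sk: "\<And>\<phi> n l w. l \<in> lists X \<Longrightarrow> w \<in> K \<Longrightarrow> sat K \<phi> ((env l)(n := w)) \<Longrightarrow> \<exists>w\<in>X. sat K \<phi> ((env l)(n := w))"
  shows "(\<And>i. s i \<in> X) \<Longrightarrow> sat X \<phi> s \<longleftrightarrow> sat K \<phi> s"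
proof (induction \<phi> arbitrary: s)
  case (Neg \<phi>)
  show ?case using Neg.IH[OF Neg.prems] by simp
next
  case (Conj \<phi> \<psi>)
  show ?case using Conj.IH(1)[OF Conj.prems] Conj.IH(2)[OF Conj.prems] by simp
next
  case (Exists n \<phi>)
  have IH: "sat X \<phi> (s(n := w)) \<longleftrightarrow> sat K \<phi> (s(n := w))" if "w \<in> X" for w
    by (rule Exists.IH) (use that Exists.prems in simp)
  define l where "l = map s [0..<var_bound \<phi>]"
  have l: "l \<in> lists X" unfolding l_def using Exists.prems by auto
  have "\<exists>w\<in>X. sat K \<phi> (s(n := w))" if "w \<in> K" "sat K \<phi> (s(n := w))" for w
    using sk[OF l that(1), of \<phi> n] that(2) unfolding l_def sat_env1 .
  then show ?case using IH sub by auto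
qed auto

text \<open>Stated for a subset X' of X because it is needed twice: for X itself, whose image is N,
  and for the part of X in H(\<theta>), whose image is M.\<close>

lemma sat_collapse:
  assumes inj: "inj_on (collapse X) X" and sub: "X' \<subseteq> X"
  shows "(\<And>i. s i \<in> X') \<Longrightarrow> sat (collapse X ` X') \<phi> (collapse X \<circ> s) \<longleftrightarrow> sat X' \<phi> s"
proof (induction \<phi> arbitrary: s)
  case (Mem m n)
  have "s m \<in> X" "s n \<in> X" using Mem sub by blast+
  then show ?case using collapse_mem_iff[OF inj] by simp
next
  case (Eq m n)
  have "s m \<in> X" "s n \<in> X" using Eq sub by blast+
  then show ?case using inj by (simp add: inj_on_eq_iff)
next
  case (Neg \<phi>)
  show ?case using Neg.IH[OF Neg.prems] by simp
next
  case (Conj \<phi> \<psi>)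
  show ?case using Conj.IH(1)[OF Conj.prems] Conj.IH(2)[OF Conj.prems] by simp
next
  case (Exists n \<phi>)
  have "sat (collapse X ` X') \<phi> ((collapse X \<circ> s)(n := collapse X w)) \<longleftrightarrow> sat X' \<phi> (s(n := w))" if "w \<in> X'" for w
  proof -
    have "(collapse X \<circ> s)(n := collapse X w) = collapse X \<circ> (s(n := w))" by auto
    moreover have "sat (collapse X ` X') \<phi> (collapse X \<circ> (s(n := w))) \<longleftrightarrow> sat X' \<phi> (s(n := w))"
      by (rule Exists.IH) (use that Exists.prems in simp)
    ultimately show ?thesis by simp
  qed
  then show ?case unfolding sat.simps by blast
qed

text \<open>In this order: constants; Skolem functions for K; Skolem functions for H; sets given by
  Separation; collecting sets; a witness inside a collecting set; unions; relations induced by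
  injections into the ordinals, for Choice; enumerations of countable sets, for approximation.
  Everything after the Skolem functions gives the witnesses for the axioms and for countability in
  the collapse directly, without writing them as formulas.\<close>

definition closure_preds :: "'v::zfc set \<Rightarrow> 'v set \<Rightarrow> 'v set \<Rightarrow> ('v list \<Rightarrow> 'v \<Rightarrow> bool) set" where
  "closure_preds K H C =
     (\<lambda>c l w. w = c) ` C
     \<union> range (\<lambda>(\<phi>, n) l w. sat K \<phi> ((env l)(n := w)))
     \<union> range (\<lambda>(\<phi>, n) l w. w \<in> H \<and> sat H \<phi> ((env l)(n := w)))
     \<union> range (\<lambda>\<phi> l w. \<exists>a l'. l = a # l' \<and> w = vset {y \<in> elts a. sat K \<phi> ((env l')(0 := y))})
     \<union> range (\<lambda>\<phi> l w. \<exists>a l'. l = a # l' \<and> (\<forall>y\<in>elts a. (\<exists>v\<in>K. sat K \<phi> ((env l')(0 := y, 1 := v)))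
          \<longrightarrow> (\<exists>v\<in>elts w. sat K \<phi> ((env l')(0 := y, 1 := v)))))
     \<union> range (\<lambda>\<phi> l w. \<exists>y b l'. l = y # b # l' \<and> w \<in> elts b \<and> sat K \<phi> ((env l')(0 := y, 1 := w)))
     \<union> {\<lambda>l w. \<exists>a. l = [a] \<and> w = vset (\<Union>y\<in>elts a. elts y)}
     \<union> {\<lambda>l w. \<exists>a (g :: 'v \<Rightarrow> 'v). l = [a] \<and> inj_on g (elts a) \<and> (\<forall>u\<in>elts a. Ord (g u)) \<and>
          elts w = {opair u v |u v. u \<in> elts a \<and> v \<in> elts a \<and> g u \<in> elts (g v)}}
     \<union> {\<lambda>l w. \<exists>b g. l = [b] \<and> inj_on g (elts b) \<and> g ` elts b \<subseteq> range vnat \<and>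
          elts w = (\<lambda>u. opair u (g u)) ` elts b}"

lemma countable_closure_preds: "countable C \<Longrightarrow> countable (closure_preds K H C)"
  unfolding closure_preds_def by simp

locale guessing_collapse = regular_above_omega1 \<kappa> for \<kappa> :: "'v::zfc" +
  fixes \<theta> \<theta>1 x :: 'v and X :: "'v set"
  assumes \<theta>: "regular_above_omega1 \<theta>" "\<kappa> \<in> elts \<theta>"
    and \<theta>1: "regular_above_omega1 \<theta>1" "vset (Hset \<theta>) \<in> Hset \<theta>1"
    and x: "x \<in> Hset \<theta>"
    and X_sub: "X \<subseteq> Hset \<theta>1" and X_lesspoll: "X \<prec> elts \<kappa>"
    and X_closed: "\<And>P l w. P \<in> closure_preds (Hset \<theta>1) (Hset \<theta>) {vset (Hset \<theta>), \<kappa>, \<theta>, x, vset (range vnat)} \<Longrightarrow>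
       l \<in> lists X \<Longrightarrow> w \<in> Hset \<theta>1 \<Longrightarrow> P l w \<Longrightarrow> \<exists>w\<in>X. P l w"
    and X_elts: "\<And>b. b \<in> X \<Longrightarrow> b \<in> elts \<kappa> \<or> countable (elts b) \<Longrightarrow> elts b \<subseteq> X"
    and X_Int: "\<And>b B. b \<in> X \<Longrightarrow> B \<in> X \<Longrightarrow> vset (elts b \<inter> elts B) \<in> X"
    and X_guessing: "guessing X"
begin

sublocale H: regular_above_omega1 \<theta> by (rule \<theta>(1))
sublocale K: regular_above_omega1 \<theta>1 by (rule \<theta>1(1))

abbreviation K where "K \<equiv> Hset \<theta>1"
abbreviation preds where "preds \<equiv> closure_preds K (Hset \<theta>) {vset (Hset \<theta>), \<kappa>, \<theta>, x, vset (range vnat)}"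
definition h where "h = vset (Hset \<theta>)"
definition \<omega> :: 'v where "\<omega> = vset (range vnat)"

lemma elts_h: "elts h = Hset \<theta>"
  unfolding h_def by (rule elts_vset[OF small_Hset])

lemma elts_\<omega>: "elts \<omega> = range vnat"
  unfolding \<omega>_def by (rule elts_vset[OF small_range_vnat])

lemma K_trans: "y \<in> K \<Longrightarrow> elts y \<subseteq> K"
  using transitive_Hset unfolding transitive_def by blast

lemma hK: "h \<in> K" and HK: "Hset \<theta> \<subseteq> K"
proof -
  show "h \<in> K" unfolding h_def by (rule \<theta>1(2))
  then show "Hset \<theta> \<subseteq> K" using K_trans elts_h by blast
qed

lemma \<omega>\<kappa>: "\<omega> \<in> elts \<kappa>"
proof (rule Ord_lesspoll_mem[OF _ Ord])
  show "Ord \<omega>" unfolding \<omega>_def by (rule Ord_omega)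
  show "elts \<omega> \<prec> elts \<kappa>" unfolding elts_\<omega> by (rule countable_lesspoll) simp
qed

lemma \<kappa>H: "\<kappa> \<in> Hset \<theta>"
  by (rule Card_mem_Hset[OF H.Card \<theta>(2)])

lemma \<theta>K: "\<theta> \<in> K"
proof -
  have "elts \<theta> \<subseteq> elts h" unfolding elts_h using Card_mem_Hset[OF H.Card] by blast
  then have "vset (elts \<theta>) \<in> K" by (rule K.Hset_subset[OF hK])
  then show ?thesis by simp
qed

lemma const_mem: "c \<in> {h, \<kappa>, \<theta>, x, \<omega>} \<Longrightarrow> c \<in> X"
proof -
  assume c: "c \<in> {h, \<kappa>, \<theta>, x, \<omega>}"
  have "\<omega> \<in> Hset \<theta>" using \<omega>\<kappa> \<kappa>H transitive_Hset unfolding transitive_def by blast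
  then have cK: "c \<in> K" using c hK \<theta>K \<kappa>H x HK by blast
  have "(\<lambda>l w. w = c) \<in> preds"
    unfolding closure_preds_def using c unfolding h_def \<omega>_def by blast
  from X_closed[OF this _ cK, of "[]"] show "c \<in> X" by simp
qed

lemma skolem:
  assumes "l \<in> lists X" "w \<in> K" "sat K \<phi> ((env l)(n := w))"
  shows "\<exists>w\<in>X. sat K \<phi> ((env l)(n := w))"
proof -
  have "(\<lambda>l w. sat K \<phi> ((env l)(n := w))) \<in> range (\<lambda>(\<phi>, n) l w. sat K \<phi> ((env l)(n := w)))"
    by (rule range_eqI[of _ _ "(\<phi>, n)"]) simp
  then have "(\<lambda>l w. sat K \<phi> ((env l)(n := w))) \<in> preds"
    unfolding closure_preds_def by simp
  from X_closed[OF this assms] show ?thesis .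
qed

lemma skolem_H:
  assumes "l \<in> lists (X \<inter> Hset \<theta>)" "w \<in> Hset \<theta>" "sat (Hset \<theta>) \<phi> ((env l)(n := w))"
  shows "\<exists>w\<in>X \<inter> Hset \<theta>. sat (Hset \<theta>) \<phi> ((env l)(n := w))"
proof -
  let ?P = "\<lambda>l w. w \<in> Hset \<theta> \<and> sat (Hset \<theta>) \<phi> ((env l)(n := w))"
  have "?P \<in> range (\<lambda>(\<phi>, n) l w. w \<in> Hset \<theta> \<and> sat (Hset \<theta>) \<phi> ((env l)(n := w)))"
    by (rule range_eqI[of _ _ "(\<phi>, n)"]) simp
  then have "?P \<in> preds"
    unfolding closure_preds_def by simp
  then have "\<exists>w\<in>X. ?P l w"
    by (rule X_closed[where w = w]) (use assms HK in auto)
  then show ?thesis by blast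
qed

lemma sat_X: "(\<And>i. s i \<in> X) \<Longrightarrow> sat X \<phi> s \<longleftrightarrow> sat K \<phi> s"
  by (rule Tarski_Vaught[OF X_sub skolem])

lemma sat_X_H: "(\<And>i. s i \<in> X \<inter> Hset \<theta>) \<Longrightarrow> sat (X \<inter> Hset \<theta>) \<phi> s \<longleftrightarrow> sat (Hset \<theta>) \<phi> s"
  by (rule Tarski_Vaught[OF Int_lower2 skolem_H])

text \<open>A Skolem function for "belongs to exactly one of the two" finds a difference inside X.
  So the collapse of X is injective.\<close>

lemma X_ext:
  assumes u: "u \<in> X" and v: "v \<in> X" and eq: "elts u \<inter> X = elts v \<inter> X" shows "u = v"
proof (rule ccontr)
  assume "u \<noteq> v"
  then obtain w where w: "w \<in> elts u \<longleftrightarrow> w \<notin> elts v" using extensionality by blast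
  then have wK: "w \<in> K" using u v X_sub K_trans by blast
  let ?\<phi> = "Neg (Iff_fm (Mem 2 0) (Mem 2 1))"
  have e: "sat K ?\<phi> ((env [u, v])(2 := w)) \<longleftrightarrow> (w \<in> elts u \<longleftrightarrow> w \<notin> elts v)" for w
    by (simp add: env_def)
  have "\<exists>w\<in>X. sat K ?\<phi> ((env [u, v])(2 := w))"
    by (rule skolem[OF _ wK]) (use u v w in \<open>simp_all only: e lists.intros\<close>)
  then show False unfolding e using eq by blast
qed

abbreviation \<pi> where "\<pi> \<equiv> collapse X"

lemma \<pi>_inj: "inj_on \<pi> X"
  by (rule collapse_inj) (rule X_ext)

definition N where "N = vset (\<pi> ` X)"

lemma elts_N: "elts N = \<pi> ` X"
  unfolding N_def by (intro elts_vset small_image lesspoll_small[OF X_lesspoll])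

lemma trans_N: "transitive (elts N)"
  unfolding elts_N by (rule transitive_collapse_image)

definition j where "j = inv_into X \<pi>"

lemma j_\<pi> [simp]: "u \<in> X \<Longrightarrow> j (\<pi> u) = u"
  unfolding j_def by (rule inv_into_f_f[OF \<pi>_inj])

lemma \<pi>_j [simp]: "v \<in> elts N \<Longrightarrow> \<pi> (j v) = v"
  unfolding j_def elts_N by (rule f_inv_into_f)

lemma j_mem: "v \<in> elts N \<Longrightarrow> j v \<in> X"
  unfolding j_def elts_N by (rule inv_into_into)

lemma \<pi>_mem: "u \<in> X \<Longrightarrow> \<pi> u \<in> elts N"
  unfolding elts_N by blast

lemma elem_K: "elementary_embedding j (elts N) K"
  unfolding elementary_embedding_def
proof (intro conjI allI impI)
  show "j ` elts N \<subseteq> K" using j_mem X_sub by blast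
  fix \<phi> and s :: "nat \<Rightarrow> 'v" assume s: "range s \<subseteq> elts N"
  then have js: "(j \<circ> s) i \<in> X" for i using j_mem by auto
  have "\<pi> \<circ> (j \<circ> s) = s" using s by (auto simp: fun_eq_iff image_subset_iff)
  then have "sat (elts N) \<phi> s \<longleftrightarrow> sat (\<pi> ` X) \<phi> (\<pi> \<circ> (j \<circ> s))" unfolding elts_N by simp
  also have "\<dots> \<longleftrightarrow> sat X \<phi> (j \<circ> s)" by (rule sat_collapse[OF \<pi>_inj subset_refl js])
  also have "\<dots> \<longleftrightarrow> sat K \<phi> (j \<circ> s)" by (rule sat_X[OF js])
  finally show "sat (elts N) \<phi> s \<longleftrightarrow> sat K \<phi> (j \<circ> s)" .
qed

sublocale elementary j "elts N" K
  by unfold_locales (rule elem_K trans_N K.pair_closed_Hset)+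

lemma ext_N: "v \<in> elts N \<Longrightarrow> ext (elts N) v = elts v"
  by (rule ext_transitive[OF trans_N])

lemma mem_\<pi>: "v \<in> elts N \<Longrightarrow> u \<in> X \<Longrightarrow> v \<in> elts (\<pi> u) \<longleftrightarrow> j v \<in> elts u"
  using mem_iff[of v "\<pi> u"] \<pi>_mem by simp

lemma sat_N: "(\<And>i. s i \<in> elts N) \<Longrightarrow> sat (elts N) \<phi> s \<longleftrightarrow> sat K \<phi> (j \<circ> s)"
  by (rule elementary_sat[OF elem_K])

lemma sat_N1:
  assumes "\<And>i. s i \<in> elts N" "v \<in> elts N"
  shows "sat (elts N) \<phi> (s(m := v)) \<longleftrightarrow> sat K \<phi> ((env (map (j \<circ> s) [0..<var_bound \<phi>]))(m := j v))"
proof -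
  have "j \<circ> (s(m := v)) = (j \<circ> s)(m := j v)" by auto
  moreover have "sat (elts N) \<phi> (s(m := v)) \<longleftrightarrow> sat K \<phi> (j \<circ> (s(m := v)))"
    by (rule sat_N) (use assms in simp)
  ultimately show ?thesis unfolding sat_env1 by simp
qed

lemma sat_N2:
  assumes "\<And>i. s i \<in> elts N" "v \<in> elts N" "w \<in> elts N"
  shows "sat (elts N) \<phi> (s(m := v, n := w)) \<longleftrightarrow>
    sat K \<phi> ((env (map (j \<circ> s) [0..<var_bound \<phi>]))(m := j v, n := j w))"
proof -
  have "j \<circ> (s(m := v, n := w)) = (j \<circ> s)(m := j v, n := j w)" by auto
  moreover have "sat (elts N) \<phi> (s(m := v, n := w)) \<longleftrightarrow> sat K \<phi> (j \<circ> (s(m := v, n := w)))"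
    by (rule sat_N) (use assms in simp)
  ultimately show ?thesis unfolding sat_env2 by simp
qed

section \<open>The axioms of ZFC without Power Set in the collapse\<close>

lemma N_separation:
  assumes s: "range s \<subseteq> elts N" and a: "a \<in> elts N"
  shows "\<exists>b\<in>elts N. ext (elts N) b = {v \<in> ext (elts N) a. sat (elts N) \<phi> (s(0 := v))}"
proof -
  have s': "s i \<in> elts N" for i using s by blast
  define l where "l = map (j \<circ> s) [0..<var_bound \<phi>]"
  \<comment> \<open>The set defined over K. Closure puts it into X, and by elementarity its collapse
    is the set defined over N.\<close>
  define w where "w = vset {y \<in> elts (j a). sat K \<phi> ((env l)(0 := y))}"
  have l: "j a # l \<in> lists X" unfolding l_def using j_mem[OF a] j_mem[OF s'] by auto
  have w: "elts w = {y \<in> elts (j a). sat K \<phi> ((env l)(0 := y))}"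
    unfolding w_def by (rule elts_vset_subset[of _ "j a"]) blast
  have wK: "w \<in> K"
    unfolding w_def by (rule K.Hset_subset[of "j a"]) (use in_cod[OF a] in auto)
  let ?P = "\<lambda>l w. \<exists>a l'. l = a # l' \<and> w = vset {y \<in> elts a. sat K \<phi> ((env l')(0 := y))}"
  have "?P \<in> preds"
    unfolding closure_preds_def by blast
  then have "\<exists>w\<in>X. ?P (j a # l) w" by (rule X_closed[OF _ l wK]) (use w_def in blast)
  then have wX: "w \<in> X" unfolding w_def by auto
  have "elts (\<pi> w) = {v \<in> elts a. sat (elts N) \<phi> (s(0 := v))}"
  proof -
    have "v \<in> elts (\<pi> w) \<longleftrightarrow> v \<in> elts a \<and> sat (elts N) \<phi> (s(0 := v))" if v: "v \<in> elts N" for v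
      unfolding mem_\<pi>[OF v wX] w sat_N1[OF s' v] l_def using mem_iff[OF v a] by simp
    then show ?thesis using elts_dom[OF \<pi>_mem[OF wX]] elts_dom[OF a] by blast
  qed
  then show ?thesis using \<pi>_mem[OF wX] ext_N a by (intro bexI[of _ "\<pi> w"]) simp_all
qed

lemma N_collection:
  assumes s: "range s \<subseteq> elts N" and a: "a \<in> elts N"
    and ex: "\<forall>v\<in>ext (elts N) a. \<exists>y\<in>elts N. sat (elts N) \<phi> (s(0 := v, 1 := y))"
  shows "\<exists>b\<in>elts N. \<forall>v\<in>ext (elts N) a. \<exists>y\<in>ext (elts N) b. sat (elts N) \<phi> (s(0 := v, 1 := y))"
proof -
  have s': "s i \<in> elts N" for i using s by blast
  define l where "l = map (j \<circ> s) [0..<var_bound \<phi>]"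
  have l: "l \<in> lists X" unfolding l_def using j_mem[OF s'] by auto
  define R where "R y v \<longleftrightarrow> sat K \<phi> ((env l)(0 := y, 1 := v))" for y v
  define F where "F y = (SOME v. v \<in> K \<and> R y v)" for y
  define A where "A = {y \<in> elts (j a). \<exists>v\<in>K. R y v}"
  have F: "F y \<in> K \<and> R y (F y)" if "y \<in> A" for y
    using that someI_ex[of "\<lambda>v. v \<in> K \<and> R y v"] unfolding A_def F_def by blast
  have "elts (j a) \<prec> elts \<theta>1" by (rule Hset_lesspoll[OF in_cod[OF a]])
  then have "F ` A \<prec> elts \<theta>1"
    by (rule lesspoll_trans1[rotated]) (rule lepoll_trans[OF image_lepoll subset_imp_lepoll], auto simp: A_def)
  then have w0: "vset (F ` A) \<in> K" "elts (vset (F ` A)) = F ` A"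
    using F by (auto intro!: K.vset_mem_Hset elts_vset K.lesspoll_small)
  let ?P = "\<lambda>l w. \<exists>a l'. l = a # l' \<and> (\<forall>y\<in>elts a. (\<exists>v\<in>K. sat K \<phi> ((env l')(0 := y, 1 := v)))
          \<longrightarrow> (\<exists>v\<in>elts w. sat K \<phi> ((env l')(0 := y, 1 := v))))"
  have "?P \<in> preds"
    unfolding closure_preds_def by blast
  then have "\<exists>w\<in>X. ?P (j a # l) w"
  proof (rule X_closed[OF _ _ w0(1)])
    show "j a # l \<in> lists X" using l j_mem[OF a] by simp
    have "\<exists>v\<in>elts (vset (F ` A)). R y v" if "y \<in> elts (j a)" "\<exists>v\<in>K. R y v" for y
      using F[of y] that w0(2) unfolding A_def by auto
    then show "?P (j a # l) (vset (F ` A))" unfolding R_def by blast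
  qed
  then obtain w where w: "w \<in> X" "\<And>y. y \<in> elts (j a) \<Longrightarrow> \<exists>v\<in>K. R y v \<Longrightarrow> \<exists>v\<in>elts w. R y v"
    unfolding R_def by auto
  have "\<exists>y\<in>ext (elts N) (\<pi> w). sat (elts N) \<phi> (s(0 := v, 1 := y))" if v: "v \<in> ext (elts N) a" for v
  proof -
    have va: "v \<in> elts a" using v ext_N[OF a] by simp
    have vN: "v \<in> elts N" using va elts_dom[OF a] by blast
    obtain y where y: "y \<in> elts N" "sat (elts N) \<phi> (s(0 := v, 1 := y))" using ex v by blast
    have "R (j v) (j y)" using y(2) unfolding sat_N2[OF s' vN y(1)] R_def l_def .
    moreover have "j v \<in> elts (j a)" using va mem_iff[OF vN a] by simp
    ultimately obtain u where u: "u \<in> elts w" "R (j v) u" using w(2) in_cod[OF y(1)] by blast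
    \<comment> \<open>The collecting set w is in X but need not be a subset of X, so a witness in w
      has to be found once more, now in X.\<close>
    let ?Q = "\<lambda>l w. \<exists>y b l'. l = y # b # l' \<and> w \<in> elts b \<and> sat K \<phi> ((env l')(0 := y, 1 := w))"
    have uK: "u \<in> K" using u(1) w(1) X_sub K_trans by blast
    have "?Q \<in> preds"
      unfolding closure_preds_def by blast
    then have "\<exists>u\<in>X. ?Q (j v # w # l) u"
    proof (rule X_closed[OF _ _ uK])
      show "j v # w # l \<in> lists X" using l j_mem[OF vN] w(1) by simp
      show "?Q (j v # w # l) u" using u unfolding R_def by blast
    qed
    then obtain u where u: "u \<in> X" "u \<in> elts w" "R (j v) u" unfolding R_def by auto
    have "sat (elts N) \<phi> (s(0 := v, 1 := \<pi> u))"
      unfolding sat_N2[OF s' vN \<pi>_mem[OF u(1)]] using u(3) unfolding R_def l_def j_\<pi>[OF u(1)] .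
    moreover have "\<pi> u \<in> ext (elts N) (\<pi> w)"
      unfolding ext_N[OF \<pi>_mem[OF w(1)]] using collapse_mem_iff[OF \<pi>_inj u(1) w(1)] u(2) by simp
    ultimately show ?thesis by blast
  qed
  then show ?thesis using \<pi>_mem[OF w(1)] by blast
qed

lemma N_union:
  assumes a: "a \<in> elts N"
  shows "\<exists>z\<in>elts N. ext (elts N) z = (\<Union>y\<in>ext (elts N) a. ext (elts N) y)"
proof -
  define w where "w = vset (\<Union>y\<in>elts (j a). elts y)"
  have aK: "j a \<in> K" by (rule in_cod[OF a])
  have w: "elts w = (\<Union>y\<in>elts (j a). elts y)" unfolding w_def by (intro elts_vset small_UN small_elts)
  have "(\<Union>y\<in>elts (j a). elts y) \<prec> elts \<theta>1"
  proof (rule regular_UN[OF K.regular Hset_lesspoll[OF aK]])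
    fix y assume "y \<in> elts (j a)"
    then have "y \<in> K" using K_trans[OF aK] by blast
    then show "elts y \<prec> elts \<theta>1" by (rule Hset_lesspoll)
  qed
  moreover have "(\<Union>y\<in>elts (j a). elts y) \<subseteq> K" using K_trans K_trans[OF aK] by blast
  ultimately have wK: "w \<in> K" unfolding w_def by (intro K.vset_mem_Hset)
  let ?P = "\<lambda>l w. \<exists>a. l = [a] \<and> w = vset (\<Union>y\<in>elts a. elts y)"
  have "?P \<in> preds"
    unfolding closure_preds_def by blast
  then have "\<exists>w\<in>X. ?P [j a] w" by (rule X_closed[OF _ _ wK]) (use j_mem[OF a] in \<open>auto simp: w_def\<close>)
  then have wX: "w \<in> X" unfolding w_def by auto
  have "v \<in> elts (\<pi> w) \<longleftrightarrow> (\<exists>y\<in>elts a. v \<in> elts y)" if v: "v \<in> elts N" for v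
  proof -
    let ?\<phi> = "Exists 2 (Conj (Mem 2 0) (Mem 1 2))"
    have "v \<in> elts (\<pi> w) \<longleftrightarrow> (\<exists>y\<in>elts (j a). j v \<in> elts y)" unfolding mem_\<pi>[OF v wX] w by simp
    also have "\<dots> \<longleftrightarrow> (\<exists>y\<in>K. y \<in> elts (j a) \<and> j v \<in> elts y)" using K_trans[OF aK] by blast
    also have "\<dots> \<longleftrightarrow> (\<exists>y\<in>elts N. y \<in> elts a \<and> v \<in> elts y)"
      using elementary_sat3[OF elem_K a v v, of ?\<phi>] by simp
    also have "\<dots> \<longleftrightarrow> (\<exists>y\<in>elts a. v \<in> elts y)" using elts_dom[OF a] by blast
    finally show ?thesis .
  qed
  note w_iff = this
  have "elts (\<pi> w) = (\<Union>y\<in>elts a. elts y)"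
  proof (intro equalityI subsetI)
    fix v assume v: "v \<in> elts (\<pi> w)"
    then have "v \<in> elts N" using elts_dom[OF \<pi>_mem[OF wX]] by blast
    then show "v \<in> (\<Union>y\<in>elts a. elts y)" using w_iff v by blast
  next
    fix v assume "v \<in> (\<Union>y\<in>elts a. elts y)"
    then obtain y where y: "y \<in> elts a" "v \<in> elts y" by blast
    have "y \<in> elts N" using y(1) elts_dom[OF a] by blast
    then have "v \<in> elts N" using y(2) elts_dom by blast
    then show "v \<in> elts (\<pi> w)" using w_iff y by blast
  qed
  moreover have "(\<Union>y\<in>elts a. ext (elts N) y) = (\<Union>y\<in>elts a. elts y)"
    by (rule SUP_cong[OF refl]) (use elts_dom[OF a] ext_N in blast)
  ultimately show ?thesis
    using \<pi>_mem[OF wX] ext_N a by (intro bexI[of _ "\<pi> w"]) simp_all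
qed

lemma Int_\<kappa>_transitive: "transitive (X \<inter> elts \<kappa>)"
  unfolding transitive_def using X_elts Ord_trans[OF Ord] by blast

lemma \<pi>_fixes: "\<beta> \<in> X \<Longrightarrow> \<beta> \<in> elts \<kappa> \<Longrightarrow> \<pi> \<beta> = \<beta>"
  by (rule collapse_fixes[OF Int_\<kappa>_transitive]) auto

lemma \<pi>_\<omega>: "\<pi> \<omega> = \<omega>" "\<omega> \<in> elts N" "\<omega> \<in> X"
proof -
  show "\<omega> \<in> X" by (rule const_mem) simp
  then show "\<pi> \<omega> = \<omega>" by (rule \<pi>_fixes[OF _ \<omega>\<kappa>])
  then show "\<omega> \<in> elts N" using \<pi>_mem[OF \<open>\<omega> \<in> X\<close>] by simp
qed

lemma N_infinity:
  "\<exists>z\<in>elts N. (\<exists>e\<in>ext (elts N) z. ext (elts N) e = {}) \<and>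
     (\<forall>y\<in>ext (elts N) z. \<exists>s\<in>ext (elts N) z. ext (elts N) s = insert y (ext (elts N) y))"
proof (rule bexI[OF _ \<pi>_\<omega>(2)])
  have n: "ext (elts N) (vnat n) = elts (vnat n)" for n
    by (rule ext_N) (use elts_dom[OF \<pi>_\<omega>(2)] elts_\<omega> in blast)
  have "ext (elts N) (vnat 0) = {}" unfolding n elts_vnat by simp
  moreover have "ext (elts N) (vnat (Suc n)) = insert (vnat n) (ext (elts N) (vnat n))" for n
    unfolding n elts_vnat by (simp add: lessThan_Suc del: vnat.simps)
  ultimately show "(\<exists>e\<in>ext (elts N) \<omega>. ext (elts N) e = {}) \<and>
     (\<forall>y\<in>ext (elts N) \<omega>. \<exists>s\<in>ext (elts N) \<omega>. ext (elts N) s = insert y (ext (elts N) y))"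
    unfolding ext_N[OF \<pi>_\<omega>(2)] elts_\<omega> by (metis (no_types, lifting) rangeE rangeI)
qed

text \<open>The relation taken from X is induced by an injection g into the ordinals. So in the
  collapse it is truly well-founded, in particular with respect to the subsets b that are in
  N.\<close>

lemma N_choice:
  assumes a: "a \<in> elts N" shows "\<exists>r\<in>elts N. well_orders_in (elts N) r a"
proof -
  have aK: "j a \<in> K" by (rule in_cod[OF a])
  obtain \<alpha> :: 'v where "Ord \<alpha>" "elts \<alpha> \<approx> elts (j a)" using Ord_exists_eqpoll[of "elts (j a)"] by auto
  then obtain g where g: "bij_betw g (elts (j a)) (elts \<alpha>)" and O: "Ord \<alpha>"
    using eqpoll_sym unfolding eqpoll_def by blast
  define W where "W = {opair u v |u v. u \<in> elts (j a) \<and> v \<in> elts (j a) \<and> g u \<in> elts (g v)}"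
  have aks: "elts (j a) \<subseteq> K" by (rule K_trans[OF aK])
  have "W \<subseteq> (\<lambda>(u, v). opair u v) ` (elts (j a) \<times> elts (j a))" unfolding W_def by auto
  then have W: "W \<prec> elts \<theta>1"
    by (rule lesspoll_trans1[OF subset_image_lepoll lesspoll_Card_Times[OF K.Card K.infinite Hset_lesspoll[OF aK] Hset_lesspoll[OF aK]]])
  have "W \<subseteq> K" unfolding W_def using K.opair_Hset aks by blast
  then have wK: "vset W \<in> K" by (rule K.vset_mem_Hset[OF _ W])
  have eW: "elts (vset W) = W" by (rule elts_vset[OF K.lesspoll_small[OF W]])
  let ?P = "\<lambda>l w. \<exists>a (g :: 'v \<Rightarrow> 'v). l = [a] \<and> inj_on g (elts a) \<and> (\<forall>u\<in>elts a. Ord (g u)) \<and>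
          elts w = {opair u v |u v. u \<in> elts a \<and> v \<in> elts a \<and> g u \<in> elts (g v)}"
  have "?P \<in> preds"
    unfolding closure_preds_def by blast
  then have "\<exists>w\<in>X. ?P [j a] w"
  proof (rule X_closed[OF _ _ wK])
    show "[j a] \<in> lists X" using j_mem[OF a] by simp
    have "inj_on g (elts (j a))" "\<forall>u\<in>elts (j a). Ord (g u)"
      using g O Ord_mem unfolding bij_betw_def by blast+
    then show "?P [j a] (vset W)"
      by (intro exI[of _ "j a"] exI[of _ g] conjI) (simp_all only: eW[unfolded W_def] W_def)
  qed
  then obtain w and g :: "'v \<Rightarrow> 'v" where w: "w \<in> X" "inj_on g (elts (j a))" "\<And>u. u \<in> elts (j a) \<Longrightarrow> Ord (g u)"
    "elts w = {opair u v |u v. u \<in> elts (j a) \<and> v \<in> elts (j a) \<and> g u \<in> elts (g v)}" by auto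
  have rN: "\<pi> w \<in> elts N" by (rule \<pi>_mem[OF w(1)])
  have aN: "u \<in> elts N" if "u \<in> elts a" for u using that elts_dom[OF a] by blast
  have ja: "j u \<in> elts (j a)" if "u \<in> elts a" for u using mem_iff[OF aN[OF that] a] that by simp
  have r: "rel_in (elts N) (\<pi> w) u v \<longleftrightarrow> g (j u) \<in> elts (g (j v))" if u: "u \<in> elts a" and v: "v \<in> elts a" for u v
  proof -
    have p: "opair u v \<in> elts N" by (rule pair_closed_opair[OF pair_dom aN[OF u] aN[OF v]])
    have "rel_in (elts N) (\<pi> w) u v \<longleftrightarrow> opair u v \<in> elts (\<pi> w)" by (rule rel_in_iff[OF pair_dom rN aN[OF u] aN[OF v]])
    also have "\<dots> \<longleftrightarrow> opair (j u) (j v) \<in> elts w" unfolding mem_\<pi>[OF p w(1)] j_opair[OF aN[OF u] aN[OF v]] ..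
    also have "\<dots> \<longleftrightarrow> g (j u) \<in> elts (g (j v))" unfolding w(4) using ja u v by auto
    finally show ?thesis .
  qed
  have lin: "u = v \<or> g (j u) \<in> elts (g (j v)) \<or> g (j v) \<in> elts (g (j u))" if u: "u \<in> elts a" and v: "v \<in> elts a" for u v
    using Ord_linear[OF w(3)[OF ja[OF u]] w(3)[OF ja[OF v]]] w(2) ja u v eq_iff[OF aN[OF u] aN[OF v]]
    by (metis inj_onD)
  have "well_orders_in (elts N) (\<pi> w) a"
    unfolding well_orders_in_def ext_N[OF a]
  proof (intro conjI ballI impI)
    fix u assume u: "u \<in> elts a"
    show "\<not> rel_in (elts N) (\<pi> w) u u" unfolding r[OF u u] by (rule mem_irrefl)
  next
    fix u v t assume u: "u \<in> elts a" and v: "v \<in> elts a" and t: "t \<in> elts a"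
      and "rel_in (elts N) (\<pi> w) u v \<and> rel_in (elts N) (\<pi> w) v t"
    then show "rel_in (elts N) (\<pi> w) u t"
      unfolding r[OF u v] r[OF v t] r[OF u t] using Ord_trans[OF w(3)[OF ja[OF t]]] by blast
  next
    fix u v assume u: "u \<in> elts a" and v: "v \<in> elts a"
    show "u = v \<or> rel_in (elts N) (\<pi> w) u v \<or> rel_in (elts N) (\<pi> w) v u"
      unfolding r[OF u v] r[OF v u] by (rule lin[OF u v])
  next
    fix b assume b: "b \<in> elts N" and "ext (elts N) b \<subseteq> elts a \<and> ext (elts N) b \<noteq> {}"
    then have ba: "elts b \<subseteq> elts a" and ne: "elts b \<noteq> {}" unfolding ext_N[OF b] by auto
    then obtain u where "u \<in> elts b" by blast
    \<comment> \<open>The least ordinal value on b gives the least element of b.\<close>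
    then obtain y where y: "\<exists>u\<in>elts b. y = g (j u)" "\<And>z. z \<in> elts y \<Longrightarrow> \<not> (\<exists>u\<in>elts b. z = g (j u))"
      using elts_minimal[of "\<lambda>y. \<exists>u\<in>elts b. y = g (j u)" "g (j u)"] by blast
    then obtain m where m: "m \<in> elts b" "y = g (j m)" by blast
    have "v = m \<or> rel_in (elts N) (\<pi> w) m v" if v: "v \<in> elts b" for v
    proof -
      have "m \<in> elts a" "v \<in> elts a" using m(1) v ba by blast+
      then show ?thesis using lin[of v m] r[of m v] y(2)[of "g (j v)"] v m(2) by blast
    qed
    then show "\<exists>m\<in>ext (elts N) b. \<forall>y\<in>ext (elts N) b. y = m \<or> rel_in (elts N) (\<pi> w) m y"
      unfolding ext_N[OF b] using m(1) by blast
  qed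
  then show ?thesis using rN by blast
qed

lemma N_model: "models_ZFC_minus (elts N)"
  unfolding models_ZFC_minus_def
proof (intro conjI)
  show "\<forall>x\<in>elts N. \<forall>y\<in>elts N. ext (elts N) x = ext (elts N) y \<longrightarrow> x = y"
    using ext_N extensionality by metis
  show "\<forall>x\<in>elts N. ext (elts N) x \<noteq> {} \<longrightarrow> (\<exists>y\<in>ext (elts N) x. ext (elts N) y \<inter> ext (elts N) x = {})"
  proof (intro ballI impI)
    fix a assume a: "a \<in> elts N" "ext (elts N) a \<noteq> {}"
    then have "elts a \<noteq> {}" using ext_N by simp
    from foundation[OF this] obtain y where y: "y \<in> elts a" "elts y \<inter> elts a = {}" by (rule bexE)
    have "y \<in> elts N" using y(1) elts_dom[OF a(1)] by blast
    then show "\<exists>y\<in>ext (elts N) a. ext (elts N) y \<inter> ext (elts N) a = {}"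
      using y ext_N[OF a(1)] ext_N[of y] by (intro bexI[of _ y]) simp_all
  qed
  show "\<forall>x\<in>elts N. \<forall>y\<in>elts N. \<exists>z\<in>elts N. ext (elts N) z = {x, y}"
  proof (intro ballI)
    fix u v assume "u \<in> elts N" "v \<in> elts N"
    then have p: "vset {u, v} \<in> elts N" using pair_dom unfolding pair_closed_def by blast
    show "\<exists>z\<in>elts N. ext (elts N) z = {u, v}"
      by (rule bexI[OF _ p]) (simp add: ext_N[OF p] elts_vset)
  qed
  show "\<forall>x\<in>elts N. \<exists>z\<in>elts N. ext (elts N) z = (\<Union>y\<in>ext (elts N) x. ext (elts N) y)"
    using N_union by (intro ballI)
  show "\<forall>\<phi> s. range s \<subseteq> elts N \<longrightarrow>
        (\<forall>a\<in>elts N. \<exists>b\<in>elts N. ext (elts N) b = {x \<in> ext (elts N) a. sat (elts N) \<phi> (s(0 := x))})"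
    using N_separation by (intro allI impI ballI)
  show "\<forall>\<phi> s. range s \<subseteq> elts N \<longrightarrow>
        (\<forall>a\<in>elts N. (\<forall>x\<in>ext (elts N) a. \<exists>y\<in>elts N. sat (elts N) \<phi> (s(0 := x, 1 := y))) \<longrightarrow>
           (\<exists>b\<in>elts N. \<forall>x\<in>ext (elts N) a. \<exists>y\<in>ext (elts N) b. sat (elts N) \<phi> (s(0 := x, 1 := y))))"
    using N_collection by (intro allI impI ballI)
  show "\<forall>a\<in>elts N. \<exists>r\<in>elts N. well_orders_in (elts N) r a"
    using N_choice by (intro ballI)
qed (rule N_infinity)

text \<open>Pulled back to a subset of \<open>j B\<close>, the set A is approximated in X: a
  countable b in X collapses to a set countable in N, whose intersection with A is in N by
  assumption. The element of X that guesses the pullback collapses to A.\<close>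

lemma N_approximation: "omega1_approximation (elts N) (Hset \<theta>)"
  unfolding omega1_approximation_def
proof (intro ballI impI)
  fix A assume "A \<in> Hset \<theta>" and "(\<exists>B\<in>elts N. elts A \<subseteq> elts B) \<and>
        (\<forall>x\<in>elts N. countable_in (elts N) x \<longrightarrow> vset (elts A \<inter> elts x) \<in> elts N)"
  then obtain B where B: "B \<in> elts N" "elts A \<subseteq> elts B"
    and ap: "\<And>y. y \<in> elts N \<Longrightarrow> countable_in (elts N) y \<Longrightarrow> vset (elts A \<inter> elts y) \<in> elts N" by blast
  define A0 where "A0 = {u \<in> elts (j B). u \<in> X \<and> \<pi> u \<in> elts A}"
  have "vset (A0 \<inter> elts b) \<in> X"
    if b: "b \<in> X" and cb: "countable (elts b)" and bB: "elts b \<subseteq> elts (j B)" for b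
  proof -
    have bX: "elts b \<subseteq> X" by (rule X_elts[OF b disjI2[OF cb]])
    have bK: "b \<in> K" using b X_sub by blast
    have "elts b \<lesssim> range (vnat :: nat \<Rightarrow> 'v)"
    proof -
      have "elts b \<lesssim> (UNIV :: nat set)" using cb unfolding countable_def lepoll_def by auto
      also have "\<dots> \<lesssim> range (vnat :: nat \<Rightarrow> 'v)"
        unfolding lepoll_def by (rule exI[of _ vnat]) (simp add: inj_on_def vnat_inject)
      finally show ?thesis .
    qed
    then obtain g :: "'v \<Rightarrow> 'v" where g: "inj_on g (elts b)" "g ` elts b \<subseteq> range vnat" unfolding lepoll_def by blast
    \<comment> \<open>K contains an enumeration of b, hence X contains one, and its collapse shows
      in N that the collapse of b is countable.\<close>
    define f where "f = vset ((\<lambda>u. opair u (g u)) ` elts b)"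
    have f: "elts f = (\<lambda>u. opair u (g u)) ` elts b" unfolding f_def by (intro elts_vset small_image small_elts)
    have \<omega>K: "\<omega> \<in> K" using \<pi>_\<omega>(3) X_sub by blast
    have "(\<lambda>u. opair u (g u)) ` elts b \<subseteq> K"
    proof (rule image_subsetI)
      fix u assume u: "u \<in> elts b"
      have "g u \<in> elts \<omega>" using u g(2) elts_\<omega> by blast
      then show "opair u (g u) \<in> K" using u K_trans[OF bK] K_trans[OF \<omega>K] by (intro K.opair_Hset) blast+
    qed
    then have fK: "f \<in> K"
      unfolding f_def by (rule K.vset_mem_Hset) (rule lesspoll_trans1[OF image_lepoll Hset_lesspoll[OF bK]])
    let ?P = "\<lambda>l w. \<exists>b g. l = [b] \<and> inj_on g (elts b) \<and> g ` elts b \<subseteq> range vnat \<and>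
          elts w = (\<lambda>u. opair u (g u)) ` elts b"
    have "?P \<in> preds"
      unfolding closure_preds_def by blast
    then have "\<exists>w\<in>X. ?P [b] w" by (rule X_closed[OF _ _ fK]) (use b f g in auto)
    then obtain f g where fX: "f \<in> X" and g: "inj_on g (elts b)" "g ` elts b \<subseteq> elts \<omega>"
      "elts f = (\<lambda>u. opair u (g u)) ` elts b" unfolding elts_\<omega> by auto
    have "injection_in K f b \<omega>"
      using injection_in_iff[OF pair_cod _ bK \<omega>K] fX X_sub g by blast
    then have "injection_in (elts N) (\<pi> f) (\<pi> b) \<omega>"
      using injection_iff[OF \<pi>_mem[OF fX] \<pi>_mem[OF b] \<pi>_\<omega>(2)] fX b \<pi>_\<omega> j_\<pi>[OF \<pi>_\<omega>(3)] by simp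
    moreover have "omega_in (elts N) \<omega>" using omega_in_iff[OF trans_N \<pi>_\<omega>(2)] elts_\<omega> by blast
    ultimately have "countable_in (elts N) (\<pi> b)"
      unfolding countable_in_def using \<pi>_\<omega>(2) \<pi>_mem[OF fX] by blast
    then have cN: "vset (elts A \<inter> elts (\<pi> b)) \<in> elts N" by (rule ap[OF \<pi>_mem[OF b]])
    \<comment> \<open>The preimage of the piece of A; on b it agrees with \<open>A0\<close>, so
      \<open>X_Int\<close> puts the piece of \<open>A0\<close> into X.\<close>
    define c where "c = j (vset (elts A \<inter> elts (\<pi> b)))"
    have c: "c \<in> X" "elts (\<pi> c) = elts A \<inter> elts (\<pi> b)"
      unfolding c_def using j_mem[OF cN] \<pi>_j[OF cN] elts_vset[OF small_subset[OF small_elts Int_lower1]] by auto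
    have "u \<in> A0 \<longleftrightarrow> u \<in> elts c" if u: "u \<in> elts b" for u
    proof -
      have uX: "u \<in> X" using u bX by blast
      have "u \<in> elts c \<longleftrightarrow> \<pi> u \<in> elts (\<pi> c)" using collapse_mem_iff[OF \<pi>_inj uX c(1)] by simp
      also have "\<dots> \<longleftrightarrow> \<pi> u \<in> elts A" unfolding c(2) using collapse_mem_iff[OF \<pi>_inj uX b] u by simp
      finally show ?thesis unfolding A0_def using uX u bB by blast
    qed
    then have "A0 \<inter> elts b = elts c \<inter> elts b" by blast
    then show ?thesis using X_Int[OF c(1) b] by simp
  qed
  moreover have "A0 \<subseteq> elts (j B)" unfolding A0_def by blast
  ultimately obtain A' where A': "A' \<in> X" "A0 \<inter> X = elts A' \<inter> X"
    using X_guessing j_mem[OF B(1)] unfolding guessing_def by meson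
  have "elts (\<pi> A') = elts A"
  proof -
    have "A0 \<inter> X = A0" unfolding A0_def by blast
    then have "elts (\<pi> A') = \<pi> ` A0" unfolding elts_collapse A'(2)[symmetric] by simp
    also have "\<dots> = elts A"
    proof (intro equalityI subsetI)
      fix v assume v: "v \<in> elts A"
      then have vN: "v \<in> elts N" and vB: "v \<in> elts B" using B elts_dom by blast+
      have "j v \<in> A0" unfolding A0_def using j_mem[OF vN] v vN mem_iff[OF vN B(1)] vB by simp
      then show "v \<in> \<pi> ` A0" using \<pi>_j[OF vN] by (metis imageI)
    qed (auto simp: A0_def)
    finally show ?thesis .
  qed
  then have "\<pi> A' = A" by (rule extensionality)
  then show "A \<in> elts N" using \<pi>_mem[OF A'(1)] by simp
qed

section \<open>The small embedding and the cardinal \<delta>\<close>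

definition M where "M = \<pi> h"

lemma hX: "h \<in> X" and \<kappa>X: "\<kappa> \<in> X" and \<theta>X: "\<theta> \<in> X" and xX: "x \<in> X"
  by (rule const_mem; simp)+

lemma M_mem: "M \<in> elts N"
  unfolding M_def by (rule \<pi>_mem[OF hX])

lemma elts_M: "elts M = \<pi> ` (X \<inter> Hset \<theta>)"
  unfolding M_def elts_collapse elts_h by (simp add: Int_commute)

lemma mem_M: "v \<in> elts N \<Longrightarrow> v \<in> elts M \<longleftrightarrow> j v \<in> Hset \<theta>"
  unfolding M_def using mem_\<pi>[OF _ hX] elts_h by simp

lemma trans_M: "transitive (elts M)"
  unfolding transitive_def
proof (intro ballI subsetI)
  fix u v assume u: "u \<in> elts M" and v: "v \<in> elts u"
  have uN: "u \<in> elts N" using u elts_dom[OF M_mem] by blast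
  then have vN: "v \<in> elts N" using v elts_dom by blast
  have "j v \<in> elts (j u)" using mem_iff[OF vN uN] v by simp
  moreover have "j u \<in> Hset \<theta>" using mem_M[OF uN] u by simp
  ultimately have "j v \<in> Hset \<theta>" using transitive_Hset unfolding transitive_def by blast
  then show "v \<in> elts M" using mem_M[OF vN] by simp
qed

text \<open>Truth in H(\<theta>) is not truth in K, so elementarity here rests on the separate
  Skolem functions for H(\<theta>) and not on \<open>elem_K\<close>.\<close>

lemma elem_M: "elementary_embedding j (elts M) (Hset \<theta>)"
  unfolding elementary_embedding_def
proof (intro conjI allI impI)
  show "j ` elts M \<subseteq> Hset \<theta>" unfolding elts_M by auto
  fix \<phi> and s :: "nat \<Rightarrow> 'v" assume s: "range s \<subseteq> elts M"
  have js: "(j \<circ> s) i \<in> X \<inter> Hset \<theta>" for i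
  proof -
    have "s i \<in> elts M" using s by blast
    then obtain u where "u \<in> X \<inter> Hset \<theta>" "s i = \<pi> u" unfolding elts_M by blast
    then show ?thesis by simp
  qed
  have "range s \<subseteq> elts N" using s elts_dom[OF M_mem] by blast
  then have "\<pi> \<circ> (j \<circ> s) = s" by (auto simp: fun_eq_iff image_subset_iff)
  then have "sat (elts M) \<phi> s \<longleftrightarrow> sat (\<pi> ` (X \<inter> Hset \<theta>)) \<phi> (\<pi> \<circ> (j \<circ> s))" unfolding elts_M by simp
  also have "\<dots> \<longleftrightarrow> sat (X \<inter> Hset \<theta>) \<phi> (j \<circ> s)" by (rule sat_collapse[OF \<pi>_inj Int_lower1 js])
  also have "\<dots> \<longleftrightarrow> sat (Hset \<theta>) \<phi> (j \<circ> s)" by (rule sat_X_H[OF js])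
  finally show "sat (elts M) \<phi> s \<longleftrightarrow> sat (Hset \<theta>) \<phi> (j \<circ> s)" .
qed

lemma N_lesspoll: "elts N \<prec> elts \<kappa>"
  unfolding elts_N by (rule lesspoll_trans1[OF image_lepoll X_lesspoll])

lemma N_sub_H: "elts N \<subseteq> Hset \<theta>"
proof
  fix v assume "v \<in> elts N"
  then have "elts v \<subseteq> elts N" by (rule elts_dom)
  moreover have "elts N \<prec> elts \<theta>" by (rule lesspoll_trans[OF N_lesspoll Card_lesspoll[OF H.Card \<theta>(2)]])
  ultimately show "v \<in> Hset \<theta>" by (rule HsetI[OF trans_N])
qed

definition c where "c = \<pi> \<kappa>"

text \<open>The part of X below \<kappa> is transitive and hence fixed by the collapse, so \<kappa>
  is sent to exactly this part, an ordinal below \<kappa> because X is small.\<close>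

lemma c: "elts c = X \<inter> elts \<kappa>" "Ord c" "c \<in> elts \<kappa>" "c \<in> elts M" "j c = \<kappa>"
proof -
  have "elts c = \<pi> ` (elts \<kappa> \<inter> X)" unfolding c_def by (rule elts_collapse)
  also have "\<dots> = (\<lambda>u. u) ` (elts \<kappa> \<inter> X)" by (rule image_cong) (auto intro: \<pi>_fixes)
  finally show e: "elts c = X \<inter> elts \<kappa>" by auto
  show O: "Ord c" unfolding c_def by (rule Ord_collapse[OF Ord])
  have "elts c \<prec> elts \<kappa>" unfolding e by (rule lesspoll_trans1[OF subset_imp_lepoll X_lesspoll]) blast
  then show "c \<in> elts \<kappa>" by (rule Ord_lesspoll_mem[OF O Ord])
  show "c \<in> elts M" unfolding elts_M c_def using \<kappa>X \<kappa>H by blast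
  show "j c = \<kappa>" unfolding c_def by (rule j_\<pi>[OF \<kappa>X])
qed

lemma crit_M: "crit j (elts M) = c" and nontrivial_M: "nontrivial j (elts M)"
proof -
  have cj: "c \<in> elts (j c)" using c by simp
  show "nontrivial j (elts M)" unfolding nontrivial_def using c cj by blast
  have least: "elts c \<subseteq> elts \<beta>" if b: "\<beta> \<in> elts M" "Ord \<beta>" "\<beta> \<in> elts (j \<beta>)" for \<beta>
  proof -
    have "\<beta> \<notin> elts c"
    proof
      assume "\<beta> \<in> elts c"
      then have bX: "\<beta> \<in> X" "\<beta> \<in> elts \<kappa>" using c(1) by auto
      then have "j \<beta> = \<beta>" using j_\<pi>[OF bX(1)] \<pi>_fixes[OF bX] by simp
      then show False using b(3) mem_irrefl[of \<beta>] by simp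
    qed
    then show ?thesis using Ord_linear[OF c(2) b(2)] Ord_subset_iff[OF c(2) b(2)] by blast
  qed
  show "crit j (elts M) = c"
    unfolding crit_def
  proof (rule the_equality)
    show "c \<in> elts M \<and> Ord c \<and> c \<in> elts (j c) \<and> (\<forall>\<beta>\<in>elts M. Ord \<beta> \<and> \<beta> \<in> elts (j \<beta>) \<longrightarrow> elts c \<subseteq> elts \<beta>)"
      using c cj least by blast
    fix \<alpha> assume a: "\<alpha> \<in> elts M \<and> Ord \<alpha> \<and> \<alpha> \<in> elts (j \<alpha>) \<and> (\<forall>\<beta>\<in>elts M. Ord \<beta> \<and> \<beta> \<in> elts (j \<beta>) \<longrightarrow> elts \<alpha> \<subseteq> elts \<beta>)"
    then have "elts \<alpha> \<subseteq> elts c" using c cj by blast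
    moreover have "elts c \<subseteq> elts \<alpha>" using a least by blast
    ultimately show "\<alpha> = c" by (intro extensionality equalityI)
  qed
qed

lemma small_embedding_M: "small_embedding \<kappa> \<theta> j M"
proof -
  have "M \<in> Hset \<theta>" using M_mem N_sub_H by blast
  then show ?thesis
    unfolding small_embedding_def crit_M using Card H.Card \<theta>(2) trans_M elem_M nontrivial_M c(5) by blast
qed

definition \<delta> where "\<delta> = \<pi> \<theta>"

lemma \<delta>_mem: "\<delta> \<in> elts N" "j \<delta> = \<theta>" "\<delta> \<in> elts \<kappa>" "Ord \<delta>"
proof -
  show d: "\<delta> \<in> elts N" unfolding \<delta>_def by (rule \<pi>_mem[OF \<theta>X])
  show "j \<delta> = \<theta>" unfolding \<delta>_def by (rule j_\<pi>[OF \<theta>X])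
  show O: "Ord \<delta>" unfolding \<delta>_def by (rule Ord_collapse[OF H.Ord])
  have "elts \<delta> \<prec> elts \<kappa>" by (rule lesspoll_trans1[OF subset_imp_lepoll[OF elts_dom[OF d]] N_lesspoll])
  then show "\<delta> \<in> elts \<kappa>" by (rule Ord_lesspoll_mem[OF O Ord])
qed

text \<open>A bijection in N from a smaller ordinal would be carried by j to one in K between
  \<theta> and an ordinal below \<theta>.\<close>

lemma Card_in_\<delta>: "Card_in (elts N) \<delta>"
  unfolding Card_in_def
proof (intro conjI ballI notI)
  show "Ord_in (elts N) \<delta>" using Ord_in_iff[OF trans_N \<delta>_mem(1)] \<delta>_mem(4) by simp
  fix \<alpha> assume "\<alpha> \<in> ext (elts N) \<delta>" and "\<exists>f\<in>elts N. bijection_in (elts N) f \<alpha> \<delta>"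
  then obtain f where a: "\<alpha> \<in> elts \<delta>" and f: "f \<in> elts N" "bijection_in (elts N) f \<alpha> \<delta>"
    unfolding ext_N[OF \<delta>_mem(1)] by blast
  have aN: "\<alpha> \<in> elts N" using a elts_dom[OF \<delta>_mem(1)] by blast
  have "sat (elts N) (bijection_fm 0 1 2) ((\<lambda>_. \<delta>)(0 := f, 1 := \<alpha>)) \<longleftrightarrow> bijection_in (elts N) f \<alpha> \<delta>"
    by (subst sat_bijection_fm) (use f aN \<delta>_mem in auto)
  moreover have "sat K (bijection_fm 0 1 2) ((\<lambda>_. j \<delta>)(0 := j f, 1 := j \<alpha>)) \<longleftrightarrow> bijection_in K (j f) (j \<alpha>) (j \<delta>)"
    by (subst sat_bijection_fm) (use f aN \<delta>_mem(1) in_cod in auto)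
  ultimately have "bijection_in K (j f) (j \<alpha>) \<theta>"
    using elementary_sat3[OF elem_K f(1) aN \<delta>_mem(1)] f(2) \<delta>_mem(2) by simp
  then have "elts (j \<alpha>) \<approx> elts \<theta>"
    using bijection_in_iff[OF pair_cod in_cod[OF f(1)] in_cod[OF aN] \<theta>K] unfolding eqpoll_def by blast
  moreover have "j \<alpha> \<in> elts \<theta>" using mem_iff[OF aN \<delta>_mem(1)] a \<delta>_mem(2) by simp
  ultimately show False using H.Card unfolding Card_def by blast
qed

text \<open>K computes H(\<theta>) correctly because it contains the transitive closures of its
  elements and the graphs of functions between them.\<close>

lemma Hset_in_K: "Hset_in K \<theta> = Hset \<theta>"
proof (intro equalityI subsetI)
  fix y assume "y \<in> Hset_in K \<theta>"
  then obtain t \<alpha> f where y: "y \<in> K" and t: "t \<in> K" "TC_in K y t" and a: "\<alpha> \<in> elts \<theta>"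
    and f: "f \<in> K" "bijection_in K f t \<alpha>"
    unfolding Hset_in_def ext_transitive[OF transitive_Hset \<theta>K] by blast
  have aK: "\<alpha> \<in> K" using a K_trans[OF \<theta>K] by blast
  have "vset (TC y) \<in> K"
  proof (rule HsetI[of "TC y"])
    show "TC y \<prec> elts \<theta>1" using y unfolding Hset_def by blast
  qed (simp_all add: transitive_TC elts_vset)
  then have "elts t = TC y" using TC_in_iff[OF transitive_Hset y t(1)] t(2) by simp
  moreover have "elts t \<approx> elts \<alpha>" using bijection_in_iff[OF pair_cod f(1) t(1) aK] f(2) unfolding eqpoll_def by blast
  ultimately have "TC y \<prec> elts \<theta>" using eq_lesspoll_trans[OF _ Card_lesspoll[OF H.Card a]] by metis
  then show "y \<in> Hset \<theta>" unfolding Hset_def by simp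
next
  fix y assume y: "y \<in> Hset \<theta>"
  then have yK: "y \<in> K" using HK by blast
  have "TC y \<prec> elts \<theta>" using y unfolding Hset_def by simp
  then obtain \<alpha> where a: "\<alpha> \<in> elts \<theta>" "elts \<alpha> \<approx> TC y" using lesspoll_Card[OF _ H.Card] by metis
  define t where "t = vset (TC y)"
  have t: "elts t = TC y" unfolding t_def by (simp add: elts_vset)
  have tK: "t \<in> K"
  proof (rule HsetI[of "TC y"])
    show "TC y \<prec> elts \<theta>1" using yK unfolding Hset_def by blast
  qed (simp_all add: transitive_TC t)
  obtain g where g: "bij_betw g (elts t) (elts \<alpha>)" using eqpoll_sym[OF a(2)] unfolding t eqpoll_def by blast
  have aK: "\<alpha> \<in> K" using a(1) K_trans[OF \<theta>K] by blast
  define f where "f = vset ((\<lambda>u. opair u (g u)) ` elts t)"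
  have f: "elts f = (\<lambda>u. opair u (g u)) ` elts t" unfolding f_def by (intro elts_vset small_image small_elts)
  have "(\<lambda>u. opair u (g u)) ` elts t \<subseteq> K"
  proof
    fix p assume "p \<in> (\<lambda>u. opair u (g u)) ` elts t"
    then obtain u where u: "u \<in> elts t" "p = opair u (g u)" by blast
    have "g u \<in> elts \<alpha>" using u(1) g unfolding bij_betw_def by blast
    then have "g u \<in> K" "u \<in> K" using u(1) K_trans[OF aK] K_trans[OF tK] by blast+
    then show "p \<in> K" unfolding u(2) by (intro K.opair_Hset)
  qed
  then have fK: "f \<in> K"
    unfolding f_def by (rule K.vset_mem_Hset) (rule lesspoll_trans1[OF image_lepoll Hset_lesspoll[OF tK]])
  have "bijection_in K f t \<alpha>" using bijection_in_iff[OF pair_cod fK tK aK] g f by blast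
  moreover have "TC_in K y t" using TC_in_iff[OF transitive_Hset yK tK] tK t unfolding t_def by simp
  ultimately show "y \<in> Hset_in K \<theta>"
    unfolding Hset_in_def ext_transitive[OF transitive_Hset \<theta>K] using yK tK a(1) fK by blast
qed

text \<open>Membership in H(\<theta>) as computed in K is expressed by \<open>Hset_fm\<close>, and
  elementarity of j from N to K transfers it to H(\<delta>) of N.\<close>

lemma elts_M_Hset_in: "elts M = Hset_in (elts N) \<delta>"
proof -
  have "v \<in> Hset_in (elts N) \<delta> \<longleftrightarrow> v \<in> elts M" if v: "v \<in> elts N" for v
  proof -
    have "sat (elts N) (Hset_fm 0 1) ((\<lambda>_. \<delta>)(0 := v, 1 := \<delta>)) \<longleftrightarrow> v \<in> Hset_in (elts N) \<delta>"
      by (subst sat_Hset_fm) (use v \<delta>_mem in auto)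
    moreover have "sat K (Hset_fm 0 1) ((\<lambda>_. j \<delta>)(0 := j v, 1 := j \<delta>)) \<longleftrightarrow> j v \<in> Hset_in K (j \<delta>)"
      by (subst sat_Hset_fm) (use v \<delta>_mem(1) in_cod in auto)
    ultimately have "v \<in> Hset_in (elts N) \<delta> \<longleftrightarrow> j v \<in> Hset_in K \<theta>"
      using elementary_sat3[OF elem_K v \<delta>_mem(1) \<delta>_mem(1)] \<delta>_mem(2) by simp
    then show ?thesis unfolding Hset_in_K using mem_M[OF v] by simp
  qed
  moreover have "Hset_in (elts N) \<delta> \<subseteq> elts N" unfolding Hset_in_def by blast
  moreover have "elts M \<subseteq> elts N" by (rule elts_dom[OF M_mem])
  ultimately show ?thesis by blast
qed

lemma AP_witness: "AP_witness \<kappa> \<theta> x"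
proof -
  have "\<pi> x \<in> elts M" unfolding elts_M using x xX by blast
  then have "x \<in> j ` elts M" using j_\<pi>[OF xX] by (metis imageI)
  moreover have "\<exists>\<delta>\<in>elts N. Card_in (elts N) \<delta> \<and> \<delta> \<in> elts \<kappa> \<and> elts M = Hset_in (elts N) \<delta>"
    by (rule bexI[OF _ \<delta>_mem(1)]) (intro conjI Card_in_\<delta> \<delta>_mem(3) elts_M_Hset_in)
  ultimately show ?thesis
    unfolding AP_witness_def
    using small_embedding_M trans_N N_model N_sub_H N_approximation M_mem
    by (intro exI[of _ j] exI[of _ M] exI[of _ N] conjI)
qed

end

context regular_above_omega1
begin

lemma ISP_imp_AP_supercompact:
  assumes ISP: "\<And>\<mu>. Card \<mu> \<Longrightarrow> elts \<kappa> \<subseteq> elts \<mu> \<Longrightarrow> ISP \<kappa> \<mu>"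
  shows "internally_AP_supercompact \<kappa>"
  unfolding internally_AP_supercompact_iff
\<comment> \<open>Every regular \<theta> above \<kappa> works, so \<kappa> is the threshold.\<close>
proof (rule conjI[OF Card], rule exI[of _ \<kappa>], rule conjI[OF Ord], intro allI impI ballI)
  fix \<theta> x assume t: "regular \<theta> \<and> \<kappa> \<in> elts \<theta>" and x: "x \<in> Hset \<theta>"
  have O\<theta>: "Ord \<theta>" using t regular_Card Card_Ord by blast
  have th: "regular_above_omega1 \<theta>"
    using t Ord_trans[OF O\<theta> _ omega1_mem] unfolding regular_above_omega1_def by blast
  interpret H: regular_above_omega1 \<theta> by (rule th)
  define h where "h = vset (Hset \<theta>)"
  have h: "elts h = Hset \<theta>" unfolding h_def by (rule elts_vset[OF small_Hset])
  \<comment> \<open>Large enough for H(\<theta>) to be an element of H(\<theta>1).\<close>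
  obtain \<theta>1 :: 'v where t1: "regular \<theta>1" "elts h \<prec> elts \<theta>1" using regular_exists[of h] by blast
  have O1: "Ord \<theta>1" using t1 regular_Card Card_Ord by blast
  have "elts \<theta> \<subseteq> elts h" unfolding h using Card_mem_Hset[OF H.Card] by blast
  then have "elts \<theta> \<prec> elts \<theta>1" by (rule lesspoll_trans1[OF subset_imp_lepoll t1(2)])
  then have \<theta>\<theta>1: "\<theta> \<in> elts \<theta>1" by (rule Ord_lesspoll_mem[OF O\<theta> O1])
  then have k1: "\<kappa> \<in> elts \<theta>1" using t Ord_trans[OF O1] by blast
  have th1: "regular_above_omega1 \<theta>1"
    using t1(1) Ord_trans[OF O1 k1 omega1_mem] unfolding regular_above_omega1_def by blast
  have hK: "vset (Hset \<theta>) \<in> Hset \<theta>1"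
    unfolding h_def[symmetric] by (rule HsetI[OF _ subset_refl t1(2)]) (simp add: h transitive_Hset)
  define PP where "PP = closure_preds (Hset \<theta>1) (Hset \<theta>) {vset (Hset \<theta>), \<kappa>, \<theta>, x, vset (range vnat)}"
  have "countable PP" unfolding PP_def by (rule countable_closure_preds) simp
  then have "small_op (Hset \<theta>1) (\<lambda>l. \<Union>P\<in>PP. choice_op (Hset \<theta>1) P l)"
    by (rule small_op_UN[OF _ small_op_choice])
  from guessing_model[OF ISP th1 k1 this] obtain X where X: "X \<subseteq> Hset \<theta>1" "X \<prec> elts \<kappa>"
    and cl: "closed_under (\<lambda>l. \<Union>P\<in>PP. choice_op (Hset \<theta>1) P l) X" "closed_under elts_op X"
    and Int: "\<And>b B. b \<in> X \<Longrightarrow> B \<in> X \<Longrightarrow> vset (elts b \<inter> elts B) \<in> X" and g: "guessing X" by metis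
  have clP: "closed_under (choice_op (Hset \<theta>1) P) X" if "P \<in> PP" for P
    using cl(1) that unfolding closed_under_UN by (rule bspec)
  interpret K: regular_above_omega1 \<theta>1 by (rule th1)
  interpret guessing_collapse \<kappa> \<theta> \<theta>1 x X
  proof (unfold_locales; (fact)?)
    show "\<kappa> \<in> elts \<theta>" using t by blast
    show "\<exists>w\<in>X. P l w"
      if "P \<in> closure_preds (Hset \<theta>1) (Hset \<theta>) {vset (Hset \<theta>), \<kappa>, \<theta>, x, vset (range vnat)}"
        "l \<in> lists X" "w \<in> Hset \<theta>1" "P l w" for P l w
      by (rule closed_under_choice_op[OF clP[unfolded PP_def, OF that(1)] that(2-4)])
    show "elts b \<subseteq> X" if "b \<in> X" "b \<in> elts \<kappa> \<or> countable (elts b)" for b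
      by (rule closed_under_elts_op[OF cl(2) that])
  qed
  show "AP_witness \<kappa> \<theta> x" by (rule AP_witness)
qed

end

theorem lemma7p4:
  fixes \<kappa> :: "'v::zfc"
  assumes "regular \<kappa>" and "omega1 \<in> elts \<kappa>"
  shows "internally_AP_supercompact \<kappa> \<longleftrightarrow>
    (\<forall>\<mu>. Card \<mu> \<and> elts \<kappa> \<subseteq> elts \<mu> \<longrightarrow> ISP \<kappa> \<mu>)"
proof -
  interpret regular_above_omega1 \<kappa> by unfold_locales (rule assms)+
  show ?thesis using AP_supercompact_imp_ISP ISP_imp_AP_supercompact by blast
qed

end
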